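(* Let $\Omega\subset\mathbb{P}^n$ be a properly convex, strictly convex open set with $C^1$ boundary which admits a non-compact quotient of finite volume. If the boundary $\partial\Omega$ is of class $C^{1+\varepsilon}$ for every $0<\varepsilon<1$, then $\Omega$ is an ellipsoid.
   Context: $\mathbb{P}^n$ is real projective space. An open set $\Omega\subset\mathbb{P}^n$ is properly convex if its closure lies in an affine chart in which $\Omega$ is convex; it is strictly convex if $\partial\Omega$ contains no nontrivial segment. The Hilbert metric of $\Omega$ is given by the Finsler norm $F(x,v)=\frac{|v|}{2}\left(\frac1{|xx^-|}+\frac1{|xx^+|}\right)$, where $x^{\pm}$ are the points where the half-lines from $x$ in the directions $\pm v$ meet $\partial\Omega$ and $|\cdot|$ is a Euclidean norm on an affine chart containing $\overline\Omega$. The Busemann volume is $\mathrm{Vol}_\Omega(A)=\int_A \frac{v_n}{\mathrm{Vol}(\{v: F(x,v)<1\})}\,d\mathrm{Vol}(x)$, with $\mathrm{Vol}$ Lebesgue measure of the chart and $v_n$ the volume of the Euclidean unit ball. $\mathrm{Aut}(\Omega)=\{g\in \mathrm{SL}_{n+1}(\mathbb{R}): g\Omega=\Omega\}$ preserves $F$ and $\mathrm{Vol}_\Omega$. "$\Omega$ admits a non-compact quotient of finite volume" means that there is a discrete subgroup $\Gamma$ of $\mathrm{Aut}(\Omega)$ such that $\Omega/\Gamma$ is non-compact and has finite volume for the measure induced by $\mathrm{Vol}_\Omega$. A $C^1$ function $f:U\to\mathbb{R}$ on an open set $U\subset\mathbb{R}^m$ is of class $C^{1+\varepsilon}$ if there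 is $C>0$ with $|f(x)-f(y)-d_xf(y-x)|\leq C|x-y|^{1+\varepsilon}$ for all $x,y\in U$. $\partial\Omega$ is of class $C^{1+\varepsilon}$ if it is locally, in affine charts, the graph of such functions. *)

theory Defs
  imports "HOL-Analysis.Analysis" "HOL-Algebra.Group"
begin

text \<open>
  Projective space \<open>P\<^sup>n\<close>, with \<open>n = CARD('n)\<close>, is the type of lines through the origin of
  \<open>\<real>\<^sup>n\<^sup>+\<^sup>1\<close>; the homogeneous coordinates are indexed by \<open>'n option\<close>.
\<close>

type_synonym 'n hvec = "real ^ ('n option)"
type_synonym 'n hmat = "real ^ ('n option) ^ ('n option)"

typedef (overloaded) 'n proj = "{span {v} | v :: ('n::finite) hvec. v \<noteq> 0}"
  morphisms line_of Abs_proj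
proof -
  have "(axis None 1 :: 'n hvec) \<noteq> 0"
    by (simp add: axis_eq_0_iff)
  then show ?thesis
    by blast
qed

definition proj_of :: "('n::finite) hvec \<Rightarrow> 'n proj" where
  "proj_of v = Abs_proj (span {v})"

instantiation proj :: (finite) topological_space
begin

definition open_proj :: "'a proj set \<Rightarrow> bool" where
  "open_proj U \<longleftrightarrow> open {v. v \<noteq> 0 \<and> proj_of v \<in> U}"

instance
proof
  have "{v :: 'a hvec. v \<noteq> 0 \<and> proj_of v \<in> UNIV} = - {0}"
    by auto
  then show "open (UNIV :: 'a proj set)"
    unfolding open_proj_def by (simp add: open_Compl)
next
  fix S T :: "'a proj set"
  assume "open S" "open T"
  moreover have "{v. v \<noteq> 0 \<and> proj_of v \<in> S \<inter> T}
      = {v. v \<noteq> 0 \<and> proj_of v \<in> S} \<inter> {v. v \<noteq> 0 \<and> proj_of v \<in> T}"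
    by auto
  ultimately show "open (S \<inter> T)"
    unfolding open_proj_def by (simp add: open_Int)
next
  fix K :: "'a proj set set"
  assume "\<forall>S\<in>K. open S"
  moreover have "{v. v \<noteq> 0 \<and> proj_of v \<in> \<Union>K} = (\<Union>S\<in>K. {v. v \<noteq> 0 \<and> proj_of v \<in> S})"
    by auto
  ultimately show "open (\<Union>K)"
    unfolding open_proj_def by (simp add: open_UN)
qed

end

text \<open>
  The affine chart with coordinates \<open>x \<mapsto> [T (1, x)]\<close>. For invertible \<open>T\<close>, its range is the
  complement of a projective hyperplane, and every affine coordinate system on every such
  complement has this form.
\<close>

definition hom_coords :: "real ^ 'n \<Rightarrow> ('n::finite) hvec" where
  "hom_coords x = (\<chi> i. case i of None \<Rightarrow> 1 | Some j \<Rightarrow> x $ j)"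

definition chart :: "('n::finite) hmat \<Rightarrow> real ^ 'n \<Rightarrow> 'n proj" where
  "chart T x = proj_of (T *v hom_coords x)"

definition adapted_chart :: "('n::finite) hmat \<Rightarrow> 'n proj set \<Rightarrow> bool" where
  "adapted_chart T \<Omega> \<longleftrightarrow>
     invertible T \<and> closure \<Omega> \<subseteq> range (chart T) \<and> convex (chart T -` \<Omega>)"

definition properly_convex :: "('n::finite) proj set \<Rightarrow> bool" where
  "properly_convex \<Omega> \<longleftrightarrow> (\<exists>T. adapted_chart T \<Omega>)"

definition strictly_convex :: "('n::finite) proj set \<Rightarrow> bool" where
  "strictly_convex \<Omega> \<longleftrightarrow>
     \<not> (\<exists>T a b. invertible T \<and> a \<noteq> b \<and> chart T ` closed_segment a b \<subseteq> frontier \<Omega>)"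

definition ellipsoid :: "('n::finite) proj set \<Rightarrow> bool" where
  "ellipsoid \<Omega> \<longleftrightarrow>
     (\<exists>T (A :: real ^ 'n ^ 'n) c. invertible T \<and> invertible A \<and>
        \<Omega> = chart T ` (\<lambda>x. A *v x + c) ` ball 0 1)"

text \<open>
  Regularity of the boundary. A set in \<open>P\<^sup>n\<close> is a graph over an open subset of \<open>\<real>\<^sup>n\<^sup>-\<^sup>1\<close>; here
  \<open>\<real>\<^sup>n\<^sup>-\<^sup>1\<close> is a coordinate hyperplane \<open>H\<close> of \<open>\<real>\<^sup>n\<close>, and the differential \<open>d\<^sub>xf\<close> is
  given by its gradient \<open>f' x \<in> H\<close>. As \<open>T\<close> ranges over all charts, graphs over coordinate
  hyperplanes account for graphs over arbitrary ones.
\<close>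

definition C1_gradient ::
  "'a::euclidean_space set \<Rightarrow> 'a set \<Rightarrow> ('a \<Rightarrow> real) \<Rightarrow> ('a \<Rightarrow> 'a) \<Rightarrow> bool" where
  "C1_gradient H U f f' \<longleftrightarrow>
     openin (top_of_set H) U \<and> continuous_on U f' \<and>
     (\<forall>x\<in>U. f' x \<in> H \<and> (f has_derivative (\<lambda>v. f' x \<bullet> v)) (at x within U))"

definition C1_on :: "'a::euclidean_space set \<Rightarrow> 'a set \<Rightarrow> ('a \<Rightarrow> real) \<Rightarrow> bool" where
  "C1_on H U f \<longleftrightarrow> (\<exists>f'. C1_gradient H U f f')"

definition C1_plus_on ::
  "real \<Rightarrow> 'a::euclidean_space set \<Rightarrow> 'a set \<Rightarrow> ('a \<Rightarrow> real) \<Rightarrow> bool" where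
  "C1_plus_on \<epsilon> H U f \<longleftrightarrow>
     (\<exists>f'. C1_gradient H U f f' \<and>
       (\<exists>C>0. \<forall>x\<in>U. \<forall>y\<in>U.
          \<bar>f y - f x - f' x \<bullet> (y - x)\<bar> \<le> C * norm (x - y) powr (1 + \<epsilon>)))"

definition locally_graph ::
  "((real ^ 'n) set \<Rightarrow> (real ^ 'n) set \<Rightarrow> (real ^ 'n \<Rightarrow> real) \<Rightarrow> bool)
     \<Rightarrow> ('n::finite) proj set \<Rightarrow> bool" where
  "locally_graph P S \<longleftrightarrow>
     (\<forall>p\<in>S. \<exists>W T k U f. open W \<and> p \<in> W \<and> invertible T \<and> P {x. x $ k = 0} U f \<and>
        S \<inter> W = chart T ` {x + f x *\<^sub>R axis k 1 | x. x \<in> U})"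

definition C1_boundary :: "('n::finite) proj set \<Rightarrow> bool" where
  "C1_boundary \<Omega> \<longleftrightarrow> locally_graph C1_on (frontier \<Omega>)"

definition C1_plus_boundary :: "real \<Rightarrow> ('n::finite) proj set \<Rightarrow> bool" where
  "C1_plus_boundary \<epsilon> \<Omega> \<longleftrightarrow> locally_graph (C1_plus_on \<epsilon>) (frontier \<Omega>)"

text \<open>
  Hilbert geometry of a bounded convex open set \<open>D\<close> of \<open>\<real>\<^sup>n\<close>. For \<open>v = 0\<close> the boundary
  points are meaningless, but the factor \<open>norm v\<close> gives the value 0.
\<close>

definition exit_point :: "(real ^ 'n) set \<Rightarrow> real ^ 'n \<Rightarrow> real ^ 'n \<Rightarrow> real ^ ('n::finite)" where
  "exit_point D x v = (THE y. y \<in> frontier D \<and> (\<exists>t\<ge>0. y = x + t *\<^sub>R v))"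

definition finsler_norm :: "(real ^ ('n::finite)) set \<Rightarrow> real ^ 'n \<Rightarrow> real ^ 'n \<Rightarrow> real" where
  "finsler_norm D x v =
     norm v / 2 * (1 / dist x (exit_point D x (- v)) + 1 / dist x (exit_point D x v))"

definition busemann_density :: "(real ^ ('n::finite)) set \<Rightarrow> real ^ 'n \<Rightarrow> ennreal" where
  "busemann_density D x =
     emeasure lborel (ball (0 :: real ^ 'n) 1) / emeasure lborel {v. finsler_norm D x v < 1}"

text \<open>
  \<open>Vol\<^sub>\<Omega>\<close>, computed in some affine chart containing the closure of \<open>\<Omega>\<close>; the value does not
  depend on the chart. In particular, changing the Euclidean norm of the chart amounts to
  composing the chart with a linear map.
\<close>

definition busemann_volume :: "('n::finite) proj set \<Rightarrow> 'n proj set \<Rightarrow> ennreal" where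
  "busemann_volume \<Omega> A =
     (let T = (SOME T. adapted_chart T \<Omega>)
      in \<integral>\<^sup>+ x \<in> chart T -` (A \<inter> \<Omega>). busemann_density (chart T -` \<Omega>) x \<partial>lborel)"

definition proj_act :: "('n::finite) hmat \<Rightarrow> 'n proj \<Rightarrow> 'n proj" where
  "proj_act g p = Abs_proj ((*v) g ` line_of p)"

definition Aut :: "('n::finite) proj set \<Rightarrow> ('n hmat) monoid" where
  "Aut \<Omega> = \<lparr>carrier = {g. det g = 1 \<and> proj_act g ` \<Omega> = \<Omega>}, mult = (\<lambda>g h. g ** h), one = mat 1\<rparr>"

definition orbit :: "('n::finite) hmat set \<Rightarrow> 'n proj \<Rightarrow> 'n proj set" where
  "orbit \<Gamma> x = (\<lambda>g. proj_act g x) ` \<Gamma>"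

definition quotient_space :: "('n::finite) proj set \<Rightarrow> 'n hmat set \<Rightarrow> 'n proj set topology" where
  "quotient_space \<Omega> \<Gamma> =
     topology (\<lambda>U. U \<subseteq> orbit \<Gamma> ` \<Omega> \<and> openin (top_of_set \<Omega>) {x \<in> \<Omega>. orbit \<Gamma> x \<in> U})"

lemma quotient_map_quotient_space:
  "quotient_map (top_of_set \<Omega>) (quotient_space \<Omega> \<Gamma>) (orbit \<Gamma>)"
proof -
  let ?P = "\<lambda>U. U \<subseteq> orbit \<Gamma> ` \<Omega> \<and> openin (top_of_set \<Omega>) {x \<in> \<Omega>. orbit \<Gamma> x \<in> U}"
  have "?P (S \<inter> T)" if "?P S" "?P T" for S T
  proof -
    have "{x \<in> \<Omega>. orbit \<Gamma> x \<in> S \<inter> T} = {x \<in> \<Omega>. orbit \<Gamma> x \<in> S} \<inter> {x \<in> \<Omega>. orbit \<Gamma> x \<in> T}"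
      by auto
    with that show ?thesis
      by (simp add: openin_Int le_infI1)
  qed
  moreover have "?P (\<Union>\<K>)" if "\<forall>K\<in>\<K>. ?P K" for \<K>
  proof -
    have "{x \<in> \<Omega>. orbit \<Gamma> x \<in> \<Union>\<K>} = \<Union>((\<lambda>K. {x \<in> \<Omega>. orbit \<Gamma> x \<in> K}) ` \<K>)"
      by auto
    moreover have "openin (top_of_set \<Omega>) (\<Union>((\<lambda>K. {x \<in> \<Omega>. orbit \<Gamma> x \<in> K}) ` \<K>))"
      using that by blast
    moreover have "\<Union>\<K> \<subseteq> orbit \<Gamma> ` \<Omega>"
      using that by (intro Union_least) simp
    ultimately show ?thesis
      by simp
  qed
  ultimately have "istopology ?P"
    unfolding istopology_def by blast
  then have *: "openin (quotient_space \<Omega> \<Gamma>) = ?P"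
    unfolding quotient_space_def by (rule topology_inverse')
  have "{x \<in> \<Omega>. orbit \<Gamma> x \<in> orbit \<Gamma> ` \<Omega>} = \<Omega>"
    by auto
  then have "openin (quotient_space \<Omega> \<Gamma>) (orbit \<Gamma> ` \<Omega>)"
    unfolding * by simp
  then have "topspace (quotient_space \<Omega> \<Gamma>) = orbit \<Gamma> ` \<Omega>"
    unfolding topspace_def * by blast
  then show ?thesis
    unfolding quotient_map_def * by simp
qed

text \<open>
  The measure induced by \<open>Vol\<^sub>\<Omega>\<close> on \<open>\<Omega>/\<Gamma>\<close> is the one for which the projection preserves the
  measure of every Borel set on which it is injective. The supremum below equals
  \<open>Vol\<^sub>\<Omega> (F \<inter> \<pi>\<^sup>-\<^sup>1 B)\<close> for any Borel set \<open>F\<close> meeting every orbit in exactly one point.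
\<close>

definition quotient_volume ::
  "('n::finite) proj set \<Rightarrow> 'n hmat set \<Rightarrow> 'n proj set set \<Rightarrow> ennreal" where
  "quotient_volume \<Omega> \<Gamma> B =
     (SUP A \<in> {A \<in> sets borel. A \<subseteq> \<Omega> \<and> orbit \<Gamma> ` A \<subseteq> B \<and> inj_on (orbit \<Gamma>) A}.
        busemann_volume \<Omega> A)"

definition noncompact_finite_volume_quotient :: "('n::finite) proj set \<Rightarrow> bool" where
  "noncompact_finite_volume_quotient \<Omega> \<longleftrightarrow>
     (\<exists>\<Gamma>. subgroup \<Gamma> (Aut \<Omega>) \<and> discrete \<Gamma> \<and>
        \<not> compact_space (quotient_space \<Omega> \<Gamma>) \<and>
        quotient_volume \<Omega> \<Gamma> (orbit \<Gamma> ` \<Omega>) < \<infinity>)"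

end

theory Submission imports Defs begin

text \<open>
  Lift \<open>\<Omega>\<close> to an open convex cone \<open>C\<close> in \<open>\<real>\<^sup>m\<close>, \<open>m = n + 1\<close>, and let \<open>X\<close> be the set of its boundary
  vectors in an affine chart. By the regularity of the boundary, every \<open>p \<in> X\<close> has exactly one
  normalized supporting functional, \<open>tang p\<close>. If the triple products
  \<open>(tang x \<bullet> y) * (tang y \<bullet> z) * (tang z \<bullet> x)\<close> do not change under reversal of the cyclic order, then
  the functionals can be rescaled so that \<open>tang x \<bullet> y\<close> becomes symmetric in \<open>x\<close> and \<open>y\<close> and extends
  to a symmetric bilinear form, whose quadratic form vanishes on \<open>X\<close>. This form is
  Lorentzian and \<open>C\<close> is its cone (\<open>lorentz_cone\<close>), so \<open>\<Omega>\<close> is an ellipsoid. The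
  proof consists in deriving the symmetry of the triple products from the group \<open>\<Gamma>\<close>.

  The regularity of the boundary enters through \<open>eigenvalue_product\<close>: if a unimodular automorphism
  of \<open>C\<close> fixes two points of \<open>X\<close>, its eigenvalues there are inverse to each other. Such an
  automorphism permutes, up to scaling, the wedges that are the cones over caps of height \<open>t\<close> at one of the
  points. The eigenvalues determine the exponent with which the volume of a wedge depends on \<open>t\<close>, whereas
  a boundary of class \<open>C\<^sup>1\<^sup>+\<^sup>\<epsilon>\<close> bounds this volume from below by a power of \<open>t\<close> with exponent
  \<open>1 + (m - 2) / (1 + \<epsilon>)\<close>, which tends to \<open>m / 2\<close>, the exponent of a paraboloid, as \<open>\<epsilon>\<close> tends to 1.

  Next, sequences in \<open>\<Gamma>\<close> that tend to infinity are considered. After rescaling, they and their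
  inverses converge to matrices of rank one with images \<open>x \<in> X\<close> and \<open>y \<in> X\<close> and kernels
  tangent to the boundary at \<open>y\<close> and \<open>x\<close> (\<open>convergence_subseq\<close>). Brouwer's theorem gives fixed points of
  the late members near \<open>x\<close> and \<open>y\<close>, and the relation between their eigenvalues determines the limit of
  the ratio of the two scalings (\<open>ratio_limit\<close>). Since these ratios are multiplicative, two sequences
  and their product yield an identity between the numbers \<open>tang p \<bullet> q\<close> for four boundary points
  (\<open>four_cycle\<close>). If all pairs \<open>(x, y)\<close> of boundary points arise from sequences,
  then these identities imply the symmetry of the triple products (\<open>triple_identity\<close>).

  That all pairs arise is a consequence of the finite volume of the quotient. A neighbourhood of a
  boundary point has infinite Busemann volume (\<open>infinite_volume_near_boundary\<close>), so it does not embed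
  into the quotient, and some element of \<open>\<Gamma>\<close> identifies two different points of it (\<open>recurrent_lift\<close>).
  If \<open>p \<in> X\<close> were not a limit point of \<open>\<Gamma>\<close>, only finitely many elements could do so near \<open>p\<close>, and
  in a smaller neighbourhood of some boundary point none would (\<open>every_point_limit\<close>). Furthermore
  \<open>\<Gamma>\<close> has no common fixed point in \<open>X\<close>: such a point would give hyperbolic
  elements \<open>h\<close>, and discreteness would force \<open>\<Gamma>\<close> to fix the other end of their axes as well
  (\<open>no_global_fixed_point\<close>). Composing sequences then gives all pairs (\<open>all_limit_pairs\<close>).
\<close>

section \<open>Rank one matrices\<close>

definition outer :: "real^'n \<Rightarrow> real^'n \<Rightarrow> real^'n^'n" where
  "outer x a = (\<chi> i j. x $ i * a $ j)"

lemma outer_mult_vec [simp]: "outer x a *v v = (a \<bullet> v) *\<^sub>R x"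
  by (simp add: outer_def matrix_vector_mult_def vec_eq_iff inner_vec_def sum_distrib_right
      sum_distrib_left mult_ac)

lemma mult_outer: "M ** outer x a = outer (M *v x) a"
  by (simp add: outer_def matrix_vector_mult_def matrix_matrix_mult_def vec_eq_iff
      sum_distrib_right sum_distrib_left mult_ac)

lemma outer_mult_outer: "outer x a ** outer y b = (a \<bullet> y) *\<^sub>R outer x b"
  by (simp add: outer_def matrix_matrix_mult_def vec_eq_iff inner_vec_def
      sum_distrib_right sum_distrib_left mult_ac)

lemma outer_mult_matrix: "outer x a ** M = outer x (transpose M *v a)"
  by (simp add: outer_def transpose_def matrix_vector_mult_def matrix_matrix_mult_def vec_eq_iff
      sum_distrib_left mult_ac)

lemma outer_scaleR_left: "outer (c *\<^sub>R x) a = c *\<^sub>R outer x a"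
  by (simp add: outer_def vec_eq_iff)

lemma outer_scaleR_right: "outer x (c *\<^sub>R a) = c *\<^sub>R outer x a"
  by (simp add: outer_def vec_eq_iff)

lemma outer_eq_0_iff: "outer x a = 0 \<longleftrightarrow> x = 0 \<or> a = 0"
  by (auto simp add: outer_def vec_eq_iff)

lemma matrix_eqI: "(\<And>v. A *v v = B *v (v :: real^'n)) \<Longrightarrow> A = B"
  by (simp add: matrix_eq)

lemma scaleR_matrix_vector: "(c *\<^sub>R A) *v v = c *\<^sub>R (A *v (v :: real^'n))"
  by (simp add: scaleR_matrix_vector_assoc)

lemma scaleR_matrix_mult: "(c *\<^sub>R A) ** B = c *\<^sub>R (A ** (B :: real^'n^'n))"
  by (simp add: matrix_matrix_mult_def vec_eq_iff sum_distrib_left mult_ac)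

lemma matrix_mult_scaleR: "A ** (c *\<^sub>R B) = c *\<^sub>R (A ** (B :: real^'n^'n))"
  by (simp add: matrix_matrix_mult_def vec_eq_iff sum_distrib_left mult_ac)

lemma transpose_inner: "(transpose A *v a) \<bullet> v = a \<bullet> (A *v (v :: real^'n))"
  by (metis dot_lmul_matrix inner_commute transpose_matrix_vector)

lemma norm_matrix_vector_le:
  fixes M :: "real^'a::finite^'a" shows "norm (M *v v) \<le> real CARD('a) * norm M * norm v"
proof -
  have "norm (M *v v) \<le> (\<Sum>i\<in>UNIV. \<bar>(M *v v) $ i\<bar>)" by (rule norm_le_l1_cart)
  also have "\<dots> \<le> (\<Sum>i\<in>(UNIV::'a set). norm M * norm v)"
  proof (rule sum_mono)
    fix i
    have "\<bar>(M *v v) $ i\<bar> = \<bar>M $ i \<bullet> v\<bar>" by (simp add: matrix_vector_mul_component)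
    also have "\<dots> \<le> norm (M $ i) * norm v" by (rule Cauchy_Schwarz_ineq2)
    also have "\<dots> \<le> norm M * norm v" by (intro mult_right_mono Finite_Cartesian_Product.norm_nth_le) simp
    finally show "\<bar>(M *v v) $ i\<bar> \<le> norm M * norm v" .
  qed
  finally show ?thesis by (simp add: mult_ac)
qed

lemma tendsto_matrix_vector:
  fixes A :: "real^'n^'n"
  assumes "(M \<longlongrightarrow> A) F" "(v \<longlongrightarrow> w) F"
  shows "((\<lambda>k. M k *v v k) \<longlongrightarrow> A *v w) F"
  unfolding matrix_vector_mult_def
  by (intro tendsto_vec_lambda tendsto_sum tendsto_mult tendsto_vec_nth assms)

lemma tendsto_matrix_mult:
  fixes A :: "real^'n^'n"
  assumes "(M \<longlongrightarrow> A) F" "(N \<longlongrightarrow> B) F"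
  shows "((\<lambda>k. M k ** N k) \<longlongrightarrow> A ** B) F"
  unfolding matrix_matrix_mult_def
  by (intro tendsto_vec_lambda tendsto_sum tendsto_mult tendsto_vec_nth assms)

lemma tendsto_det:
  fixes A :: "real^'n^'n"
  assumes "(M \<longlongrightarrow> A) F"
  shows "((\<lambda>k. det (M k)) \<longlongrightarrow> det A) F"
  unfolding det_def by (intro tendsto_intros assms tendsto_prod)

lemma det_scaleR_matrix: "det (c *\<^sub>R (A :: real^'n^'n)) = c ^ CARD('n) * det A"
proof -
  have "c *\<^sub>R A = mat c ** A"
    by (simp add: vec_eq_iff matrix_matrix_mult_def mat_def if_distrib [where f = "\<lambda>x. x * _"] sum.delta cong: if_cong)
  moreover have "det (mat c :: real^'n^'n) = c ^ CARD('n)"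
    by (simp add: det_matrix_scaleR[unfolded matrix_scaleR])
  ultimately show ?thesis
    by (simp add: det_mul)
qed

text \<open>The determinant is invariant under an orthogonal change of coordinates taking \<open>a\<close>
  to a multiple of a coordinate vector; there the matrix differs from the identity in one
  column.\<close>

lemma det_rank_one_update:
  fixes u a :: "real^'n"
  shows "det (mat 1 + outer u a) = 1 + a \<bullet> u"
proof (cases "a = 0")
  case True
  then show ?thesis by (simp add: outer_eq_0_iff[THEN iffD2])
next
  case False
  obtain k :: 'n where True by auto
  have "norm a = norm (norm a *\<^sub>R axis k (1::real))" by simp
  then obtain f where f: "orthogonal_transformation f" "f a = norm a *\<^sub>R axis k (1::real)"
    using orthogonal_transformation_exists[of a "norm a *\<^sub>R axis k (1::real)"] by metis
  define P where "P = matrix f"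
  have lin: "linear f" using f(1) by (simp add: orthogonal_transformation_linear)
  have Pv: "P *v v = f v" for v by (simp add: P_def lin matrix_works)
  have oP: "orthogonal_matrix P"
    using f(1) orthogonal_transformation_matrix P_def by blast
  then have PP: "transpose P ** P = mat 1" "P ** transpose P = mat 1"
    by (auto simp: orthogonal_matrix_def)
  have inn: "f x \<bullet> f y = x \<bullet> y" for x y
    using f(1) by (simp add: orthogonal_transformation_def)
  have conj: "P ** (mat 1 + outer u a) ** transpose P = mat 1 + outer (f u) (f a)"
  proof (rule matrix_eqI)
    fix v
    have 1: "f (transpose P *v v) = v"
      using PP(2) by (metis Pv matrix_vector_mul_assoc matrix_vector_mul_lid)
    have 2: "a \<bullet> (transpose P *v v) = f a \<bullet> v"
      using inn[of a "transpose P *v v"] 1 by simp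
    show "(P ** (mat 1 + outer u a) ** transpose P) *v v = (mat 1 + outer (f u) (f a)) *v v"
      using 1 2
      by (simp add: matrix_vector_mul_assoc [symmetric] matrix_vector_mult_add_rdistrib Pv
         linear_add[OF lin] linear_scale[OF lin] del: matrix_vector_mul_assoc)
  qed
  define x where "x = axis k 1 + norm a *\<^sub>R f u"
  have "mat 1 + outer (f u) (f a) = (\<chi> i j. if j = k then (mat 1 *v x) $ i else mat 1 $ i $ j)"
    unfolding matrix_vector_mul_lid by (auto simp add: vec_eq_iff f(2) outer_def x_def mat_def axis_def)
  then have "det (mat 1 + outer (f u) (f a)) = x $ k * det (mat 1 :: real^'n^'n)"
    by (simp only: cramer_lemma)
  also have "\<dots> = 1 + f a \<bullet> f u"
    by (simp add: x_def f(2) inner_axis' axis_nth)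
  finally have "det (P ** (mat 1 + outer u a) ** transpose P) = 1 + a \<bullet> u"
    using conj inn by simp
  moreover have "det P * det (transpose P) = 1"
    using PP(2) by (metis det_I det_mul)
  moreover have "det (P ** (mat 1 + outer u a) ** transpose P) =
      (det P * det (transpose P)) * det (mat 1 + outer u a)"
    unfolding det_mul by (simp only: mult_ac)
  ultimately show ?thesis by simp
qed

lemma compact_subseq:
  fixes g :: "nat \<Rightarrow> 'a::metric_space"
  assumes "compact S" "\<And>k. g k \<in> S"
  shows "\<exists>l r. l \<in> S \<and> strict_mono r \<and> (\<lambda>k. g (r k)) \<longlonglongrightarrow> l"
  using assms unfolding compact_def o_def by blast

lemma exists_subseq_normalized:
  fixes g :: "nat \<Rightarrow> 'a::euclidean_space"
  assumes "\<And>k. g k \<noteq> 0"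
  shows "\<exists>r A. strict_mono r \<and> norm A = 1 \<and> (\<lambda>k. (1 / norm (g (r k))) *\<^sub>R g (r k)) \<longlonglongrightarrow> A"
proof -
  have "(1 / norm (g k)) *\<^sub>R g k \<in> sphere 0 1" for k using assms by simp
  then obtain A r where "A \<in> sphere 0 1" "strict_mono r"
     "(\<lambda>k. (1 / norm (g (r k))) *\<^sub>R g (r k)) \<longlonglongrightarrow> A"
    using compact_subseq[OF compact_sphere, of "\<lambda>k. (1 / norm (g k)) *\<^sub>R g k" 0 1] by blast
  then show ?thesis by auto
qed

text \<open>Otherwise unimodular matrices of bounded norm would have a limit \<open>A\<close>, again
  unimodular, that annihilates the limit of their normalized inverses.\<close>

lemma norm_inverse_bounded:
  "\<exists>R'. \<forall>(M::real^'n^'n) N. M ** N = mat 1 \<longrightarrow> \<bar>det M\<bar> = 1 \<longrightarrow> norm M \<le> R \<longrightarrow> norm N \<le> R'"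
proof (rule ccontr)
  assume "\<not> ?thesis"
  then have "\<forall>k::nat. \<exists>M N::real^'n^'n. M ** N = mat 1 \<and> \<bar>det M\<bar> = 1 \<and> norm M \<le> R \<and> norm N > real k"
    by (meson not_le)
  then obtain M N :: "nat \<Rightarrow> real^'n^'n" where MN: "M k ** N k = mat 1" "\<bar>det (M k)\<bar> = 1"
    "norm (M k) \<le> R" "norm (N k) > real k" for k by metis
  have "M k \<in> cball 0 R" for k using MN by simp
  then obtain A r where A: "strict_mono r" "(\<lambda>k. M (r k)) \<longlonglongrightarrow> A"
    using compact_subseq[OF compact_cball, of M 0 R] by blast
  have Nnz: "N k \<noteq> 0" for k using MN(4)[of k] by auto
  obtain q B where B: "strict_mono q" "norm B = 1"
    "(\<lambda>k. (1 / norm (N (r (q k)))) *\<^sub>R N (r (q k))) \<longlonglongrightarrow> B"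
    using exists_subseq_normalized[of "\<lambda>k. N (r k)"] Nnz by blast
  have lim1: "(\<lambda>k. M (r (q k))) \<longlonglongrightarrow> A"
    using LIMSEQ_subseq_LIMSEQ[OF A(2) B(1)] by (simp add: o_def)
  have "(\<lambda>k. M (r (q k)) ** ((1 / norm (N (r (q k)))) *\<^sub>R N (r (q k)))) \<longlonglongrightarrow> A ** B"
    by (rule tendsto_matrix_mult[OF lim1 B(3)])
  then have 1: "(\<lambda>k. (1 / norm (N (r (q k)))) *\<^sub>R (mat 1 :: real^'n^'n)) \<longlonglongrightarrow> A ** B"
    by (simp add: matrix_mult_scaleR MN)
  have sm: "strict_mono (\<lambda>k. r (q k))" using A(1) B(1) by (simp add: strict_mono_def)
  have top: "filterlim (\<lambda>k. norm (N (r (q k)))) at_top sequentially"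
  proof (rule filterlim_at_top_mono[OF filterlim_real_sequentially], rule always_eventually, rule allI)
    fix k show "real k \<le> norm (N (r (q k)))"
      using MN(4)[of "r (q k)"] seq_suble[OF sm, of k] by linarith
  qed
  have "(\<lambda>k. 1 / norm (N (r (q k)))) \<longlonglongrightarrow> 0"
    by (rule tendsto_divide_0[OF tendsto_const filterlim_at_top_imp_at_infinity[OF top]])
  then have "(\<lambda>k. (1 / norm (N (r (q k)))) *\<^sub>R (mat 1 :: real^'n^'n)) \<longlonglongrightarrow> 0 *\<^sub>R mat 1"
    by (intro tendsto_intros)
  then have AB: "A ** B = 0" using 1 LIMSEQ_unique by fastforce
  have "(\<lambda>k. \<bar>det (M (r (q k)))\<bar>) \<longlonglongrightarrow> \<bar>det A\<bar>"
    by (intro tendsto_intros tendsto_det lim1)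
  then have "\<bar>det A\<bar> = 1" by (simp add: MN LIMSEQ_const_iff)
  then have "invertible A" by (auto simp: invertible_det_nz)
  then obtain A' where "A' ** A = mat 1" by (auto simp: invertible_def)
  then have "B = A' ** (A ** B)" by (simp add: matrix_mul_assoc)
  also have "\<dots> = 0" by (simp add: AB)
  finally show False using B(2) by simp
qed

section \<open>Convex cones and their supporting functionals\<close>

text \<open>The cone over a properly convex domain: positivity of \<open>f\<close> on the closure says
  that the closure of the domain misses the hyperplane at infinity of the affine chart \<open>f
  \<bullet> v = 1\<close>. In this chart the closed domain is \<open>slice\<close> and its
  boundary is \<open>bdry\<close>. The interior point \<open>base\<close> serves to normalize
  functionals.\<close>

locale sharp_cone =
  fixes C :: "(real^'m::finite) set" and f :: "real^'m"
  assumes open_C: "open C"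
    and conv_C: "convex C"
    and cone_C: "v \<in> C \<Longrightarrow> t > 0 \<Longrightarrow> t *\<^sub>R v \<in> C"
    and ne_C: "C \<noteq> {}"
    and pos: "v \<in> closure C \<Longrightarrow> v \<noteq> 0 \<Longrightarrow> f \<bullet> v > 0"
begin

definition bdry :: "(real^'m) set" where
  "bdry = {v. v \<in> closure C \<and> v \<notin> C \<and> f \<bullet> v = 1}"

definition slice :: "(real^'m) set" where
  "slice = {v. v \<in> closure C \<and> f \<bullet> v = 1}"

definition base :: "real^'m" where
  "base = (SOME v. v \<in> C \<and> f \<bullet> v = 1)"

definition supports :: "real^'m \<Rightarrow> real^'m \<Rightarrow> bool" where
  "supports a p \<longleftrightarrow> a \<noteq> 0 \<and> (\<forall>v\<in>C. 0 \<le> a \<bullet> v) \<and> a \<bullet> p = 0"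

lemma add_C: assumes "u \<in> C" "v \<in> C" shows "u + v \<in> C"
proof -
  have "(1/2) *\<^sub>R u + (1/2) *\<^sub>R v \<in> C"
    using conv_C assms by (intro convexD) auto
  from cone_C[OF this, of 2] show ?thesis by (simp add: scaleR_add_right)
qed

lemma zero_notin_C: "0 \<notin> C"
proof
  assume "0 \<in> C"
  then obtain e where e: "e > 0" "ball 0 e \<subseteq> C" using open_C by (meson openE)
  obtain k :: 'm where True by auto
  let ?v = "(e/2) *\<^sub>R axis k 1 :: real^'m"
  have v: "?v \<in> C" "- ?v \<in> C" using e by (auto simp: subset_iff dist_norm)
  have "?v \<noteq> 0" using e by (simp add: axis_eq_0_iff)
  then have "f \<bullet> ?v > 0" "f \<bullet> (- ?v) > 0"
    using pos closure_subset v by (metis subsetD, metis neg_equal_0_iff_equal subsetD)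
  then show False by simp
qed

lemma C_pos: "v \<in> C \<Longrightarrow> f \<bullet> v > 0"
  using pos closure_subset zero_notin_C by blast

lemma base_C: "base \<in> C" and f_base: "f \<bullet> base = 1"
proof -
  obtain v where v: "v \<in> C" using ne_C by auto
  have "(1 / (f \<bullet> v)) *\<^sub>R v \<in> C" "f \<bullet> ((1 / (f \<bullet> v)) *\<^sub>R v) = 1"
    using cone_C[OF v] C_pos[OF v] by auto
  then have "\<exists>v. v \<in> C \<and> f \<bullet> v = 1" by blast
  from someI_ex[OF this] show "base \<in> C" "f \<bullet> base = 1" unfolding base_def by auto
qed

lemma closure_seq: "v \<in> closure C \<longleftrightarrow> (\<exists>g. (\<forall>k::nat. g k \<in> C) \<and> g \<longlonglongrightarrow> v)"
  by (rule closure_sequential)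

lemma closure_scale: assumes "v \<in> closure C" "t \<ge> 0" shows "t *\<^sub>R v \<in> closure C"
proof -
  obtain g where g: "\<And>k::nat. g k \<in> C" "g \<longlonglongrightarrow> v" using assms(1) closure_seq by metis
  have *: "s *\<^sub>R v \<in> closure C" if "s > 0" for s
    unfolding closure_seq using g cone_C that
    by (intro exI[of _ "\<lambda>k. s *\<^sub>R g k"]) (auto intro!: tendsto_intros)
  show ?thesis
  proof (cases "t = 0")
    case True
    have "(\<lambda>k. inverse (real (Suc k)) *\<^sub>R base) \<longlonglongrightarrow> 0 *\<^sub>R base"
      by (intro tendsto_intros LIMSEQ_inverse_real_of_nat)
    then show ?thesis unfolding closure_seq True using cone_C[OF base_C]
      by (intro exI[of _ "\<lambda>k. inverse (real (Suc k)) *\<^sub>R base"]) auto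
  qed (use * assms in auto)
qed

lemma convex_closure_C: "convex (closure C)"
  using conv_C by (rule convex_closure)

lemma closure_add: assumes "u \<in> closure C" "v \<in> closure C" shows "u + v \<in> closure C"
proof -
  have "(1/2) *\<^sub>R u + (1/2) *\<^sub>R v \<in> closure C"
    using convex_closure_C assms by (intro convexD) auto
  from closure_scale[OF this, of 2] show ?thesis by (simp add: scaleR_add_right)
qed

lemma interior_closure_C: "interior (closure C) = C"
  using convex_interior_closure[OF conv_C] open_C by (simp add: interior_open)

lemma add_closure_C: assumes "u \<in> closure C" "v \<in> C" shows "u + v \<in> C"
proof -
  have "v \<in> interior (closure C)" using assms interior_closure_C by simp
  then obtain e where e: "e > 0" "ball v e \<subseteq> closure C"
    using assms(2) open_C open_contains_ball closure_subset by (metis subset_trans)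
  have "ball (u + v) e \<subseteq> closure C"
  proof
    fix w assume "w \<in> ball (u + v) e"
    then have "w - u \<in> ball v e" by (simp add: dist_norm algebra_simps)
    then have "u + (w - u) \<in> closure C" using e closure_add assms by blast
    then show "w \<in> closure C" by simp
  qed
  then have "u + v \<in> interior (closure C)" using e(1) by (meson centre_in_ball interiorI open_ball)
  then show ?thesis by (simp add: interior_closure_C)
qed

lemma pointed: assumes "v \<in> closure C" "- v \<in> closure C" shows "v = 0"
proof (rule ccontr)
  assume "v \<noteq> 0"
  then have "f \<bullet> v > 0" "f \<bullet> (- v) > 0" using pos assms by (auto simp del: inner_minus_right)
  then show False by simp
qed

lemma f_lower: "\<exists>d>0. \<forall>v\<in>closure C. d * norm v \<le> f \<bullet> v"
proof -
  let ?S = "closure C \<inter> sphere 0 1"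
  have cS: "compact ?S" by (simp add: closed_Int_compact)
  have "norm ((1 / norm base) *\<^sub>R base) = 1" using base_C zero_notin_C by auto
  moreover have "(1 / norm base) *\<^sub>R base \<in> closure C"
    using base_C closure_subset closure_scale by (metis divide_nonneg_nonneg norm_ge_zero subsetD zero_le_one)
  ultimately have nS: "?S \<noteq> {}" by force
  have "\<exists>x\<in>?S. \<forall>y\<in>?S. f \<bullet> x \<le> f \<bullet> y"
    by (rule continuous_attains_inf[OF cS nS]) (intro continuous_intros)
  then obtain x where x: "x \<in> ?S" "\<And>y. y \<in> ?S \<Longrightarrow> f \<bullet> x \<le> f \<bullet> y" by blast
  have "f \<bullet> x > 0" using x(1) pos by force
  moreover have "(f \<bullet> x) * norm v \<le> f \<bullet> v" if "v \<in> closure C" for v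
  proof (cases "v = 0")
    case False
    then have "(1 / norm v) *\<^sub>R v \<in> ?S" using closure_scale[OF that, of "1 / norm v"] by simp
    from x(2)[OF this] False show ?thesis by (simp add: field_simps)
  qed simp
  ultimately show ?thesis by blast
qed

lemma compact_slice: "compact slice" and convex_slice: "convex slice"
proof -
  have eq: "slice = closure C \<inter> {v. f \<bullet> v = 1}" by (auto simp: slice_def)
  obtain d where d: "d > 0" "\<And>v. v \<in> closure C \<Longrightarrow> d * norm v \<le> f \<bullet> v" using f_lower by blast
  have "norm v \<le> 1 / d" if "v \<in> slice" for v
    using d(2)[of v] that d(1) by (auto simp: slice_def field_simps)
  then have "bounded slice" unfolding bounded_iff by blast
  moreover have "closed slice" unfolding eq by (intro closed_Int closed_closure closed_hyperplane)
  ultimately show "compact slice" by (simp add: compact_eq_bounded_closed)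
  show "convex slice" unfolding eq by (intro convex_Int convex_closure_C convex_hyperplane)
qed

lemma bdryD: "x \<in> bdry \<Longrightarrow> x \<in> closure C" "x \<in> bdry \<Longrightarrow> x \<notin> C" "x \<in> bdry \<Longrightarrow> f \<bullet> x = 1"
  "x \<in> bdry \<Longrightarrow> x \<noteq> 0" "x \<in> bdry \<Longrightarrow> x \<in> slice"
  by (auto simp: bdry_def slice_def)

lemma normalize_slice: "v \<in> closure C \<Longrightarrow> v \<noteq> 0 \<Longrightarrow> (1 / (f \<bullet> v)) *\<^sub>R v \<in> slice"
  using pos[of v] closure_scale[of v "1 / (f \<bullet> v)"] by (simp add: slice_def)

lemma normalize_bdry:
  assumes "v \<in> closure C" "v \<notin> C" "v \<noteq> 0" shows "(1 / (f \<bullet> v)) *\<^sub>R v \<in> bdry"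
proof -
  have p: "f \<bullet> v > 0" using pos assms by auto
  have "(1 / (f \<bullet> v)) *\<^sub>R v \<notin> C"
    using cone_C[of "(1 / (f \<bullet> v)) *\<^sub>R v" "f \<bullet> v"] assms(2) p by auto
  then show ?thesis using normalize_slice[OF assms(1,3)] by (simp add: bdry_def slice_def)
qed

lemma supports_pos: assumes "supports a p" "v \<in> C" shows "a \<bullet> v > 0"
proof (rule ccontr)
  assume "\<not> ?thesis"
  then have 0: "a \<bullet> v = 0" using assms by (force simp: supports_def)
  obtain e where e: "e > 0" "ball v e \<subseteq> C" using open_C assms(2) by (meson openE)
  have an: "norm a > 0" using assms by (simp add: supports_def)
  let ?w = "v - (e / (2 * norm a)) *\<^sub>R a"
  have "?w \<in> C" using e an by (auto simp: subset_iff dist_norm)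
  then have "a \<bullet> ?w \<ge> 0" using assms by (simp add: supports_def)
  then have "(e / (2 * norm a)) * (a \<bullet> a) \<le> 0" using 0 by (simp add: inner_diff_right)
  moreover have "(e / (2 * norm a)) * (a \<bullet> a) > 0" using e an by simp
  ultimately show False by simp
qed

lemma supports_nonneg: assumes "supports a p" "v \<in> closure C" shows "a \<bullet> v \<ge> 0"
proof -
  obtain g where g: "\<And>k::nat. g k \<in> C" "g \<longlonglongrightarrow> v" using assms(2) closure_seq by metis
  have "(\<lambda>k. a \<bullet> g k) \<longlonglongrightarrow> a \<bullet> v" using g by (intro tendsto_intros)
  moreover have "0 \<le> a \<bullet> g k" for k using g assms by (simp add: supports_def)
  ultimately show ?thesis by (meson LIMSEQ_le_const)
qed

lemma exists_supports: assumes "p \<in> bdry" shows "\<exists>a. supports a p"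
proof -
  have "p \<notin> interior C" using assms open_C bdryD by (simp add: interior_open)
  then have "\<exists>a b. a \<noteq> 0 \<and> (\<forall>x\<in>C. a \<bullet> x \<le> b) \<and> (\<forall>x\<in>{p}. a \<bullet> x \<ge> b)"
    using separating_hyperplane_sets[OF conv_C convex_singleton[of p] ne_C] assms bdryD by blast
  then obtain a b where a: "a \<noteq> 0" "\<And>x. x \<in> C \<Longrightarrow> a \<bullet> x \<le> b" "a \<bullet> p \<ge> b" by blast
  have nonpos: "a \<bullet> x \<le> 0" if "x \<in> C" for x
  proof (rule ccontr)
    assume n: "\<not> ?thesis"
    then have "a \<bullet> ((\<bar>b\<bar> + 1) / (a \<bullet> x)) *\<^sub>R x \<le> b"
      using a(2)[OF cone_C[OF that, of "(\<bar>b\<bar> + 1) / (a \<bullet> x)"]] by simp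
    then show False using n by simp
  qed
  have "b \<ge> 0"
  proof -
    have "(\<lambda>k. a \<bullet> (inverse (real (Suc k)) *\<^sub>R base)) \<longlonglongrightarrow> a \<bullet> (0 *\<^sub>R base)"
      by (intro tendsto_intros LIMSEQ_inverse_real_of_nat)
    moreover have "a \<bullet> (inverse (real (Suc k)) *\<^sub>R base) \<le> b" for k
      using a(2)[OF cone_C[OF base_C, of "inverse (real (Suc k))"]] by simp
    ultimately have "a \<bullet> (0 *\<^sub>R base) \<le> b" by (meson LIMSEQ_le_const2)
    then show ?thesis by simp
  qed
  moreover have "a \<bullet> p \<le> 0"
  proof -
    obtain g where g: "\<And>k::nat. g k \<in> C" "g \<longlonglongrightarrow> p" using bdryD(1)[OF assms] closure_seq by metis
    have "(\<lambda>k. a \<bullet> g k) \<longlonglongrightarrow> a \<bullet> p" using g by (intro tendsto_intros)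
    then show ?thesis using nonpos g(1) by (meson LIMSEQ_le_const2)
  qed
  ultimately have "supports (-a) p" using a nonpos by (auto simp: supports_def)
  then show ?thesis by blast
qed

text \<open>The parameters at which the line lies in the cone are closed upwards, because \<open>u\<close>
  may be added, and bounded below, because \<open>f\<close> is positive on the cone;
  \<open>r\<close> is their infimum. Questions about arbitrary vectors are reduced in this way
  to questions about boundary vectors.\<close>

lemma exit_exists:
  assumes "u \<in> C"
  shows "\<exists>r. v + r *\<^sub>R u \<in> closure C \<and> v + r *\<^sub>R u \<notin> C \<and> (\<forall>s>r. v + s *\<^sub>R u \<in> C)"
proof -
  define S where "S = {r. v + r *\<^sub>R u \<in> C}"
  obtain e where e: "e > 0" "ball u e \<subseteq> C" using open_C assms by (meson openE)
  define r0 where "r0 = 2 * (norm v + 1) / e"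
  have r0: "r0 > 0" using e by (simp add: r0_def add_nonneg_pos)
  have "norm v / r0 < e"
    using e r0 by (simp add: r0_def divide_simps)
  then have "u + (1 / r0) *\<^sub>R v \<in> C" using e r0 by (auto simp: subset_iff dist_norm)
  from cone_C[OF this r0] have "v + r0 *\<^sub>R u \<in> C" using r0 by (simp add: scaleR_add_right add.commute)
  then have Sne: "S \<noteq> {}" by (auto simp: S_def)
  have fu: "f \<bullet> u > 0" using C_pos assms by auto
  have lower: "r > - (f \<bullet> v) / (f \<bullet> u)" if "r \<in> S" for r
    using C_pos[of "v + r *\<^sub>R u"] that fu by (simp add: S_def inner_add_right field_simps)
  then have bdd: "bdd_below S" by (meson bdd_belowI less_imp_le)
  have up: "s \<in> S" if "r \<in> S" "s > r" for r s
  proof -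
    have "(v + r *\<^sub>R u) + (s - r) *\<^sub>R u \<in> C"
      using add_C[of "v + r *\<^sub>R u" "(s - r) *\<^sub>R u"] cone_C[OF assms, of "s - r"] that by (auto simp: S_def)
    then show ?thesis by (simp add: S_def algebra_simps)
  qed
  define r where "r = Inf S"
  have gt: "s \<in> S" if "s > r" for s
    using cInf_lessD[OF Sne, of s] that up r_def by metis
  have notin: "r \<notin> S"
  proof
    assume "r \<in> S"
    then obtain d where d: "d > 0" "ball (v + r *\<^sub>R u) d \<subseteq> C" using open_C openE S_def by blast
    have un: "norm u > 0" using assms zero_notin_C by auto
    have "v + (r - d / (2 * norm u)) *\<^sub>R u \<in> ball (v + r *\<^sub>R u) d"
      using d un by (auto simp: dist_norm algebra_simps)
    then have "r - d / (2 * norm u) \<in> S" using d by (auto simp: S_def)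
    then have "r \<le> r - d / (2 * norm u)" unfolding r_def using bdd by (rule cInf_lower)
    moreover have "d / (2 * norm u) > 0" using d un by simp
    ultimately show False by simp
  qed
  have "v + r *\<^sub>R u \<in> closure C"
    unfolding closure_seq
  proof (intro exI conjI allI)
    fix k show "v + (r + inverse (real (Suc k))) *\<^sub>R u \<in> C" using gt[of "r + inverse (real (Suc k))"] by (simp add: S_def)
  next
    have "(\<lambda>k. v + (r + inverse (real (Suc k))) *\<^sub>R u) \<longlonglongrightarrow> v + (r + 0) *\<^sub>R u"
      by (intro tendsto_intros LIMSEQ_inverse_real_of_nat)
    then show "(\<lambda>k. v + (r + inverse (real (Suc k))) *\<^sub>R u) \<longlonglongrightarrow> v + r *\<^sub>R u" by simp
  qed
  then show ?thesis using notin gt by (auto simp: S_def)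
qed

end

text \<open>The assumption \<open>strict\<close> is strict convexity of the projective domain, and
  \<open>regular\<close> is the regularity of its boundary: measured by a supporting functional
  at \<open>p\<close>, the boundary deviates from the supporting hyperplane by a power of the
  distance to \<open>p\<close> that is as close to the square as desired.\<close>

locale smooth_cone = sharp_cone C f for C :: "(real^'m::finite) set" and f +
  assumes strict: "x \<in> bdry \<Longrightarrow> y \<in> bdry \<Longrightarrow> x \<noteq> y \<Longrightarrow> s > 0 \<Longrightarrow> t > 0 \<Longrightarrow> s *\<^sub>R x + t *\<^sub>R y \<in> C"
    and regular: "p \<in> bdry \<Longrightarrow> supports a p \<Longrightarrow> 0 < \<epsilon> \<Longrightarrow> \<epsilon> < 1 \<Longrightarrow>
      \<exists>K>0. \<exists>r>0. \<forall>w. w \<in> closure C \<longrightarrow> w \<notin> C \<longrightarrow> norm (w - p) < r \<longrightarrow>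
        a \<bullet> w \<le> K * norm (w - p) powr (1 + \<epsilon>)"
begin

text \<open>The line from \<open>p + d\<close> in the direction of \<open>base\<close> leaves the cone at
  a boundary vector whose distance to \<open>p\<close> is of the order of \<open>norm d\<close>.
  Applied to this vector, \<open>regular\<close> bounds the exit parameter.\<close>

lemma cap:
  assumes p: "p \<in> bdry" and a: "supports a p" "a \<bullet> base = 1" and eps: "0 < \<epsilon>" "\<epsilon> < 1"
  shows "\<exists>K>0. \<exists>r>0. \<forall>d s. norm d < r \<longrightarrow> s > K * norm d powr (1 + \<epsilon>) - a \<bullet> d \<longrightarrow> p + d + s *\<^sub>R base \<in> C"
proof -
  obtain K r where K: "K > 0" "r > 0" and reg: "\<And>w. w \<in> closure C \<Longrightarrow> w \<notin> C \<Longrightarrow> norm (w - p) < r \<Longrightarrow>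
        a \<bullet> w \<le> K * norm (w - p) powr (1 + \<epsilon>)"
    using regular[OF p a(1) eps] by metis
  obtain e where e: "e > 0" "ball base e \<subseteq> C" using open_C base_C by (meson openE)
  define M where "M = 2 / e"
  define L where "L = 1 + M * norm base"
  have M: "M > 0" and L: "L > 0" using e by (auto simp: M_def L_def intro: add_pos_nonneg)
  have up: "d + s *\<^sub>R base \<in> C" if "s > M * norm d" for d s
  proof -
    have "0 \<le> M * norm d" using M by simp
    then have s: "s > 0" using that by linarith
    have "2 * norm d < e * s" using that e by (simp add: M_def field_simps)
    then have "norm d < e * s" using norm_ge_zero[of d] by linarith
    then have "norm d / s < e" using s by (simp add: field_simps)
    then have "base + (1 / s) *\<^sub>R d \<in> C" using e s by (auto simp: subset_iff dist_norm)
    from cone_C[OF this s] show ?thesis using s by (simp add: scaleR_add_right add.commute)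
  qed
  have main: "p + d + s *\<^sub>R base \<in> C"
    if d: "norm d < r / L" and s: "s > K * L powr (1 + \<epsilon>) * norm d powr (1 + \<epsilon>) - a \<bullet> d" for d s
  proof -
    obtain q where q: "p + d + q *\<^sub>R base \<in> closure C" "p + d + q *\<^sub>R base \<notin> C"
      "\<And>s. s > q \<Longrightarrow> p + d + s *\<^sub>R base \<in> C"
      using exit_exists[OF base_C, of "p + d"] by blast
    have "q \<le> M * norm d"
    proof (rule ccontr)
      assume "\<not> ?thesis"
      then have "d + q *\<^sub>R base \<in> C" using up by simp
      then have "p + (d + q *\<^sub>R base) \<in> C" using add_closure_C bdryD(1)[OF p] by blast
      then show False using q(2) by (simp add: add.assoc)
    qed
    moreover have "- q \<le> M * norm d"
    proof (rule ccontr)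
      assume "\<not> ?thesis"
      then have "- d + (- q) *\<^sub>R base \<in> C" using up[of "-d" "-q"] by simp
      then have "(p + d + q *\<^sub>R base) + (- d + (- q) *\<^sub>R base) \<in> C" using add_closure_C q(1) by blast
      then show False using bdryD(2)[OF p] by simp
    qed
    ultimately have "norm (d + q *\<^sub>R base) \<le> norm d + M * norm d * norm base"
      by (intro norm_triangle_le) (simp add: mult_right_mono abs_le_iff)
    then have nd: "norm (d + q *\<^sub>R base) \<le> L * norm d" by (simp add: L_def algebra_simps)
    also have "\<dots> < r" using d L by (simp add: field_simps)
    finally have "a \<bullet> (p + d + q *\<^sub>R base) \<le> K * norm (d + q *\<^sub>R base) powr (1 + \<epsilon>)"
      using reg[OF q(1,2)] by (simp add: add.assoc)
    also have "\<dots> \<le> K * (L * norm d) powr (1 + \<epsilon>)"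
      using nd K eps by (intro mult_left_mono powr_mono2) auto
    finally have "a \<bullet> d + q \<le> K * L powr (1 + \<epsilon>) * norm d powr (1 + \<epsilon>)"
      using a L by (simp add: supports_def inner_add_right powr_mult)
    then show ?thesis using s by (intro q(3)) linarith
  qed
  show ?thesis
    by (rule exI[of _ "K * L powr (1 + \<epsilon>)"], rule conjI)
       (use main K L in \<open>auto intro!: exI[of _ "r / L"]\<close>)
qed

text \<open>If \<open>(a - b) \<bullet> d\<close> exceeded \<open>K * norm d powr (3/2)\<close>, the
  region of \<open>cap\<close> would contain \<open>p + d - (b \<bullet> d) *\<^sub>R
  base\<close>, where \<open>b\<close> vanishes. It does exceed it when \<open>d\<close> is a
  small multiple of \<open>a - b\<close>.\<close>

lemma supports_unique:
  assumes p: "p \<in> bdry" and a: "supports a p" "a \<bullet> base = 1" and b: "supports b p" "b \<bullet> base = 1"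
  shows "a = b"
proof (rule ccontr)
  assume "a \<noteq> b"
  define e where "e = a - b"
  have e: "norm e > 0" using \<open>a \<noteq> b\<close> by (simp add: e_def)
  obtain K r where K: "K > 0" "r > 0" and
    cap: "\<And>d s. norm d < r \<Longrightarrow> s > K * norm d powr (1 + 1/2) - a \<bullet> d \<Longrightarrow> p + d + s *\<^sub>R base \<in> C"
    using cap[OF p a, of "1/2"] by auto
  have le: "(a - b) \<bullet> d \<le> K * norm d powr (1 + 1/2)" if d: "norm d < r" for d
  proof (rule ccontr)
    assume n: "\<not> ?thesis"
    define s where "s = - (b \<bullet> d)"
    have "p + d + s *\<^sub>R base \<in> C" using n by (intro cap[OF d]) (simp add: s_def inner_diff_left)
    from supports_pos[OF b(1) this] show False using b by (simp add: supports_def inner_add_right inner_diff_right s_def)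
  qed
  define t where "t = min (r / (2 * norm e)) ((norm e powr (1/2) / (2 * K))^2)"
  have t: "t > 0" using K e by (simp add: t_def)
  have "t \<le> r / (2 * norm e)" by (simp add: t_def)
  then have "norm (t *\<^sub>R e) < r" using e t K by (simp add: field_simps)
  from le[OF this] have "t * (norm e)^2 \<le> K * (t * norm e) powr (1 + 1/2)"
    using t by (simp add: e_def power2_norm_eq_inner)
  also have "\<dots> = K * (t * norm e) * ((t powr (1/2)) * norm e powr (1/2))"
  proof -
    have "(t * norm e) powr (1 + 1/2) = (t * norm e) * (t * norm e) powr (1/2)"
      using t e by (simp only: powr_add) simp
    then show ?thesis by (simp only: powr_mult mult_ac)
  qed
  finally have 1: "norm e \<le> K * t powr (1/2) * norm e powr (1/2)"
    using t e by (simp add: power2_eq_square field_simps)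
  have "t powr (1/2) \<le> ((norm e powr (1/2) / (2 * K))^2) powr (1/2)"
    using t by (intro powr_mono2) (auto simp: t_def)
  also have "\<dots> = norm e powr (1/2) / (2 * K)"
    using K e by (simp add: powr_half_sqrt real_sqrt_abs)
  finally have "K * t powr (1/2) * norm e powr (1/2) \<le> K * (norm e powr (1/2) / (2 * K)) * norm e powr (1/2)"
    using K by (intro mult_right_mono mult_left_mono) auto
  also have "\<dots> = norm e / 2" using K e by (simp add: powr_add[symmetric])
  finally show False using 1 e by simp
qed

text \<open>By \<open>supports_unique\<close> the normalization at \<open>base\<close> leaves a single
  supporting functional.\<close>

definition tang :: "real^'m \<Rightarrow> real^'m" where
  "tang p = (SOME a. supports a p \<and> a \<bullet> base = 1)"

lemma tang: assumes "p \<in> bdry" shows "supports (tang p) p" and tang_base: "tang p \<bullet> base = 1"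
proof -
  obtain a where a: "supports a p" using exists_supports assms by blast
  have ab: "a \<bullet> base > 0" using supports_pos[OF a base_C] .
  have "supports ((1 / (a \<bullet> base)) *\<^sub>R a) p \<and> ((1 / (a \<bullet> base)) *\<^sub>R a) \<bullet> base = 1"
    using a ab by (auto simp: supports_def)
  then have "\<exists>a. supports a p \<and> a \<bullet> base = 1" by blast
  from someI_ex[OF this] show "supports (tang p) p" "tang p \<bullet> base = 1" unfolding tang_def by auto
qed

lemma supports_eq_tang: assumes "p \<in> bdry" "supports a p" shows "a = (a \<bullet> base) *\<^sub>R tang p"
proof -
  have ab: "a \<bullet> base > 0" using supports_pos[OF assms(2) base_C] .
  have "(1 / (a \<bullet> base)) *\<^sub>R a = tang p"
    using assms ab tang[OF assms(1)] tang_base[OF assms(1)]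
    by (intro supports_unique[OF assms(1)]) (auto simp: supports_def)
  then have "(a \<bullet> base) *\<^sub>R tang p = (a \<bullet> base) *\<^sub>R ((1 / (a \<bullet> base)) *\<^sub>R a)" by simp
  then show ?thesis using ab by simp
qed

lemma tang_self: "p \<in> bdry \<Longrightarrow> tang p \<bullet> p = 0"
  using tang by (simp add: supports_def)

lemma tang_pos_C: "p \<in> bdry \<Longrightarrow> v \<in> C \<Longrightarrow> tang p \<bullet> v > 0"
  using tang supports_pos by blast

lemma tang_nonneg: "p \<in> bdry \<Longrightarrow> v \<in> closure C \<Longrightarrow> tang p \<bullet> v \<ge> 0"
  using tang supports_nonneg by blast

lemma tang_pos: assumes "p \<in> bdry" "q \<in> bdry" "p \<noteq> q" shows "tang p \<bullet> q > 0"
  using tang_pos_C[OF assms(1) strict[OF assms, of 1 1]] tang_self[OF assms(1)]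
  by (simp add: inner_add_right)

lemma tang_pos_slice: assumes "p \<in> bdry" "v \<in> slice" "v \<noteq> p" shows "tang p \<bullet> v > 0"
  using assms tang_pos[of p v] tang_pos_C[of p v] by (auto simp: slice_def bdry_def)

lemma tang_pos_closure:
  assumes "p \<in> bdry" "v \<in> closure C" "v \<noteq> (f \<bullet> v) *\<^sub>R p" shows "tang p \<bullet> v > 0"
proof -
  have v: "v \<noteq> 0" using assms by auto
  then have fv: "f \<bullet> v > 0" using pos assms by auto
  have "(1 / (f \<bullet> v)) *\<^sub>R v \<noteq> p" using assms(3) fv by auto
  from tang_pos_slice[OF assms(1) normalize_slice[OF assms(2) v] this] fv show ?thesis
    by (simp add: zero_less_divide_iff)
qed

end

section \<open>Unimodular automorphisms of a cone and their limits\<close>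

context sharp_cone
begin

definition autC :: "real^'m^'m \<Rightarrow> bool" where
  "autC g \<longleftrightarrow> (*v) g ` C = C \<and> \<bar>det g\<bar> = 1"

lemma autC_inv_exists:
  assumes "autC g" shows "\<exists>h. autC h \<and> g ** h = mat 1 \<and> h ** g = mat 1"
proof -
  have "det g \<noteq> 0" using assms by (auto simp: autC_def)
  then have "invertible g" by (simp add: invertible_det_nz)
  then obtain h where h: "g ** h = mat 1" "h ** g = mat 1" by (auto simp: invertible_def)
  have "(*v) h ` C = (*v) h ` ((*v) g ` C)" using assms by (simp add: autC_def)
  also have "\<dots> = C" by (simp add: image_image matrix_vector_mul_assoc h)
  finally have "(*v) h ` C = C" .
  moreover have "\<bar>det h\<bar> = 1"
  proof -
    have "det g * det h = 1" using h by (metis det_I det_mul)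
    then have "\<bar>det g\<bar> * \<bar>det h\<bar> = 1" by (metis abs_1 abs_mult)
    then show ?thesis using assms by (simp add: autC_def)
  qed
  ultimately show ?thesis using h autC_def by blast
qed

definition ginv :: "real^'m^'m \<Rightarrow> real^'m^'m" where
  "ginv g = (SOME h. autC h \<and> g ** h = mat 1 \<and> h ** g = mat 1)"

lemma autC_inv: "autC g \<Longrightarrow> autC (ginv g)" and inv_right: "autC g \<Longrightarrow> g ** ginv g = mat 1"
  and inv_left: "autC g \<Longrightarrow> ginv g ** g = mat 1"
  using someI_ex[OF autC_inv_exists[of g]] unfolding ginv_def by auto

lemma inv_unique: assumes "autC g" "g ** h = mat 1" shows "ginv g = h"
proof -
  have "ginv g = ginv g ** (g ** h)" using assms by simp
  also have "\<dots> = h" using inv_left[OF assms(1)] by (simp add: matrix_mul_assoc)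
  finally show ?thesis .
qed

lemma inv_inv: "autC g \<Longrightarrow> ginv (ginv g) = g"
  using inv_unique[OF autC_inv] inv_left by blast

lemma inv_apply: "autC g \<Longrightarrow> ginv g *v (g *v v) = v" "autC g \<Longrightarrow> g *v (ginv g *v v) = v"
  by (simp_all add: matrix_vector_mul_assoc inv_left inv_right)

lemma ginv_eigen: assumes "autC g" "g *v v = l *\<^sub>R v" "l \<noteq> 0" shows "ginv g *v v = (1 / l) *\<^sub>R v"
proof -
  have "v = ginv g *v (g *v v)" by (simp only: inv_apply(1)[OF assms(1)])
  also have "\<dots> = l *\<^sub>R (ginv g *v v)" by (simp add: assms matrix_vector_mult_scaleR)
  finally have "(1 / l) *\<^sub>R v = (1 / l) *\<^sub>R (l *\<^sub>R (ginv g *v v))" by simp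
  then show ?thesis using assms by simp
qed

lemma autC_mult: assumes "autC g" "autC h" shows "autC (g ** h)"
proof -
  have "(*v) (g ** h) ` C = (*v) g ` ((*v) h ` C)" by (simp add: image_image matrix_vector_mul_assoc)
  then show ?thesis using assms by (simp add: autC_def det_mul abs_mult)
qed

lemma inv_mult: assumes "autC g" "autC h" shows "ginv (g ** h) = ginv h ** ginv g"
proof (rule inv_unique)
  have "g ** h ** (ginv h ** ginv g) = g ** (h ** ginv h) ** ginv g" by (simp add: matrix_mul_assoc)
  then show "g ** h ** (ginv h ** ginv g) = mat 1" using assms by (simp add: inv_right)
qed (use assms autC_mult in auto)

lemma autC_C: assumes "autC g" shows "g *v v \<in> C \<longleftrightarrow> v \<in> C"
proof
  assume "v \<in> C" then show "g *v v \<in> C" using assms by (auto simp: autC_def)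
next
  assume "g *v v \<in> C"
  then have "ginv g *v (g *v v) \<in> C" using autC_inv[OF assms] by (auto simp: autC_def)
  then show "v \<in> C" by (simp add: inv_apply assms)
qed

lemma autC_closure: assumes "autC g" "v \<in> closure C" shows "g *v v \<in> closure C"
proof -
  obtain u where u: "\<And>k::nat. u k \<in> C" "u \<longlonglongrightarrow> v" using assms(2) closure_seq by metis
  have "(\<lambda>k. g *v u k) \<longlonglongrightarrow> g *v v" using u by (intro tendsto_matrix_vector tendsto_const)
  moreover have "g *v u k \<in> C" for k using u autC_C assms by simp
  ultimately show ?thesis unfolding closure_seq by (intro exI[of _ "\<lambda>k. g *v u k"]) simp
qed

lemma autC_nz: assumes "autC g" "v \<noteq> 0" shows "g *v v \<noteq> 0"
  using inv_apply(1)[OF assms(1), of v] assms(2) by auto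

lemma autC_f_pos: "autC g \<Longrightarrow> v \<in> closure C \<Longrightarrow> v \<noteq> 0 \<Longrightarrow> f \<bullet> (g *v v) > 0"
  using pos autC_closure autC_nz by blast

definition act :: "real^'m^'m \<Rightarrow> real^'m \<Rightarrow> real^'m" where
  "act g v = (1 / (f \<bullet> (g *v v))) *\<^sub>R (g *v v)"

lemma act_bdry: assumes "autC g" "x \<in> bdry" shows "act g x \<in> bdry"
  unfolding act_def using assms bdryD[OF assms(2)]
  by (intro normalize_bdry) (auto simp: autC_closure autC_C autC_nz)

text \<open>An automorphism maps a ball around \<open>v\<close> into the cone, where norm and height are
  comparable. Hence the height of the image of a single interior vector controls the whole
  matrix.\<close>

lemma autC_norm_bound:
  assumes "v \<in> C" shows "\<exists>B>0. \<forall>g. autC g \<longrightarrow> norm g \<le> B * (f \<bullet> (g *v v))"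
proof -
  obtain e where e: "e > 0" "ball v e \<subseteq> C" using open_C assms by (meson openE)
  obtain d where d: "d > 0" "\<And>v. v \<in> closure C \<Longrightarrow> d * norm v \<le> f \<bullet> v" using f_lower by blast
  define B where "B = 3 / d * (2 / e)"
  have B: "B > 0" using d e by (simp add: B_def)
  have col: "norm (g *v axis j 1) \<le> B * (f \<bullet> (g *v v))" if g: "autC g" for g j
  proof -
    let ?w = "(e/2) *\<^sub>R axis j 1 :: real^'m"
    have w: "v + ?w \<in> C" "v - ?w \<in> C" using e by (auto simp: subset_iff dist_norm)
    have gw: "g *v (v + ?w) = g *v v + g *v ?w" "g *v (v - ?w) = g *v v - g *v ?w"
      by (simp_all add: matrix_vector_right_distrib matrix_vector_mult_diff_distrib)
    have p: "f \<bullet> (g *v (v + ?w)) > 0" "f \<bullet> (g *v (v - ?w)) > 0" "f \<bullet> (g *v v) > 0"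
      using w assms g autC_C C_pos by blast+
    have "d * norm (g *v (v + ?w)) \<le> f \<bullet> (g *v (v + ?w))"
      using d(2) w g autC_C closure_subset by blast
    also have "\<dots> \<le> 2 * (f \<bullet> (g *v v))" using p(2) by (simp add: gw inner_add_right inner_diff_right)
    finally have 1: "d * norm (g *v v + g *v ?w) \<le> 2 * (f \<bullet> (g *v v))" by (simp only: gw)
    have 2: "d * norm (g *v v) \<le> f \<bullet> (g *v v)" using d(2) assms g autC_C closure_subset by blast
    have "d * norm (g *v ?w) \<le> d * (norm (g *v v + g *v ?w) + norm (g *v v))"
      using d norm_triangle_ineq4[of "g *v v + g *v ?w" "g *v v"] by (intro mult_left_mono) auto
    then have "d * norm (g *v ?w) \<le> 3 * (f \<bullet> (g *v v))" using 1 2 by (simp add: distrib_left)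
    moreover have "norm (g *v ?w) = (e/2) * norm (g *v axis j 1)"
      using e by (simp add: matrix_vector_mult_scaleR)
    ultimately show ?thesis using d e by (simp add: B_def field_simps)
  qed
  have "norm g \<le> (real CARD('m) * (real CARD('m) * B)) * (f \<bullet> (g *v v))" if g: "autC g" for g
  proof -
    have ent: "\<bar>g $ i $ j\<bar> \<le> B * (f \<bullet> (g *v v))" for i j
    proof -
      have "\<bar>(g *v axis j 1) $ i\<bar> \<le> B * (f \<bullet> (g *v v))"
        using component_le_norm_cart[of "g *v axis j 1" i] col[OF g, of j] by linarith
      moreover have "(g *v axis j 1) $ i = g $ i $ j"
        by (simp add: matrix_vector_mult_def axis_def if_distrib[where f = "\<lambda>x. _ * x"] cong: if_cong)
      ultimately show ?thesis by simp
    qed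
    have "norm g \<le> (\<Sum>i\<in>UNIV. norm (g $ i))" unfolding norm_vec_def by (rule L2_set_le_sum) simp
    also have "\<dots> \<le> (\<Sum>i\<in>(UNIV::'m set). real CARD('m) * (B * (f \<bullet> (g *v v))))"
    proof (rule sum_mono)
      fix i :: 'm
      have "norm (g $ i) \<le> (\<Sum>j\<in>UNIV. \<bar>g $ i $ j\<bar>)" by (rule norm_le_l1_cart)
      also have "\<dots> \<le> (\<Sum>j\<in>(UNIV::'m set). B * (f \<bullet> (g *v v)))" by (intro sum_mono ent)
      finally show "norm (g $ i) \<le> real CARD('m) * (B * (f \<bullet> (g *v v)))" by simp
    qed
    finally show ?thesis by (simp add: mult_ac)
  qed
  then show ?thesis using B by (intro exI[of _ "real CARD('m) * (real CARD('m) * B)"]) auto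
qed

lemma det_limit_zero:
  assumes "\<And>k. autC (g k)" "s \<longlonglongrightarrow> 0" "(\<lambda>k. s k *\<^sub>R g k) \<longlonglongrightarrow> A"
  shows "det A = 0"
proof -
  have "(\<lambda>k. \<bar>det (s k *\<^sub>R g k)\<bar>) \<longlonglongrightarrow> \<bar>det A\<bar>" by (intro tendsto_intros tendsto_det assms)
  moreover have "\<bar>det (s k *\<^sub>R g k)\<bar> = \<bar>s k\<bar> ^ CARD('m)" for k
    using assms(1)[of k] by (simp add: det_scaleR_matrix abs_mult power_abs autC_def)
  moreover have "(\<lambda>k. \<bar>s k\<bar> ^ CARD('m)) \<longlonglongrightarrow> \<bar>0\<bar> ^ CARD('m)" by (intro tendsto_intros assms)
  ultimately have "(\<lambda>k. \<bar>s k\<bar> ^ CARD('m)) \<longlonglongrightarrow> \<bar>det A\<bar>" by simp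
  with \<open>(\<lambda>k. \<bar>s k\<bar> ^ CARD('m)) \<longlonglongrightarrow> \<bar>0\<bar> ^ CARD('m)\<close> show ?thesis
    using LIMSEQ_unique by (fastforce simp: zero_power)
qed

text \<open>A limit of rescaled automorphisms maps the cone into its closure, and it is singular because
  the scalings tend to zero. If \<open>A *v v\<close> were interior, then so would be, at a late
  stage of the sequence, the images of the vectors \<open>v + t *\<^sub>R w\<close> with
  \<open>w\<close> in the kernel of \<open>A\<close>; but this line leaves the cone.\<close>

lemma limit_in_frontier:
  assumes g: "\<And>k. autC (g k)" and s: "\<And>k. s k > 0" "s \<longlonglongrightarrow> 0"
    and A: "(\<lambda>k. s k *\<^sub>R g k) \<longlonglongrightarrow> A" "A \<noteq> 0" and v: "v \<in> C"
  shows "A *v v \<in> closure C" "A *v v \<noteq> 0" "A *v v \<notin> C"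
proof -
  have lim: "(\<lambda>k. s k *\<^sub>R (g k *v w)) \<longlonglongrightarrow> A *v w" for w
    using tendsto_matrix_vector[OF A(1) tendsto_const[of w]] by (simp add: scaleR_matrix_vector)
  have cl: "A *v w \<in> closure C" if "w \<in> C" for w
    unfolding closure_seq using lim[of w] s cone_C autC_C[OF g] that
    by (intro exI[of _ "\<lambda>k. s k *\<^sub>R (g k *v w)"]) auto
  show "A *v v \<in> closure C" by (rule cl[OF v])
  show "A *v v \<noteq> 0"
  proof
    assume 0: "A *v v = 0"
    obtain e where e: "e > 0" "ball v e \<subseteq> C" using open_C v by (meson openE)
    have "A *v w = 0" for w
    proof -
      define t where "t = e / (2 * (norm w + 1))"
      have t: "t > 0" using e by (simp add: t_def add_nonneg_pos)
      have "norm w < 2 * (norm w + 1)" using norm_ge_zero[of w] by argo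
      then have "e * norm w < e * (2 * (norm w + 1))" using e(1) by (rule mult_strict_left_mono)
      moreover have "2 * (norm w + 1) > 0" by (simp add: add_nonneg_pos)
      ultimately have "t * norm w < e" by (simp add: t_def pos_divide_less_eq del: distrib_left_numeral)
      then have "v + t *\<^sub>R w \<in> C" "v + (- t) *\<^sub>R w \<in> C" using e t by (auto simp: subset_iff dist_norm)
      then have "A *v (v + t *\<^sub>R w) \<in> closure C" "A *v (v + (- t) *\<^sub>R w) \<in> closure C" by (auto intro: cl)
      then have "t *\<^sub>R (A *v w) \<in> closure C" "- (t *\<^sub>R (A *v w)) \<in> closure C"
        by (simp_all add: matrix_vector_right_distrib matrix_vector_mult_diff_distrib 0 matrix_vector_mult_scaleR)
      then have "t *\<^sub>R (A *v w) = 0" by (rule pointed)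
      then show ?thesis using t by simp
    qed
    then have "A = 0" by (intro matrix_eqI) simp
    then show False using A by simp
  qed
  show "A *v v \<notin> C"
  proof
    assume inC: "A *v v \<in> C"
    have "det A = 0" by (rule det_limit_zero[OF g s(2) A(1)])
    then have "\<not> invertible A" by (simp add: invertible_det_nz)
    then obtain w where w: "w \<noteq> 0" "A *v w = 0"
      by (metis invertible_left_inverse matrix_left_invertible_ker)
    have "\<exists>t. v + t *\<^sub>R w \<notin> closure C"
    proof (rule ccontr)
      assume "\<not> ?thesis"
      then have all: "v + t *\<^sub>R w \<in> closure C" for t by blast
      have "u \<in> closure C" if u: "\<And>t. v + t *\<^sub>R u \<in> closure C" for u
      proof -
        have "inverse (real (Suc k)) *\<^sub>R v + u \<in> closure C" for k
          using closure_scale[OF u[of "real (Suc k)"], of "inverse (real (Suc k))"]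
          by (simp add: scaleR_add_right del: of_nat_Suc)
        moreover have "(\<lambda>k. inverse (real (Suc k)) *\<^sub>R v + u) \<longlonglongrightarrow> 0 *\<^sub>R v + u"
          by (intro tendsto_intros LIMSEQ_inverse_real_of_nat)
        ultimately have "0 *\<^sub>R v + u \<in> closure C" by (meson closed_closure closed_sequentially)
        then show ?thesis by simp
      qed
      from this[of w] this[of "-w"] all all[of "- _"] have "w \<in> closure C" "- w \<in> closure C"
        by (force, metis scaleR_minus_left scaleR_minus_right)
      then show False using pointed w by blast
    qed
    then obtain t where t: "v + t *\<^sub>R w \<notin> closure C" by blast
    have "(\<lambda>k. s k *\<^sub>R (g k *v (v + t *\<^sub>R w))) \<longlonglongrightarrow> A *v v"
      using lim[of "v + t *\<^sub>R w"] w by (simp add: matrix_vector_right_distrib matrix_vector_mult_scaleR)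
    then have "eventually (\<lambda>k. s k *\<^sub>R (g k *v (v + t *\<^sub>R w)) \<in> C) sequentially"
      using open_C inC by (rule topological_tendstoD)
    then have "\<exists>k. s k *\<^sub>R (g k *v (v + t *\<^sub>R w)) \<in> C"
      by (rule eventually_happens'[OF sequentially_bot])
    then obtain k where "s k *\<^sub>R (g k *v (v + t *\<^sub>R w)) \<in> C" ..
    from cone_C[OF this, of "1 / s k"] s(1)[of k] have "g k *v (v + t *\<^sub>R w) \<in> C" by simp
    then have "v + t *\<^sub>R w \<in> C" using autC_C[OF g] by simp
    then show False using t closure_subset by blast
  qed
qed

lemma C_spans: assumes "\<And>v. v \<in> C \<Longrightarrow> A *v v = B *v v" shows "A = B"
proof (rule matrix_eqI)
  fix v
  obtain r where "v + r *\<^sub>R base \<in> C" using exit_exists[OF base_C, of v] by (meson gt_ex)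
  from assms[OF this] assms[OF base_C] show "A *v v = B *v v"
    by (simp add: matrix_vector_right_distrib matrix_vector_mult_scaleR)
qed

end

context smooth_cone
begin

text \<open>The image of the cone under a singular limit of automorphisms avoids the interior, and strict
  convexity reduces it to a single ray.\<close>

lemma limit_rank_one:
  assumes g: "\<And>k. autC (g k)" and s: "\<And>k. s k > 0" "s \<longlonglongrightarrow> 0"
    and A: "(\<lambda>k. s k *\<^sub>R g k) \<longlonglongrightarrow> A" "A \<noteq> 0"
  shows "\<exists>x\<in>bdry. \<exists>a. A = outer x a \<and> (\<forall>v\<in>C. a \<bullet> v > 0)"
proof -
  note lk = limit_in_frontier[OF g s A]
  define n where "n v = (1 / (f \<bullet> (A *v v))) *\<^sub>R (A *v v)" for v
  have n: "n v \<in> bdry" "f \<bullet> (A *v v) > 0" "A *v v = (f \<bullet> (A *v v)) *\<^sub>R n v" if "v \<in> C" for v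
  proof -
    show "n v \<in> bdry" unfolding n_def using lk[OF that] by (intro normalize_bdry) auto
    show "f \<bullet> (A *v v) > 0" using lk[OF that] pos by blast
    then show "A *v v = (f \<bullet> (A *v v)) *\<^sub>R n v" by (simp add: n_def)
  qed
  define x where "x = n base"
  have eq: "n v = x" if v: "v \<in> C" for v
  proof (rule ccontr)
    assume "n v \<noteq> x"
    then have "(f \<bullet> (A *v v)) *\<^sub>R n v + (f \<bullet> (A *v base)) *\<^sub>R x \<in> C"
      using n v base_C unfolding x_def by (intro strict) auto
    then have "A *v (v + base) \<in> C"
      using n(3)[OF v] n(3)[OF base_C] by (simp add: x_def matrix_vector_right_distrib)
    then show False using lk(3) add_C v base_C by blast
  qed
  define a where "a = transpose A *v f"
  have a: "a \<bullet> v = f \<bullet> (A *v v)" for v unfolding a_def by (rule transpose_inner)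
  have "A = outer x a"
    using n(3) eq by (intro C_spans) (simp add: a)
  moreover have "\<forall>v\<in>C. a \<bullet> v > 0" using n(2) by (simp add: a)
  moreover have "x \<in> bdry" using n base_C by (simp add: x_def)
  ultimately show ?thesis by blast
qed

text \<open>The sequence degenerates to rank one with attracting point \<open>x\<close> and repelling
  point \<open>y\<close>, and the sequence of inverses does so with the two exchanged. The
  scalings \<open>s\<close>, \<open>t\<close> and the factors \<open>c\<close>, \<open>d\<close>
  are part of the data because the ratio \<open>s k / t k\<close> is what the eigenvalues
  control.\<close>

definition converges :: "(nat \<Rightarrow> real^'m^'m) \<Rightarrow> (nat \<Rightarrow> real) \<Rightarrow> (nat \<Rightarrow> real) \<Rightarrow> real \<Rightarrow> real
     \<Rightarrow> real^'m \<Rightarrow> real^'m \<Rightarrow> bool" where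
  "converges g s t c d x y \<longleftrightarrow> (\<forall>k. autC (g k) \<and> s k > 0 \<and> t k > 0) \<and> s \<longlonglongrightarrow> 0 \<and> t \<longlonglongrightarrow> 0 \<and>
     c > 0 \<and> d > 0 \<and> x \<in> bdry \<and> y \<in> bdry \<and>
     (\<lambda>k. s k *\<^sub>R g k) \<longlonglongrightarrow> c *\<^sub>R outer x (tang y) \<and>
     (\<lambda>k. t k *\<^sub>R ginv (g k)) \<longlonglongrightarrow> d *\<^sub>R outer y (tang x)"

lemma convergesD:
  assumes "converges g s t c d x y"
  shows "autC (g k)" "s k > 0" "t k > 0" "s \<longlonglongrightarrow> 0" "t \<longlonglongrightarrow> 0" "c > 0" "d > 0" "x \<in> bdry" "y \<in> bdry"
    "(\<lambda>k. s k *\<^sub>R g k) \<longlonglongrightarrow> c *\<^sub>R outer x (tang y)"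
    "(\<lambda>k. t k *\<^sub>R ginv (g k)) \<longlonglongrightarrow> d *\<^sub>R outer y (tang x)"
  using assms by (auto simp: converges_def)

lemma converges_inv: "converges g s t c d x y \<Longrightarrow> converges (\<lambda>k. ginv (g k)) t s d c y x"
  by (auto simp: converges_def autC_inv inv_inv)

text \<open>By unimodularity the inverses are unbounded too, so both normalized sequences have rank one
  limits. The products of the two limits vanish in either order; therefore the functional of
  each limit vanishes at the boundary point of the other one and is its tangent functional.\<close>

lemma convergence_subseq:
  assumes g: "\<And>k. autC (g k)" and top: "filterlim (\<lambda>k. norm (g k)) at_top sequentially"
  shows "\<exists>r c d x y. strict_mono r \<and>
    converges (\<lambda>k. g (r k)) (\<lambda>k. 1 / norm (g (r k))) (\<lambda>k. 1 / norm (ginv (g (r k)))) c d x y"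
proof -
  have nz: "h \<noteq> 0" if "autC h" for h
  proof
    assume "h = 0"
    then have "h *v base = 0" by simp
    then show False using autC_nz[OF that, of base] base_C zero_notin_C by metis
  qed
  have itop: "filterlim (\<lambda>k. norm (ginv (g k))) at_top sequentially"
  proof (subst filterlim_at_top, intro allI)
    fix Z
    obtain R' where R': "\<And>M N :: real^'m^'m. M ** N = mat 1 \<Longrightarrow> \<bar>det M\<bar> = 1 \<Longrightarrow> norm M \<le> Z \<Longrightarrow> norm N \<le> R'"
      using norm_inverse_bounded by blast
    have "eventually (\<lambda>k. norm (g k) \<ge> R' + 1) sequentially" using top by (simp add: filterlim_at_top)
    then show "eventually (\<lambda>k. Z \<le> norm (ginv (g k))) sequentially"
    proof eventually_elim
      case (elim k)
      show ?case
      proof (rule ccontr)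
        assume "\<not> ?case"
        then have "norm (g k) \<le> R'"
          using g[of k] autC_inv[OF g[of k]] by (intro R'[of "ginv (g k)"]) (auto simp: inv_left autC_def)
        then show False using elim by simp
      qed
    qed
  qed
  have z: "(\<lambda>k. 1 / norm (g k)) \<longlonglongrightarrow> 0"
    by (rule tendsto_divide_0[OF tendsto_const filterlim_at_top_imp_at_infinity[OF top]])
  have iz: "(\<lambda>k. 1 / norm (ginv (g k))) \<longlonglongrightarrow> 0"
    by (rule tendsto_divide_0[OF tendsto_const filterlim_at_top_imp_at_infinity[OF itop]])
  obtain r A where r: "strict_mono r" "norm A = 1" "(\<lambda>k. (1 / norm (g (r k))) *\<^sub>R g (r k)) \<longlonglongrightarrow> A"
    using exists_subseq_normalized[of g] nz g by blast
  obtain q B where q: "strict_mono q" "norm B = 1"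
     "(\<lambda>k. (1 / norm (ginv (g (r (q k))))) *\<^sub>R ginv (g (r (q k)))) \<longlonglongrightarrow> B"
    using exists_subseq_normalized[of "\<lambda>k. ginv (g (r k))"] nz autC_inv g by blast
  define p where "p k = r (q k)" for k
  have p: "strict_mono p" using r q by (simp add: p_def strict_mono_def)
  define s where "s k = 1 / norm (g (p k))" for k
  define t where "t k = 1 / norm (ginv (g (p k)))" for k
  have gp: "autC (g (p k))" for k using g by simp
  have s: "s k > 0" "s \<longlonglongrightarrow> 0" for k
    using nz[OF gp] LIMSEQ_subseq_LIMSEQ[OF z p] by (auto simp: s_def[abs_def] o_def)
  have t: "t k > 0" "t \<longlonglongrightarrow> 0" for k
    using nz[OF autC_inv[OF gp]] LIMSEQ_subseq_LIMSEQ[OF iz p] by (auto simp: t_def[abs_def] o_def)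
  have limA: "(\<lambda>k. s k *\<^sub>R g (p k)) \<longlonglongrightarrow> A"
    using LIMSEQ_subseq_LIMSEQ[OF r(3) q(1)] by (simp add: s_def p_def o_def)
  have limB: "(\<lambda>k. t k *\<^sub>R ginv (g (p k))) \<longlonglongrightarrow> B" using q(3) by (simp add: t_def p_def)
  have nzAB: "A \<noteq> 0" "B \<noteq> 0" using r q by auto
  obtain x a where x: "x \<in> bdry" "A = outer x a" "\<And>v. v \<in> C \<Longrightarrow> a \<bullet> v > 0"
    using limit_rank_one[OF gp s limA nzAB(1)] by blast
  obtain y b where y: "y \<in> bdry" "B = outer y b" "\<And>v. v \<in> C \<Longrightarrow> b \<bullet> v > 0"
    using limit_rank_one[OF autC_inv[OF gp] t limB nzAB(2)] by blast
  have prods: "(\<lambda>k. (s k * t k) *\<^sub>R (mat 1 :: real^'m^'m)) \<longlonglongrightarrow> 0 *\<^sub>R mat 1"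
    using s t tendsto_mult[OF s(2) t(2)] by (intro tendsto_scaleR tendsto_const) simp
  have "(\<lambda>k. (s k *\<^sub>R g (p k)) ** (t k *\<^sub>R ginv (g (p k)))) \<longlonglongrightarrow> A ** B"
    by (intro tendsto_matrix_mult limA limB)
  then have "(\<lambda>k. (s k * t k) *\<^sub>R (mat 1 :: real^'m^'m)) \<longlonglongrightarrow> A ** B"
    by (simp add: scaleR_matrix_mult matrix_mult_scaleR inv_right[OF gp] mult.commute)
  then have "A ** B = 0" using LIMSEQ_unique[OF prods] by simp
  then have "a \<bullet> y = 0"
    using x(1,2) y(1,2) y(3)[OF base_C] bdryD(4) by (auto simp: outer_mult_outer outer_eq_0_iff)
  have "(\<lambda>k. (t k *\<^sub>R ginv (g (p k))) ** (s k *\<^sub>R g (p k))) \<longlonglongrightarrow> B ** A"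
    by (intro tendsto_matrix_mult limA limB)
  then have "(\<lambda>k. (s k * t k) *\<^sub>R (mat 1 :: real^'m^'m)) \<longlonglongrightarrow> B ** A"
    by (simp add: scaleR_matrix_mult matrix_mult_scaleR inv_left[OF gp] mult.commute)
  then have "B ** A = 0" using LIMSEQ_unique[OF prods] by simp
  then have "b \<bullet> x = 0"
    using x(1,2) y(1,2) x(3)[OF base_C] bdryD(4) by (auto simp: outer_mult_outer outer_eq_0_iff)
  have "supports a y" using \<open>a \<bullet> y = 0\<close> x(3) x(3)[OF base_C] by (auto simp: supports_def less_imp_le)
  then have a: "a = (a \<bullet> base) *\<^sub>R tang y" by (rule supports_eq_tang[OF y(1)])
  have "supports b x" using \<open>b \<bullet> x = 0\<close> y(3) y(3)[OF base_C] by (auto simp: supports_def less_imp_le)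
  then have b: "b = (b \<bullet> base) *\<^sub>R tang x" by (rule supports_eq_tang[OF x(1)])
  have "A = (a \<bullet> base) *\<^sub>R outer x (tang y)" using x(2) a by (metis outer_scaleR_right)
  moreover have "B = (b \<bullet> base) *\<^sub>R outer y (tang x)" using y(2) b by (metis outer_scaleR_right)
  ultimately have "converges (\<lambda>k. g (p k)) s t (a \<bullet> base) (b \<bullet> base) x y"
    unfolding converges_def using gp s t x(1,3) y(1,3) base_C limA limB by auto
  then show ?thesis using p unfolding s_def t_def by blast
qed

lemma converges_apply:
  assumes c: "converges g s t c d x y" and v: "u \<longlonglongrightarrow> v" "\<And>k. u k \<in> closure C" "\<And>k. u k \<noteq> 0" "tang y \<bullet> v > 0"
  shows "(\<lambda>k. act (g k) (u k)) \<longlonglongrightarrow> x"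
proof -
  note cD = convergesD[OF c]
  have "(\<lambda>k. (s k *\<^sub>R g k) *v u k) \<longlonglongrightarrow> (c *\<^sub>R outer x (tang y)) *v v"
    by (intro tendsto_matrix_vector cD v)
  then have lim: "(\<lambda>k. s k *\<^sub>R (g k *v u k)) \<longlonglongrightarrow> (c * (tang y \<bullet> v)) *\<^sub>R x"
    by (simp add: scaleR_matrix_vector)
  have fl: "(\<lambda>k. f \<bullet> (s k *\<^sub>R (g k *v u k))) \<longlonglongrightarrow> f \<bullet> ((c * (tang y \<bullet> v)) *\<^sub>R x)"
    by (intro tendsto_intros lim)
  have fx: "f \<bullet> ((c * (tang y \<bullet> v)) *\<^sub>R x) = c * (tang y \<bullet> v)" using bdryD(3)[OF cD(8)] by simp
  have p: "c * (tang y \<bullet> v) > 0" using v cD by simp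
  have "(\<lambda>k. (1 / (f \<bullet> (s k *\<^sub>R (g k *v u k)))) *\<^sub>R (s k *\<^sub>R (g k *v u k))) \<longlonglongrightarrow>
      (1 / (c * (tang y \<bullet> v))) *\<^sub>R ((c * (tang y \<bullet> v)) *\<^sub>R x)"
    using fl p unfolding fx by (intro tendsto_intros lim) auto
  moreover have "(1 / (f \<bullet> (s k *\<^sub>R (g k *v u k)))) *\<^sub>R (s k *\<^sub>R (g k *v u k)) = act (g k) (u k)" for k
    using cD(2)[of k] by (simp add: act_def)
  moreover have "(1 / (c * (tang y \<bullet> v))) *\<^sub>R ((c * (tang y \<bullet> v)) *\<^sub>R x) = x" using cD(6) v(4) by simp
  ultimately show ?thesis by (simp only:)
qed

end

section \<open>Volume of linear images\<close>

text \<open>A copy of a finite type, well-ordered by an enumeration. The formula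
  \<open>measure_linear_image\<close> is proved by elimination and is stated for vectors whose
  index type is well-ordered; along this copy it carries over to vectors with an arbitrary
  finite index type.\<close>

typedef 'a wcopy = "UNIV :: 'a set" by auto

instance wcopy :: (finite) finite
proof
  have "(UNIV :: 'a wcopy set) = range Abs_wcopy" 
    by (rule UNIV_eq_I) (metis Rep_wcopy_inverse rangeI)
  moreover have "finite (range (Abs_wcopy :: 'a \<Rightarrow> 'a wcopy))" by (rule finite_imageI) (rule finite)
  ultimately show "finite (UNIV :: 'a wcopy set)" by metis
qed

instantiation wcopy :: (finite) wellorder
begin

definition "x \<le> y \<longleftrightarrow> to_nat (Rep_wcopy x) \<le> to_nat (Rep_wcopy y)"
definition "x < y \<longleftrightarrow> to_nat (Rep_wcopy x) < to_nat (Rep_wcopy y)"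

instance
proof
  fix P :: "'a wcopy \<Rightarrow> bool" and a
  assume *: "\<And>x. (\<And>y. y < x \<Longrightarrow> P y) \<Longrightarrow> P x"
  show "P a"
    by (rule measure_induct_rule[where f = "\<lambda>x. to_nat (Rep_wcopy x)"])
       (use * in \<open>auto simp: less_wcopy_def\<close>)
qed (auto simp: less_eq_wcopy_def less_wcopy_def Rep_wcopy_inject)

end

definition recopy_fun :: "('a \<Rightarrow> 'a) \<Rightarrow> 'a wcopy \<Rightarrow> 'a wcopy" where
  "recopy_fun p = Abs_wcopy \<circ> p \<circ> Rep_wcopy"

lemma wcopy_inv [simp]: "Abs_wcopy (Rep_wcopy x) = x" "Rep_wcopy (Abs_wcopy y) = y"
  by (simp_all add: Rep_wcopy_inverse Abs_wcopy_inverse)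

lemma bij_Rep_wcopy: "bij Rep_wcopy"
  by (rule bij_betw_byWitness[where f' = Abs_wcopy]) auto

lemma bij_Abs_wcopy: "bij Abs_wcopy"
  by (rule bij_betw_byWitness[where f' = Rep_wcopy]) auto

lemma recopy_fun_permutes: "p permutes UNIV \<Longrightarrow> recopy_fun p permutes UNIV"
  unfolding recopy_fun_def
  by (intro bij_imp_permutes bij_comp bij_Rep_wcopy bij_Abs_wcopy) (auto simp: permutes_bij)

lemma inj_transpose:
  "inj h \<Longrightarrow> h (Transposition.transpose a b y) = Transposition.transpose (h a) (h b) (h y)"
  by (simp add: Transposition.transpose_def inj_eq)

lemma sign_recopy_fun:
  fixes p :: "'a::finite \<Rightarrow> 'a"
  assumes "p permutes UNIV" shows "sign (recopy_fun p) = sign p"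
  using assms finite[of UNIV]
proof (induction p rule: permutes_induct)
  case id
  have "recopy_fun id = (id :: 'a wcopy \<Rightarrow> _)" by (auto simp: recopy_fun_def)
  then show ?case by (simp only: sign_id)
next
  case (swap a b p)
  have eq: "recopy_fun (Transposition.transpose a b \<circ> p)
      = Transposition.transpose (Abs_wcopy a) (Abs_wcopy b) \<circ> recopy_fun p"
  proof (rule ext)
    fix x
    have "Abs_wcopy (Transposition.transpose a b (p (Rep_wcopy x))) =
        Transposition.transpose (Abs_wcopy a) (Abs_wcopy b) (Abs_wcopy (p (Rep_wcopy x)))"
      by (rule inj_transpose[OF bij_is_inj[OF bij_Abs_wcopy]])
    then show "recopy_fun (Transposition.transpose a b \<circ> p) x =
        (Transposition.transpose (Abs_wcopy a) (Abs_wcopy b) \<circ> recopy_fun p) x"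
      by (simp only: recopy_fun_def comp_apply)
  qed
  have "permutation p" "permutation (recopy_fun p)"
    by (rule permutes_imp_permutation[OF finite swap(4)],
        rule permutes_imp_permutation[OF finite recopy_fun_permutes[OF swap(4)]])
  then have "sign (recopy_fun (Transposition.transpose a b \<circ> p)) = - sign (recopy_fun p)"
    "sign (Transposition.transpose a b \<circ> p) = - sign p"
    using swap(3) Abs_wcopy_inject[of a b] unfolding eq
    by (simp_all only: sign_compose[OF permutation_swap_id] sign_swap_id) auto
  then show ?case using swap(5) by (simp only: swap(4))
qed

definition recopy_vec :: "real^'a \<Rightarrow> real^('a wcopy)" where
  "recopy_vec v = (\<chi> i. v $ Rep_wcopy i)"

definition recopy_mat :: "real^'a^'a \<Rightarrow> real^('a wcopy)^('a wcopy)" where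
  "recopy_mat A = (\<chi> i j. A $ Rep_wcopy i $ Rep_wcopy j)"

lemma det_recopy_mat: "det (recopy_mat A) = det (A :: real^'a::finite^'a)"
proof -
  have bij: "bij_betw recopy_fun {p. p permutes (UNIV::'a set)} {p. p permutes UNIV}"
  proof (rule bij_betw_byWitness[where f' = "\<lambda>q. Rep_wcopy \<circ> q \<circ> Abs_wcopy"])
    show "(\<lambda>q. Rep_wcopy \<circ> q \<circ> Abs_wcopy) ` {p. p permutes UNIV} \<subseteq> {p. p permutes (UNIV::'a set)}"
    proof clarify
      fix q :: "'a wcopy \<Rightarrow> 'a wcopy" assume "q permutes UNIV"
      then have "bij (Rep_wcopy \<circ> q \<circ> Abs_wcopy)"
        by (intro bij_comp bij_Rep_wcopy bij_Abs_wcopy permutes_bij)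
      then show "(Rep_wcopy \<circ> q \<circ> Abs_wcopy) permutes UNIV" by (rule bij_imp_permutes) simp
    qed
  qed (auto simp: recopy_fun_def fun_eq_iff intro: recopy_fun_permutes[unfolded recopy_fun_def])
  have "det (recopy_mat A) = (\<Sum>p | p permutes UNIV. of_int (sign (recopy_fun p)) *
      (\<Prod>i\<in>UNIV. recopy_mat A $ i $ recopy_fun p i))"
    unfolding det_def by (rule sum.reindex_bij_betw[OF bij, symmetric])
  also have "\<dots> = det A"
    unfolding det_def
  proof (rule sum.cong)
    fix p :: "'a \<Rightarrow> 'a" assume "p \<in> {p. p permutes UNIV}"
    then have p: "p permutes UNIV" by simp
    have "(\<Prod>i\<in>UNIV. recopy_mat A $ i $ recopy_fun p i) =
        (\<Prod>i\<in>UNIV. A $ Rep_wcopy i $ p (Rep_wcopy i))"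
      by (simp add: recopy_mat_def recopy_fun_def)
    also have "\<dots> = (\<Prod>i\<in>UNIV. A $ i $ p i)"
      by (rule prod.reindex_bij_betw[OF bij_Rep_wcopy])
    finally show "of_int (sign (recopy_fun p)) * (\<Prod>i\<in>UNIV. recopy_mat A $ i $ recopy_fun p i)
        = of_int (sign p) * (\<Prod>i\<in>UNIV. A $ i $ p i)"
      by (simp add: sign_recopy_fun[OF p])
  qed simp
  finally show ?thesis .
qed

lemma recopy_vec_mult: "recopy_vec (A *v v) = recopy_mat A *v recopy_vec (v :: real^'a::finite)"
  unfolding vec_eq_iff recopy_vec_def recopy_mat_def matrix_vector_mult_def vec_lambda_beta
  by (intro allI sum.reindex_bij_betw[OF bij_Rep_wcopy, symmetric])

lemma prod_Basis_vec: "(\<Prod>b\<in>Basis. (v :: real^'a) \<bullet> b) = (\<Prod>i\<in>UNIV. v $ i)"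
proof -
  let ?e = "\<lambda>i. axis i 1 :: real^'a"
  have "Basis = range ?e" by (auto simp: Basis_vec_def)
  moreover have "inj ?e" by (simp add: inj_def axis_eq_axis)
  then have "prod ((\<bullet>) v) (range ?e) = prod ((\<bullet>) v \<circ> ?e) UNIV" by (rule prod.reindex)
  moreover have "(\<bullet>) v \<circ> ?e = ($) v" by (auto simp: inner_axis)
  ultimately show ?thesis by simp
qed

lemma distr_recopy_vec: "distr lborel borel (recopy_vec :: real^'a::finite \<Rightarrow> _) = lborel"
proof (rule lborel_eqI[symmetric])
  have cont: "continuous_on UNIV (recopy_vec :: real^'a \<Rightarrow> _)"
    unfolding recopy_vec_def by (intro continuous_intros)
  then have meas: "(recopy_vec :: real^'a \<Rightarrow> _) \<in> borel_measurable lborel"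
    by (simp add: borel_measurable_continuous_onI)
  fix l u :: "real^('a wcopy)" assume le: "\<And>b. b \<in> Basis \<Longrightarrow> l \<bullet> b \<le> u \<bullet> b"
  then have le': "l $ i \<le> u $ i" for i
    using le[of "axis i 1"] by (simp add: inner_axis)
  define r where "r v = (\<chi> i. v $ Abs_wcopy i)" for v :: "real^('a wcopy)"
  have "recopy_vec v \<in> box l u \<longleftrightarrow> v \<in> box (r l) (r u)" for v
    unfolding mem_box_cart recopy_vec_def r_def vec_lambda_beta by (metis wcopy_inv)
  then have "recopy_vec -` box l u = box (r l) (r u)" by blast
  then have "emeasure (distr lborel borel recopy_vec) (box l u) = emeasure lborel (box (r l) (r u))"
    using meas by (simp add: emeasure_distr)
  also have "\<dots> = (\<Prod>b\<in>Basis. (r u - r l) \<bullet> b)"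
    using le' by (intro emeasure_lborel_box) (auto simp: Basis_vec_def inner_axis r_def)
  also have "(\<Prod>b\<in>Basis. (r u - r l) \<bullet> b) = (\<Prod>i\<in>UNIV. (r u - r l) $ i)" by (rule prod_Basis_vec)
  also have "\<dots> = (\<Prod>i\<in>UNIV. (u - l) $ i)"
    using prod.reindex_bij_betw[OF bij_Rep_wcopy, of "\<lambda>i. (r u - r l) $ i"] by (simp add: r_def)
  also have "\<dots> = (\<Prod>b\<in>Basis. (u - l) \<bullet> b)" by (rule prod_Basis_vec[symmetric])
  finally show "emeasure (distr lborel borel recopy_vec) (box l u) = (\<Prod>b\<in>Basis. (u - l) \<bullet> b)" .
qed simp

lemma measure_matrix_image:
  fixes A :: "real^'a::finite^'a"
  assumes S: "S \<in> sets borel" "bounded S" and A: "det A \<noteq> 0"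
  shows "measure lebesgue ((*v) A ` S) = \<bar>det A\<bar> * measure lebesgue S"
proof -
  define g :: "real^('a wcopy) \<Rightarrow> real^'a" where "g v = (\<chi> i. v $ Abs_wcopy i)" for v
  have g: "continuous_on UNIV g" "\<And>x. g (recopy_vec x) = x" "\<And>y. recopy_vec (g y) = y"
    by (auto simp: recopy_vec_def g_def intro!: continuous_intros)
  have im: "recopy_vec ` X = g -` X" for X
  proof (intro equalityI subsetI)
    fix y assume "y \<in> g -` X"
    then show "y \<in> recopy_vec ` X" using g(3)[of y] by (metis image_eqI vimage_eq)
  qed (auto simp: g(2))
  have cont: "continuous_on UNIV (recopy_vec :: real^'a \<Rightarrow> _)"
    unfolding recopy_vec_def by (intro continuous_intros)
  have borel_im: "recopy_vec ` X \<in> sets borel" if "X \<in> sets borel" for X :: "(real^'a) set"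
    unfolding im using measurable_sets[OF borel_measurable_continuous_onI[OF g(1)] that] by simp
  have m: "measure lebesgue (recopy_vec ` X) = measure lebesgue X" if X: "X \<in> sets borel" for X :: "(real^'a) set"
  proof -
    have "emeasure lborel (recopy_vec ` X) = emeasure (distr lborel borel recopy_vec) (recopy_vec ` X)"
      by (simp add: distr_recopy_vec)
    also have "\<dots> = emeasure lborel (recopy_vec -` recopy_vec ` X)"
      using borel_measurable_continuous_onI[OF cont] borel_im[OF X] by (simp add: emeasure_distr)
    also have "recopy_vec -` recopy_vec ` X = X" using g(2) by (metis inj_on_inverseI inj_vimage_image_eq)
    finally show ?thesis using X borel_im[OF X] by (simp add: measure_def)
  qed
  obtain B where B: "A ** B = mat 1" "B ** A = mat 1"
    using A invertible_det_nz[of A] unfolding invertible_def by blast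
  have "x \<in> (*v) A ` S \<longleftrightarrow> B *v x \<in> S" for x
  proof
    assume "x \<in> (*v) A ` S" then show "B *v x \<in> S" using B by (auto simp: matrix_vector_mul_assoc)
  next
    assume "B *v x \<in> S"
    moreover have "x = A *v (B *v x)" using B by (simp add: matrix_vector_mul_assoc)
    ultimately show "x \<in> (*v) A ` S" by blast
  qed
  then have "(*v) A ` S = (*v) B -` S" by blast
  moreover have "continuous_on UNIV ((*v) B)" by (simp add: linear_continuous_on)
  ultimately have AS: "(*v) A ` S \<in> sets borel"
    using measurable_sets[OF borel_measurable_continuous_onI S(1), of "(*v) B"] by simp
  have "bounded (recopy_vec ` S)"
  proof -
    have "compact (recopy_vec ` closure S)"
      using S(2) by (intro compact_continuous_image continuous_on_subset[OF cont]) auto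
    moreover have "recopy_vec ` S \<subseteq> recopy_vec ` closure S" using closure_subset by blast
    ultimately show ?thesis using compact_imp_bounded bounded_subset by blast
  qed
  then have lm: "recopy_vec ` S \<in> lmeasurable"
    using borel_im[OF S(1)] by (simp add: bounded_set_imp_lmeasurable)
  have "measure lebesgue ((*v) A ` S) = measure lebesgue (recopy_vec ` ((*v) A ` S))"
    by (rule m[OF AS, symmetric])
  also have "recopy_vec ` ((*v) A ` S) = (*v) (recopy_mat A) ` (recopy_vec ` S)"
    by (simp add: image_image recopy_vec_mult)
  also have "measure lebesgue \<dots> = \<bar>det (matrix ((*v) (recopy_mat A)))\<bar> * measure lebesgue (recopy_vec ` S)"
    by (rule measure_linear_image) (auto intro: lm)
  also have "\<dots> = \<bar>det A\<bar> * measure lebesgue S"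
    by (simp add: matrix_of_matrix_vector_mul det_recopy_mat m[OF S(1)])
  finally show ?thesis .
qed

section \<open>Eigenvalues at two fixed boundary points\<close>

context smooth_cone
begin

lemma eigenvalue_pos: assumes "autC g" "x \<in> bdry" "g *v x = l *\<^sub>R x" shows "l > 0"
  using autC_f_pos[OF assms(1), of x] bdryD[OF assms(2)] assms(3) by simp

text \<open>The functional \<open>tang x \<circ> g\<close> supports the cone at the fixed point
  \<open>x\<close>, so it is a multiple of \<open>tang x\<close>; the factor is read off at
  \<open>y\<close>.\<close>

lemma tang_eigen:
  assumes g: "autC g" and x: "x \<in> bdry" "g *v x = l *\<^sub>R x" and y: "y \<in> bdry" "g *v y = u *\<^sub>R y" "x \<noteq> y"
  shows "tang x \<bullet> (g *v v) = u * (tang x \<bullet> v)"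
proof -
  define b where "b = transpose g *v tang x"
  have b: "b \<bullet> v = tang x \<bullet> (g *v v)" for v unfolding b_def by (rule transpose_inner)
  have "b \<bullet> base > 0" using b tang_pos_C x(1) autC_C[OF g] base_C by simp
  then have "supports b x"
    using b tang_pos_C x autC_C[OF g] tang_self by (auto simp: supports_def less_imp_le)
  then have e: "b = (b \<bullet> base) *\<^sub>R tang x" by (rule supports_eq_tang[OF x(1)])
  have "b \<bullet> y = (b \<bullet> base) * (tang x \<bullet> y)" using e by (metis inner_scaleR_left)
  then have "b \<bullet> base = u" using b y tang_pos[OF x(1) y(1,3)] by auto
  then show ?thesis using e b by (metis inner_scaleR_left)
qed

text \<open>In the affine chart that sends the tangent hyperplane at \<open>y\<close> to infinity, a cap
  of height \<open>t\<close> at \<open>x\<close>; more precisely the cone over this cap,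
  truncated at \<open>tang y \<bullet> v < 1\<close>. An automorphism fixing \<open>x\<close>
  and \<open>y\<close> acts on that chart by an affine map and permutes the caps.\<close>

definition wedge :: "real^'m \<Rightarrow> real^'m \<Rightarrow> real \<Rightarrow> (real^'m) set" where
  "wedge x y t = {v \<in> C. tang y \<bullet> v < 1 \<and> tang x \<bullet> v < t * (tang y \<bullet> v)}"

lemma wedge_bounded:
  assumes "x \<in> bdry" "y \<in> bdry" "x \<noteq> y" shows "bounded (wedge x y t)" and wedge_open: "open (wedge x y t)"
proof -
  have *: "(tang x + tang y) \<bullet> v > 0" if "v \<in> closure C" "v \<noteq> 0" for v
  proof -
    have "v \<noteq> (f \<bullet> v) *\<^sub>R x \<or> v \<noteq> (f \<bullet> v) *\<^sub>R y"
    proof (rule ccontr)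
      assume "\<not> ?thesis"
      then have "(f \<bullet> v) *\<^sub>R x = (f \<bullet> v) *\<^sub>R y" by metis
      then show False using pos[OF that] assms by simp
    qed
    then show ?thesis
      using tang_pos_closure[OF assms(1) that(1)] tang_pos_closure[OF assms(2) that(1)]
        tang_nonneg[OF assms(1) that(1)] tang_nonneg[OF assms(2) that(1)]
      by (auto simp: inner_add_left intro: add_pos_nonneg add_nonneg_pos)
  qed
  interpret h: sharp_cone C "tang x + tang y"
    using open_C conv_C cone_C ne_C * by unfold_locales auto
  obtain d where d: "d > 0" "\<And>v. v \<in> closure C \<Longrightarrow> d * norm v \<le> (tang x + tang y) \<bullet> v"
    using h.f_lower by blast
  have "norm v \<le> (\<bar>t\<bar> + 1) / d" if "v \<in> wedge x y t" for v
  proof -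
    have v: "v \<in> closure C" "tang y \<bullet> v < 1" "tang x \<bullet> v < t * (tang y \<bullet> v)" "tang y \<bullet> v > 0"
      using that closure_subset tang_pos_C[OF assms(2)] by (auto simp: wedge_def)
    have "t * (tang y \<bullet> v) \<le> \<bar>t\<bar> * 1" using v by (intro mult_mono) auto
    then have "d * norm v \<le> \<bar>t\<bar> + 1" using d(2)[OF v(1)] v by (simp add: inner_add_left)
    then show ?thesis using d(1) by (simp add: field_simps)
  qed
  then show "bounded (wedge x y t)" unfolding bounded_iff by blast
  have "wedge x y t = C \<inter> {v. tang y \<bullet> v < 1} \<inter> {v. tang x \<bullet> v < t * (tang y \<bullet> v)}"
    by (auto simp: wedge_def)
  then show "open (wedge x y t)"
    by (simp only:) (intro open_Int open_C open_Collect_less continuous_intros)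
qed

lemma wedge_measurable:
  assumes "x \<in> bdry" "y \<in> bdry" "x \<noteq> y" shows "wedge x y t \<in> lmeasurable"
  using wedge_bounded[OF assms] by (intro lmeasurable_open) auto

text \<open>The matrix \<open>(1 / l) *\<^sub>R g\<close> preserves \<open>tang y\<close>, multiplies
  \<open>tang x\<close> by \<open>u / l\<close>, and its determinant has absolute value \<open>1
  / l ^ CARD('m)\<close>.\<close>

lemma wedge_scaling:
  assumes g: "autC g" and x: "x \<in> bdry" "g *v x = l *\<^sub>R x" and y: "y \<in> bdry" "g *v y = u *\<^sub>R y" "x \<noteq> y"
  shows "measure lebesgue (wedge x y (t * (u / l))) = measure lebesgue (wedge x y t) / l ^ CARD('m)"
proof -
  have l: "l > 0" and u: "u > 0" using eigenvalue_pos g x y by blast+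
  have tx: "tang x \<bullet> (g *v v) = u * (tang x \<bullet> v)" for v by (rule tang_eigen[OF g x y])
  have ty: "tang y \<bullet> (g *v v) = l * (tang y \<bullet> v)" for v using tang_eigen[OF g y(1,2) x] y by simp
  have "(*v) ((1 / l) *\<^sub>R g) ` wedge x y t = wedge x y (t * (u / l))"
  proof (intro equalityI subsetI)
    fix w assume "w \<in> (*v) ((1 / l) *\<^sub>R g) ` wedge x y t"
    then obtain v where v: "v \<in> wedge x y t" "w = (1 / l) *\<^sub>R (g *v v)" by (auto simp: scaleR_matrix_vector)
    have "w \<in> C" using v l cone_C autC_C[OF g] by (auto simp: wedge_def)
    moreover have "u * (tang x \<bullet> v) < u * (t * (tang y \<bullet> v))" using v u by (auto simp: wedge_def)
    ultimately show "w \<in> wedge x y (t * (u / l))" using v l u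
      by (auto simp: wedge_def tx ty field_simps)
  next
    fix w assume w: "w \<in> wedge x y (t * (u / l))"
    define v where "v = l *\<^sub>R (ginv g *v w)"
    have gv: "g *v v = l *\<^sub>R w" by (simp add: v_def matrix_vector_mult_scaleR inv_apply g)
    then have wv: "w = ((1 / l) *\<^sub>R g) *v v" using l by (simp add: scaleR_matrix_vector)
    have "l *\<^sub>R w \<in> C" using w l cone_C by (auto simp: wedge_def)
    then have "v \<in> C" using gv autC_C[OF g] by metis
    moreover have "l * (tang y \<bullet> v) = l * (tang y \<bullet> w)" using ty[of v] gv by auto
    then have "tang y \<bullet> v = tang y \<bullet> w" using l by (metis mult_left_cancel less_irrefl)
    moreover have "u * (tang x \<bullet> v) = l * (tang x \<bullet> w)" using tx[of v] gv by simp
    moreover have "l * (tang x \<bullet> w) < l * (t * (u / l) * (tang y \<bullet> w))"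
      using w l by (intro mult_strict_left_mono) (simp_all only: wedge_def mem_Collect_eq)
    then have "l * (tang x \<bullet> w) < u * (t * (tang y \<bullet> w))" using l by (simp add: mult_ac)
    ultimately have "v \<in> C" "tang y \<bullet> v = tang y \<bullet> w" "u * (tang x \<bullet> v) < u * (t * (tang y \<bullet> w))"
      by auto
    then have "v \<in> wedge x y t" using w u by (auto simp: wedge_def)
    then show "w \<in> (*v) ((1 / l) *\<^sub>R g) ` wedge x y t" using wv by blast
  qed
  moreover have "measure lebesgue ((*v) ((1 / l) *\<^sub>R g) ` wedge x y t)
      = \<bar>det ((1 / l) *\<^sub>R g)\<bar> * measure lebesgue (wedge x y t)"
    using wedge_bounded[OF x(1) y(1,3), of t] l g
    by (intro measure_matrix_image) (auto simp: det_scaleR_matrix autC_def)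
  ultimately show ?thesis
    using l g by (simp add: det_scaleR_matrix abs_mult autC_def power_divide)
qed

text \<open>By \<open>cap\<close>, the wedge contains the image of a fixed ball under the linear map that
  fixes \<open>x\<close> and contracts the direction of \<open>base\<close> by \<open>t =
  \<rho>\<^sup>1\<^sup>+\<^sup>\<epsilon>\<close> and the remaining ones by
  \<open>\<rho>\<close>.\<close>

lemma wedge_lower_bound:
  assumes x: "x \<in> bdry" and y: "y \<in> bdry" "x \<noteq> y" and eps: "0 < \<epsilon>" "\<epsilon> < 1"
  shows "\<exists>c>0. \<forall>\<rho> t. 0 < \<rho> \<longrightarrow> \<rho> \<le> 1 \<longrightarrow> t = \<rho> powr (1 + \<epsilon>) \<longrightarrow>
     c * (\<rho> ^ CARD('m) * t / \<rho>\<^sup>2) \<le> measure lebesgue (wedge x y t)"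
proof -
  define Y where "Y = tang y \<bullet> x"
  have Y: "Y > 0" using tang_pos y x by (auto simp: Y_def)
  \<comment> \<open>The functional \<open>k\<close> is 1 at \<open>x\<close> and 0 at \<open>base\<close>, so
    \<open>k\<close>, \<open>tang x\<close> and \<open>w\<close> are the components of a vector
    along \<open>x\<close>, along \<open>base\<close> and in the common kernel of \<open>tang
    x\<close> and \<open>tang y\<close>.\<close>
  define k where "k = (1 / Y) *\<^sub>R (tang y - tang x)"
  have kx: "k \<bullet> x = 1" using Y by (simp add: k_def inner_diff_left tang_self x flip: Y_def)
  have kb: "k \<bullet> base = 0" by (simp add: k_def inner_diff_left tang_base x y)
  have tx: "tang x \<bullet> x = 0" "tang x \<bullet> base = 1" using tang_self tang_base x by auto
  define w where "w v = v - (k \<bullet> v) *\<^sub>R x - (tang x \<bullet> v) *\<^sub>R base" for v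
  have Yk: "Y * (k \<bullet> v) = tang y \<bullet> v - tang x \<bullet> v" for v using Y by (simp add: k_def inner_diff_left)
  have wx: "tang x \<bullet> w v = 0" for v by (simp add: w_def inner_diff_right tx)
  have wy: "tang y \<bullet> w v = 0" for v
    using Yk[of v] by (simp add: w_def inner_diff_right tang_base y mult.commute flip: Y_def)
  obtain K r where K: "K > 0" "r > 0" and
    cap: "\<And>d s. norm d < r \<Longrightarrow> s > K * norm d powr (1 + \<epsilon>) - tang x \<bullet> d \<Longrightarrow> x + d + s *\<^sub>R base \<in> C"
    using cap[OF x tang[OF x] eps] by metis
  define e where "e = min (r / 2) (min 1 (Y / (10 * K)))"
  have e: "e > 0" "e < r" "e \<le> 1" "e \<le> Y / (10 * K)" using K Y by (auto simp: e_def)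
  have "K * e powr (1 + \<epsilon>) \<le> K * e powr 1"
    using e eps K by (intro mult_left_mono powr_mono') auto
  also have "\<dots> \<le> K * (Y / (10 * K))" using e K by (intro mult_left_mono) auto
  also have "\<dots> < Y / 5" using K Y by simp
  finally have Ke: "K * e powr (1 + \<epsilon>) < Y / 5" .
  \<comment> \<open>For vectors of \<open>Q\<close> both inequalities defining the wedge hold with room to
    spare, and the third component is small compared with the first, so that \<open>cap\<close>
    applies after division by \<open>k \<bullet> v\<close>.\<close>
  define Q where "Q = {v. 3/8 < Y * (k \<bullet> v)} \<inter> {v. Y * (k \<bullet> v) < 5/8} \<inter>
      {v. 1/8 < tang x \<bullet> v} \<inter> {v. tang x \<bullet> v < 3/8} \<inter> {v. norm (w v) < e * (k \<bullet> v)}"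
  have oQ: "open Q"
    unfolding Q_def w_def by (intro open_Int open_Collect_less continuous_intros)
  define q where "q = (1 / (2 * Y)) *\<^sub>R x + (1/4) *\<^sub>R base"
  have kq: "k \<bullet> q = 1 / (2 * Y)" and tq: "tang x \<bullet> q = 1/4"
    by (simp_all add: q_def inner_add_right kx kb tx)
  have "w q = 0" unfolding w_def kq tq by (simp add: q_def)
  then have "q \<in> Q" using Y e by (simp add: Q_def kq tq)
  then obtain d where d: "d > 0" "ball q d \<subseteq> Q" using oQ openE by blast
  define c where "c = measure lebesgue (ball q d)"
  have c: "c > 0" unfolding c_def using content_ball_pos[OF d(1), of q]
    by (simp add: measure_completion)
  have "c * (\<rho> ^ CARD('m) * t / \<rho>\<^sup>2) \<le> measure lebesgue (wedge x y t)"
    if \<rho>: "0 < \<rho>" "\<rho> \<le> 1" and t: "t = \<rho> powr (1 + \<epsilon>)" for \<rho> t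
  proof -
    have t0: "t > 0" "t \<le> 1" using \<rho> eps by (auto simp: t powr_le1)
    define S where "S = \<rho> *\<^sub>R ((mat 1 + outer ((1 / \<rho> - 1) *\<^sub>R x) k) **
        (mat 1 + outer ((t / \<rho> - 1) *\<^sub>R base) (tang x)))"
    have detS: "det S = \<rho> ^ CARD('m) * t / \<rho>\<^sup>2"
      using \<rho> by (simp add: S_def det_scaleR_matrix det_mul det_rank_one_update kx tx
          power2_eq_square divide_simps)
    have Sv: "S *v v = (k \<bullet> v) *\<^sub>R x + \<rho> *\<^sub>R w v + (t * (tang x \<bullet> v)) *\<^sub>R base" for v
      using \<rho> by (simp add: S_def scaleR_matrix_vector matrix_vector_mul_assoc[symmetric]
          matrix_vector_mult_add_rdistrib outer_scaleR_left inner_add_right kb w_def algebra_simps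
          del: matrix_vector_mul_assoc)
    have "(*v) S ` ball q d \<subseteq> wedge x y t"
    proof
      fix u assume "u \<in> (*v) S ` ball q d"
      then obtain v where v: "v \<in> Q" "u = S *v v" using d by blast
      define a where "a = k \<bullet> v"
      define b where "b = tang x \<bullet> v"
      have vQ: "3/8 < Y * a" "Y * a < 5/8" "1/8 < b" "b < 3/8" "norm (w v) < e * a"
        using v by (auto simp: Q_def a_def b_def)
      have a: "a > 0" using vQ(1) Y by (metis less_trans zero_less_divide_iff zero_less_mult_pos zero_less_numeral)
      have u: "u = a *\<^sub>R x + \<rho> *\<^sub>R w v + (t * b) *\<^sub>R base" using v Sv by (simp add: a_def b_def)
      define D where "D = (\<rho> / a) *\<^sub>R w v"
      have nD: "norm D \<le> \<rho> * e"
        using vQ(5) a \<rho> by (simp add: D_def field_simps)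
      have "\<rho> * e \<le> e" using \<rho> e by simp
      then have "norm D < r" using nD e by linarith
      moreover have "t * b / a > K * norm D powr (1 + \<epsilon>) - tang x \<bullet> D"
      proof -
        have "K * norm D powr (1 + \<epsilon>) \<le> K * (\<rho> * e) powr (1 + \<epsilon>)"
          using nD K eps by (intro mult_left_mono powr_mono2) auto
        also have "\<dots> = t * (K * e powr (1 + \<epsilon>))" using \<rho> e by (simp add: t powr_mult)
        also have "\<dots> < t * (Y / 5)" using Ke t0 by simp
        also have "\<dots> \<le> t * (b / a)"
        proof -
          have "Y / 5 * a \<le> b" using vQ by simp
          then have "Y / 5 \<le> b / a" using a by (simp add: pos_le_divide_eq)
          then show ?thesis using t0 by (intro mult_left_mono) auto
        qed
        finally show ?thesis by (simp add: D_def wx)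
      qed
      ultimately have "x + D + (t * b / a) *\<^sub>R base \<in> C" by (rule cap)
      from cone_C[OF this a] have "u \<in> C" using a by (simp add: u D_def scaleR_add_right)
      moreover have tyu: "tang y \<bullet> u = Y * a + t * b"
        by (simp add: u inner_add_right wy tang_base y Y_def mult.commute)
      moreover have "tang x \<bullet> u = t * b" by (simp add: u inner_add_right wx tx)
      moreover have "t * b \<le> 1 * b" using t0 vQ by (intro mult_right_mono) auto
      moreover have "0 < t * b" using t0 vQ by simp
      moreover have "t * b < t * (Y * a + t * b)"
        using t0 vQ \<open>0 < t * b\<close> by (intro mult_strict_left_mono) linarith+
      moreover have "Y * a + t * b < 1" using vQ \<open>t * b \<le> 1 * b\<close> by linarith
      ultimately show "u \<in> wedge x y t" by (simp add: wedge_def)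
    qed
    then have "measure lebesgue ((*v) S ` ball q d) \<le> measure lebesgue (wedge x y t)"
      by (intro measure_mono_fmeasurable wedge_measurable x y)
         (auto intro!: fmeasurableD measurable_convex convex_linear_image bounded_linear_image)
    moreover have "measure lebesgue ((*v) S ` ball q d) = \<bar>det S\<bar> * c"
      unfolding c_def using \<rho> t0 by (intro measure_matrix_image) (auto simp: detS)
    moreover have "\<bar>det S\<bar> = \<rho> ^ CARD('m) * t / \<rho>\<^sup>2" using \<rho> t0 by (simp add: detS)
    ultimately show ?thesis by (simp add: mult.commute)
  qed
  then show ?thesis using c by (intro exI[of _ c]) auto
qed

text \<open>The powers of \<open>g\<close> shrink the wedge from height 1 to height \<open>(u /
  l)\<^sup>k\<close> and divide its volume by \<open>l\<^sup>m\<^sup>k\<close>, where \<open>m =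
  CARD('m)\<close>. The lower bound for the volume thus gives \<open>m * ln l \<le> (1 + (m - 2)
  / (1 + \<epsilon>)) * ln (l / u)\<close>. As \<open>\<epsilon>\<close> tends to 1, the factor
  on the right tends to \<open>m / 2\<close>, which is the claim. This is the only step that
  uses exponents arbitrarily close to 1.\<close>

lemma eigenvalue_product_le:
  assumes g: "autC g" and x: "x \<in> bdry" "g *v x = l *\<^sub>R x" and y: "y \<in> bdry" "g *v y = u *\<^sub>R y" "x \<noteq> y"
    and ul: "u < l"
  shows "l * u \<le> 1"
proof -
  let ?m = "real CARD('m)"
  have l: "l > 0" and u: "u > 0" using eigenvalue_pos g x y by blast+
  define a where "a = u / l"
  have a: "a > 0" "a < 1" using l u ul by (auto simp: a_def)
  have iter: "measure lebesgue (wedge x y (a ^ k)) = measure lebesgue (wedge x y 1) / (l ^ CARD('m)) ^ k" for k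
  proof (induction k)
    case (Suc k)
    then show ?case using wedge_scaling[OF g x y, of "a ^ k"] by (simp add: a_def mult.commute)
  qed simp
  have bound: "?m * ln l \<le> - ln a * (1 + (?m - 2) / (1 + \<epsilon>))" if eps: "0 < \<epsilon>" "\<epsilon> < 1" for \<epsilon>
  proof (rule ccontr)
    assume n: "\<not> ?thesis"
    define V where "V = measure lebesgue (wedge x y 1)"
    define E where "E = 1 + (?m - 2) / (1 + \<epsilon>)"
    obtain c where c: "c > 0" and lb: "\<And>\<rho> t. 0 < \<rho> \<Longrightarrow> \<rho> \<le> 1 \<Longrightarrow> t = \<rho> powr (1 + \<epsilon>) \<Longrightarrow>
        c * (\<rho> ^ CARD('m) * t / \<rho>\<^sup>2) \<le> measure lebesgue (wedge x y t)"
      using wedge_lower_bound[OF x(1) y(1,3) eps] by metis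
    have main: "c \<le> V * exp (- (?m * ln l + ln a * E)) ^ k" for k
    proof -
      define \<rho> where "\<rho> = exp (real k * ln a / (1 + \<epsilon>))"
      have \<rho>: "0 < \<rho>" "\<rho> \<le> 1" using a eps by (auto simp: \<rho>_def divide_le_0_iff mult_nonneg_nonpos)
      have ak: "a ^ k = exp (real k * ln a)" using a by (simp add: exp_of_nat_mult)
      have "a ^ k = \<rho> powr (1 + \<epsilon>)" using eps by (simp add: \<rho>_def powr_def ak)
      from lb[OF \<rho> this] have "c * (\<rho> ^ CARD('m) * a ^ k / \<rho>\<^sup>2) \<le> V / (l ^ CARD('m)) ^ k"
        by (simp add: iter V_def)
      moreover have "\<rho> ^ CARD('m) * a ^ k / \<rho>\<^sup>2 = exp (real k * (ln a * E))"
      proof -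
        define z where "z = real k * ln a / (1 + \<epsilon>)"
        have "\<rho> = exp z" by (simp add: \<rho>_def z_def)
        then have "\<rho> ^ CARD('m) = exp (?m * z)" "\<rho>\<^sup>2 = exp (2 * z)"
          by (simp_all only: exp_of_nat_mult power2_eq_square mult_2 exp_add)
        moreover have "a ^ k = exp (z * (1 + \<epsilon>))" using eps by (simp add: z_def ak)
        moreover have "?m * z + z * (1 + \<epsilon>) - 2 * z = z * (1 + \<epsilon>) * E"
          using eps by (simp add: E_def field_simps)
        moreover have "z * (1 + \<epsilon>) = real k * ln a" using eps by (simp add: z_def)
        ultimately show ?thesis by (simp only: mult.assoc flip: exp_add exp_diff)
      qed
      moreover have "(l ^ CARD('m)) ^ k = exp (real k * (?m * ln l))"
        using l by (simp add: exp_of_nat_mult)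
      ultimately have "c * exp (real k * (ln a * E)) * exp (real k * (?m * ln l)) \<le> V"
        by (simp add: pos_le_divide_eq)
      then have "c * exp (real k * (?m * ln l + ln a * E)) \<le> V"
        by (simp add: mult.assoc distrib_left add.commute flip: exp_add)
      then have "c \<le> V / exp (real k * (?m * ln l + ln a * E))" by (simp add: pos_le_divide_eq)
      also have "\<dots> = V * exp (- (?m * ln l + ln a * E)) ^ k"
        by (simp only: exp_minus divide_inverse exp_of_nat_mult power_inverse)
      finally show ?thesis .
    qed
    have "exp (- (?m * ln l + ln a * E)) < 1" using n by (simp add: E_def)
    then have "(\<lambda>k. V * exp (- (?m * ln l + ln a * E)) ^ k) \<longlonglongrightarrow> V * 0"
      by (intro tendsto_mult tendsto_const LIMSEQ_power_zero) simp
    then have "c \<le> V * 0" using main by (meson LIMSEQ_le_const)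
    then show False using c by simp
  qed
  have "?m * ln l \<le> - ln a * (1 + (?m - 2) / (1 + 1))"
  proof (rule tendsto_lowerbound)
    show "((\<lambda>\<epsilon>. - ln a * (1 + (?m - 2) / (1 + \<epsilon>))) \<longlongrightarrow> - ln a * (1 + (?m - 2) / (1 + 1))) (at_left (1::real))"
      by (intro tendsto_intros) auto
    show "eventually (\<lambda>\<epsilon>. ?m * ln l \<le> - ln a * (1 + (?m - 2) / (1 + \<epsilon>))) (at_left (1::real))"
      unfolding eventually_at_left_field using bound by (intro exI[of _ 0]) auto
  qed simp
  then have "?m * ln l \<le> ?m * (- ln a / 2)" by (simp add: field_simps)
  then have "ln l \<le> - ln a / 2" by (rule mult_left_le_imp_le) simp
  then have "ln (l * u) \<le> 0" using l u by (simp add: a_def ln_div ln_mult)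
  then show ?thesis using l u by (simp add: ln_le_zero_iff)
qed

text \<open>For \<open>l \<noteq> u\<close> the estimate above is applied to \<open>g\<close> and, with
  the two fixed points exchanged, to its inverse. For \<open>l = u\<close> the wedge is mapped
  to itself while its volume is divided by \<open>l ^ CARD('m)\<close>.\<close>

lemma eigenvalue_product:
  assumes g: "autC g" and x: "x \<in> bdry" "g *v x = l *\<^sub>R x" and y: "y \<in> bdry" "g *v y = u *\<^sub>R y" "x \<noteq> y"
  shows "l * u = 1"
proof -
  have main: "l * u = 1"
    if g: "autC g" and x: "x \<in> bdry" "g *v x = l *\<^sub>R x" and y: "y \<in> bdry" "g *v y = u *\<^sub>R y" "x \<noteq> y"
      and ul: "u < l" for g x y l u
  proof -
    have l: "l > 0" and u: "u > 0" using eigenvalue_pos g x y by blast+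
    have gi: "ginv g *v z = (1 / r) *\<^sub>R z" if "g *v z = r *\<^sub>R z" "r > 0" for z r
      using ginv_eigen[OF g that(1)] that(2) by simp
    have "l * u \<le> 1" by (rule eigenvalue_product_le[OF g x y ul])
    moreover have "(1 / u) * (1 / l) \<le> 1"
      using l u ul by (intro eigenvalue_product_le[OF autC_inv[OF g] y(1) gi[OF y(2) u] x(1) gi[OF x(2) l]])
         (use y in \<open>auto simp: field_simps\<close>)
    then have "1 \<le> l * u" using l u by (simp add: field_simps)
    ultimately show ?thesis by simp
  qed
  have l: "l > 0" and u: "u > 0" using eigenvalue_pos g x y by blast+
  consider "u < l" | "l < u" | "l = u" by linarith
  then show ?thesis
  proof cases
    case 1 then show ?thesis using main[OF g x y] by simp
  next
    case 2 then show ?thesis using main[OF g y(1,2) x] y by (simp add: mult.commute)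
  next
    case 3
    obtain c where c: "c > 0" "\<And>\<rho> t. 0 < \<rho> \<Longrightarrow> \<rho> \<le> 1 \<Longrightarrow> t = \<rho> powr (1 + 1/2) \<Longrightarrow>
        c * (\<rho> ^ CARD('m) * t / \<rho>\<^sup>2) \<le> measure lebesgue (wedge x y t)"
      using wedge_lower_bound[OF x(1) y(1,3), of "1/2"] by auto
    have "c * (1 ^ CARD('m) * 1 / 1\<^sup>2) \<le> measure lebesgue (wedge x y 1)" by (rule c(2)) auto
    then have V: "measure lebesgue (wedge x y 1) > 0" using c by simp
    have "measure lebesgue (wedge x y 1) = measure lebesgue (wedge x y 1) / l ^ CARD('m)"
      using wedge_scaling[OF g x y, of 1] 3 l by simp
    then have "l ^ CARD('m) = 1" using V l by (simp add: field_simps)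
    then have "l = 1" using l by (metis power_eq_1_iff abs_of_pos zero_less_card_finite less_irrefl real_norm_def)
    then show ?thesis using 3 by simp
  qed
qed

end

section \<open>Fixed points of automorphisms close to rank one\<close>

lemma eventually_gt_one:
  fixes s l :: "nat \<Rightarrow> real"
  assumes "(\<lambda>k. s k * l k) \<longlonglongrightarrow> L" "L > 0" "s \<longlonglongrightarrow> 0" "\<And>k. s k > 0"
  shows "eventually (\<lambda>k. l k > 1) sequentially"
proof -
  have "eventually (\<lambda>k. s k * l k > L / 2) sequentially"
    using assms by (intro order_tendstoD(1)[OF assms(1)]) simp
  moreover have "eventually (\<lambda>k. s k < L / 2) sequentially"
    using assms by (intro order_tendstoD(2)[OF assms(3)]) simp
  ultimately show ?thesis
  proof eventually_elim
    case (elim k)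
    then have "s k * 1 < s k * l k" by simp
    then show ?case using assms(4)[of k] by (simp only: mult_less_cancel_left_pos)
  qed
qed

context smooth_cone
begin

lemma act_slice: assumes "autC g" "v \<in> slice" shows "act g v \<in> slice"
proof -
  have "v \<in> closure C" "v \<noteq> 0" using assms(2) by (auto simp: slice_def)
  then show ?thesis unfolding act_def using assms(1) by (intro normalize_slice autC_closure autC_nz) auto
qed

lemma continuous_act: assumes "autC g" shows "continuous_on slice (act g)"
proof -
  have "f \<bullet> (g *v v) \<noteq> 0" if "v \<in> slice" for v
    using that autC_f_pos[OF assms, of v] by (fastforce simp: slice_def)
  then show ?thesis
    unfolding act_def
    by (intro continuous_on_scaleR continuous_on_divide continuous_on_const continuous_on_inner
        matrix_vector_mult_linear_continuous_on) auto
qed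

lemma converges_subseq:
  assumes "converges g s t c d x y" "strict_mono r"
  shows "converges (\<lambda>k. g (r k)) (\<lambda>k. s (r k)) (\<lambda>k. t (r k)) c d x y"
proof -
  note cD = convergesD[OF assms(1)]
  have 1: "X \<longlonglongrightarrow> L \<Longrightarrow> (\<lambda>k. X (r k)) \<longlonglongrightarrow> L" for X and L :: real
    using LIMSEQ_subseq_LIMSEQ[OF _ assms(2)] by (simp add: o_def)
  have 2: "X \<longlonglongrightarrow> L \<Longrightarrow> (\<lambda>k. X (r k)) \<longlonglongrightarrow> L" for X and L :: "real^'m^'m"
    using LIMSEQ_subseq_LIMSEQ[OF _ assms(2)] by (simp add: o_def)
  show ?thesis
    unfolding converges_def using cD(1-3,6-9) 1[OF cD(4)] 1[OF cD(5)] 2[OF cD(10)] 2[OF cD(11)] by simp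
qed

lemma act_fixed_iff: assumes "autC g" "v \<in> slice"
  shows "act g v = v \<longleftrightarrow> g *v v = (f \<bullet> (g *v v)) *\<^sub>R v"
proof -
  have k: "f \<bullet> (g *v v) > 0" using assms autC_f_pos[OF assms(1), of v] by (fastforce simp: slice_def)
  have "act g v = v \<longleftrightarrow> (f \<bullet> (g *v v)) *\<^sub>R act g v = (f \<bullet> (g *v v)) *\<^sub>R v" using k by simp
  also have "(f \<bullet> (g *v v)) *\<^sub>R act g v = g *v v" using k by (simp add: act_def)
  finally show ?thesis .
qed

text \<open>Away from \<open>y\<close> the maps \<open>act (g k)\<close> converge uniformly to the
  constant \<open>x\<close>, so they eventually map a small convex neighbourhood of
  \<open>x\<close> in the slice to itself, and Brouwer's theorem applies.\<close>

lemma exists_near_fixed_point: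
  assumes c: "converges g s t c d x y" and xy: "x \<noteq> y" and e: "e > 0"
  shows "eventually (\<lambda>k. \<exists>v\<in>slice. norm (v - x) \<le> e \<and> act (g k) v = v) sequentially"
proof -
  note cD = convergesD[OF c]
  define e' where "e' = min e (norm (x - y) / 2)"
  have e': "e' > 0" "e' \<le> e" "e' < norm (x - y)" using e xy by (auto simp: e'_def min_def)
  define S where "S = slice \<inter> cball x e'"
  have S: "compact S" "convex S" "x \<in> S"
    using compact_slice convex_slice bdryD(5)[OF cD(8)] e' by (auto simp: S_def intro!: compact_Int convex_Int)
  have yS: "tang y \<bullet> v > 0" if "v \<in> S" for v
  proof -
    have "v \<noteq> y" using that e'(3) by (auto simp: S_def dist_norm)
    then show ?thesis using that tang_pos_slice[OF cD(9), of v] by (auto simp: S_def)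
  qed
  have "eventually (\<lambda>k. \<forall>v\<in>S. act (g k) v \<in> S) sequentially"
  proof (rule ccontr)
    assume "\<not> ?thesis"
    then have "\<exists>r :: nat \<Rightarrow> nat. strict_mono r \<and> (\<forall>k. \<not> (\<forall>v\<in>S. act (g (r k)) v \<in> S))"
      by (rule not_eventually_sequentiallyD)
    then obtain r :: "nat \<Rightarrow> nat" where r: "strict_mono r" "\<And>k. \<not> (\<forall>v\<in>S. act (g (r k)) v \<in> S)" by blast
    then obtain v where v: "\<And>k. v k \<in> S" "\<And>k. act (g (r k)) (v k) \<notin> S" by metis
    have "\<exists>l q. l \<in> S \<and> strict_mono q \<and> (\<lambda>k. v (q k)) \<longlonglongrightarrow> l"
      by (rule compact_subseq[OF S(1) v(1)])
    then obtain l and q :: "nat \<Rightarrow> nat" where q: "l \<in> S" "strict_mono q" "(\<lambda>k. v (q k)) \<longlonglongrightarrow> l" by blast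
    have rq: "strict_mono (\<lambda>k. r (q k))" using r q by (simp add: strict_mono_def)
    have "(\<lambda>k. act (g (r (q k))) (v (q k))) \<longlonglongrightarrow> x"
    proof (rule converges_apply[OF converges_subseq[OF c rq] q(3)])
      fix k show "v (q k) \<in> closure C" "v (q k) \<noteq> 0" using v(1)[of "q k"] by (auto simp: S_def slice_def)
    qed (rule yS[OF q(1)])
    then have "eventually (\<lambda>k. act (g (r (q k))) (v (q k)) \<in> ball x e') sequentially"
      using e' by (intro topological_tendstoD) auto
    then have "\<exists>k. act (g (r (q k))) (v (q k)) \<in> ball x e'" by (rule eventually_happens'[OF sequentially_bot])
    then obtain k where k: "act (g (r (q k))) (v (q k)) \<in> ball x e'" by blast
    moreover have "act (g (r (q k))) (v (q k)) \<in> slice"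
      using v(1)[of "q k"] act_slice cD by (auto simp: S_def)
    ultimately show False using v(2)[of "q k"] by (auto simp: S_def)
  qed
  then show ?thesis
  proof eventually_elim
    case (elim k)
    have "continuous_on S (act (g k))"
      using continuous_act[OF cD(1)] by (rule continuous_on_subset) (auto simp: S_def)
    moreover have "act (g k) \<in> S \<rightarrow> S" using elim by blast
    ultimately obtain v where "v \<in> S" "act (g k) v = v"
      using brouwer[OF S(1,2), of "act (g k)"] S(3) by blast
    then show ?case using e' by (intro bexI[of _ v]) (auto simp: S_def dist_norm norm_minus_commute)
  qed
qed

text \<open>The fixed points are chosen nearest to \<open>x\<close>, so that they converge to
  \<open>x\<close>. The eigenvalue at a fixed point of height 1 is the height of its image.\<close>

lemma fixed_sequence:
  assumes c: "converges g s t c d x y" and xy: "x \<noteq> y"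
  shows "\<exists>v. v \<longlonglongrightarrow> x \<and> eventually (\<lambda>k. v k \<in> slice \<and> act (g k) (v k) = v k) sequentially \<and>
     (\<lambda>k. s k * (f \<bullet> (g k *v v k))) \<longlonglongrightarrow> c * (tang y \<bullet> x)"
proof -
  note cD = convergesD[OF c]
  define F where "F k = {v \<in> slice. act (g k) v = v}" for k
  have clF: "closed (F k)" for k
  proof -
    have "continuous_on slice (\<lambda>v. act (g k) v - v)"
      by (intro continuous_on_diff continuous_act cD continuous_on_id)
    then have "closed {v \<in> slice. act (g k) v - v = 0}"
      using compact_imp_closed[OF compact_slice] by (rule continuous_closed_preimage_constant)
    then show ?thesis by (simp add: F_def)
  qed
  have "\<exists>v. \<forall>k. F k \<noteq> {} \<longrightarrow> v k \<in> F k \<and> infdist x (F k) = dist x (v k)"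
    using infdist_attains_inf[OF clF] by (intro choice) metis
  then obtain v where v: "\<And>k. F k \<noteq> {} \<Longrightarrow> v k \<in> F k \<and> infdist x (F k) = dist x (v k)" by blast
  have near: "eventually (\<lambda>k. v k \<in> F k \<and> dist x (v k) \<le> e) sequentially" if "e > 0" for e
    using exists_near_fixed_point[OF c xy that]
  proof eventually_elim
    case (elim k)
    then obtain u where u: "u \<in> F k" "norm (u - x) \<le> e" by (auto simp: F_def)
    then have "infdist x (F k) \<le> e"
      using infdist_le[OF u(1), of x] by (simp add: dist_norm norm_minus_commute)
    moreover have "v k \<in> F k \<and> infdist x (F k) = dist x (v k)" using u(1) by (intro v) blast
    ultimately show ?case by simp
  qed
  have lim: "v \<longlonglongrightarrow> x"
  proof (rule tendstoI)
    fix e :: real assume "e > 0"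
    then show "eventually (\<lambda>k. dist (v k) x < e) sequentially"
      using near[of "e/2"] by (auto elim!: eventually_mono simp: dist_commute)
  qed
  have "(\<lambda>k. f \<bullet> ((s k *\<^sub>R g k) *v v k)) \<longlonglongrightarrow> f \<bullet> ((c *\<^sub>R outer x (tang y)) *v x)"
    by (intro tendsto_intros tendsto_matrix_vector cD lim)
  then have "(\<lambda>k. s k * (f \<bullet> (g k *v v k))) \<longlonglongrightarrow> c * (tang y \<bullet> x)"
    using bdryD(3)[OF cD(8)] by (simp add: scaleR_matrix_vector)
  moreover have "eventually (\<lambda>k. v k \<in> slice \<and> act (g k) (v k) = v k) sequentially"
    using near[of 1] by (auto elim!: eventually_mono simp: F_def)
  ultimately show ?thesis using lim by blast
qed

text \<open>If \<open>v\<close> were interior, the cone would contain \<open>v - a *\<^sub>R u\<close> for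
  some \<open>a > 0\<close>. Powers of the inverse, rescaled, turn this into \<open>v - (a * (l
  / m) ^ k) *\<^sub>R u\<close>, whose height is negative for large \<open>k\<close>.\<close>

lemma repelled_notin_C:
  assumes g: "autC g" and v: "g *v v = l *\<^sub>R v" and u: "u \<in> slice" "g *v u = m *\<^sub>R u" and ml: "0 < m" "m < l"
    and fv: "f \<bullet> v = 1"
  shows "v \<notin> C"
proof
  assume "v \<in> C"
  have l: "l > 0" using ml by simp
  have gi: "ginv g *v v = (1 / l) *\<^sub>R v" "ginv g *v u = (1 / m) *\<^sub>R u"
    using ginv_eigen[OF g v] ginv_eigen[OF g u(2)] l ml by simp_all
  obtain e where e: "e > 0" "ball v e \<subseteq> C" using open_C \<open>v \<in> C\<close> by (meson openE)
  have un: "norm u > 0" using u by (auto simp: slice_def)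
  define a where "a = e / (2 * norm u)"
  have a: "a > 0" using e un by (simp add: a_def)
  have "norm (a *\<^sub>R u) < e" using a un e by (simp add: a_def)
  then have "v - a *\<^sub>R u \<in> C" using e a by (auto simp: subset_iff dist_norm)
  then have "v - (a * (l / m) ^ k) *\<^sub>R u \<in> C" for k
  proof (induction k)
    case (Suc k)
    have "ginv g *v (v - (a * (l / m) ^ k) *\<^sub>R u) \<in> C" using Suc autC_C autC_inv g by blast
    from cone_C[OF this l] have "v - (l * (a * (l / m) ^ k) / m) *\<^sub>R u \<in> C"
      using l by (simp add: matrix_vector_mult_diff_distrib matrix_vector_mult_scaleR gi scaleR_diff_right)
    then show ?case by (simp add: mult_ac)
  qed simp
  from C_pos[OF this] have lt: "a * (l / m) ^ k < 1" for k
    using fv u(1) by (simp add: slice_def inner_diff_right)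
  have "1 < l / m" using ml by simp
  then obtain k where "1 / a < (l / m) ^ k" using real_arch_pow by blast
  then show False using lt[of k] a by (simp add: field_simps)
qed

text \<open>A late \<open>g k\<close> has a fixed point near \<open>x\<close> with eigenvalue \<open>l
  k\<close> and one near \<open>y\<close> with eigenvalue \<open>1 / m k\<close>. Both lie on
  the boundary, so \<open>l k = m k\<close> by \<open>eigenvalue_product\<close>, while \<open>s
  k * l k\<close> and \<open>t k * m k\<close> converge to the two terms of the quotient.\<close>

lemma ratio_limit:
  assumes c: "converges g s t c d x y" and xy: "x \<noteq> y"
  shows "(\<lambda>k. s k / t k) \<longlonglongrightarrow> (c * (tang y \<bullet> x)) / (d * (tang x \<bullet> y))"
proof -
  note cD = convergesD[OF c]
  obtain v where v: "v \<longlonglongrightarrow> x" "eventually (\<lambda>k. v k \<in> slice \<and> act (g k) (v k) = v k) sequentially"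
     "(\<lambda>k. s k * (f \<bullet> (g k *v v k))) \<longlonglongrightarrow> c * (tang y \<bullet> x)" using fixed_sequence[OF c xy] by blast
  obtain u where u: "u \<longlonglongrightarrow> y" "eventually (\<lambda>k. u k \<in> slice \<and> act (ginv (g k)) (u k) = u k) sequentially"
     "(\<lambda>k. t k * (f \<bullet> (ginv (g k) *v u k))) \<longlonglongrightarrow> d * (tang x \<bullet> y)"
    using fixed_sequence[OF converges_inv[OF c] xy[symmetric]] by blast
  define l where "l k = f \<bullet> (g k *v v k)" for k
  define m where "m k = f \<bullet> (ginv (g k) *v u k)" for k
  have L: "c * (tang y \<bullet> x) > 0" "d * (tang x \<bullet> y) > 0" using tang_pos cD xy by auto
  have "eventually (\<lambda>k. l k > 1) sequentially" by (rule eventually_gt_one[OF v(3)[folded l_def] L(1) cD(4,2)])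
  moreover have "eventually (\<lambda>k. m k > 1) sequentially" by (rule eventually_gt_one[OF u(3)[folded m_def] L(2) cD(5,3)])
  moreover note v(2) u(2)
  ultimately have eq: "eventually (\<lambda>k. s k / t k = (s k * l k) / (t k * m k)) sequentially"
  proof eventually_elim
    case (elim k)
    have g: "autC (g k)" by (rule cD)
    have gv: "g k *v v k = l k *\<^sub>R v k" using elim act_fixed_iff[OF g, of "v k"] unfolding l_def by blast
    have giu: "ginv (g k) *v u k = m k *\<^sub>R u k" using elim act_fixed_iff[OF autC_inv[OF g], of "u k"] unfolding m_def by blast
    have giv: "ginv (g k) *v v k = (1 / l k) *\<^sub>R v k" using ginv_eigen[OF g gv] elim by simp
    have gu: "g k *v u k = (1 / m k) *\<^sub>R u k"
      using ginv_eigen[OF autC_inv[OF g] giu] elim by (simp add: inv_inv[OF g])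
    have mk: "0 < 1 / m k" "1 / m k < 1" "0 < 1 / l k" "1 / l k < 1" using elim by auto
    have mk2: "1 / m k < l k" "1 / l k < m k" using mk elim by linarith+
    have usl: "u k \<in> slice" "v k \<in> slice" using elim by auto
    have fvu: "f \<bullet> v k = 1" "f \<bullet> u k = 1" using elim by (auto simp: slice_def)
    have "v k \<notin> C" by (rule repelled_notin_C[OF g gv usl(1) gu mk(1) mk2(1) fvu(1)])
    then have vb: "v k \<in> bdry" using elim by (auto simp: slice_def bdry_def)
    have "u k \<notin> C" by (rule repelled_notin_C[OF autC_inv[OF g] giu usl(2) giv mk(3) mk2(2) fvu(2)])
    then have ub: "u k \<in> bdry" using elim by (auto simp: slice_def bdry_def)
    have "v k \<noteq> u k"
    proof
      assume "v k = u k"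
      then have "l k *\<^sub>R v k = (1 / m k) *\<^sub>R v k" using gv gu by metis
      then have "l k = 1 / m k" using bdryD(4)[OF vb] by (simp only: scaleR_cancel_right simp_thms)
      then show False using mk elim by linarith
    qed
    then have "l k * (1 / m k) = 1" by (rule eigenvalue_product[OF g vb gv ub gu])
    then have "l k = m k" using elim by (simp add: field_simps)
    then show ?case using elim by simp
  qed
  have "(\<lambda>k. (s k * l k) / (t k * m k)) \<longlonglongrightarrow> (c * (tang y \<bullet> x)) / (d * (tang x \<bullet> y))"
    using L by (intro tendsto_divide v(3)[folded l_def] u(3)[folded m_def]) auto
  then show ?thesis using eq by (simp add: tendsto_cong)
qed

lemma converges_mult:
  assumes g: "converges g s t c d x y" and h: "converges h s' t' c' d' z w" and yz: "y \<noteq> z"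
  shows "converges (\<lambda>k. g k ** h k) (\<lambda>k. s k * s' k) (\<lambda>k. t k * t' k)
     (c * c' * (tang y \<bullet> z)) (d * d' * (tang z \<bullet> y)) x w"
proof -
  note gD = convergesD[OF g] note hD = convergesD[OF h]
  have "(\<lambda>k. (s k *\<^sub>R g k) ** (s' k *\<^sub>R h k)) \<longlonglongrightarrow> (c *\<^sub>R outer x (tang y)) ** (c' *\<^sub>R outer z (tang w))"
    by (intro tendsto_matrix_mult gD hD)
  then have 1: "(\<lambda>k. (s k * s' k) *\<^sub>R (g k ** h k)) \<longlonglongrightarrow> (c * c' * (tang y \<bullet> z)) *\<^sub>R outer x (tang w)"
    by (simp add: scaleR_matrix_mult matrix_mult_scaleR outer_mult_outer mult_ac)
  have "(\<lambda>k. (t' k *\<^sub>R ginv (h k)) ** (t k *\<^sub>R ginv (g k))) \<longlonglongrightarrow> (d' *\<^sub>R outer w (tang z)) ** (d *\<^sub>R outer y (tang x))"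
    by (intro tendsto_matrix_mult gD hD)
  then have 2: "(\<lambda>k. (t k * t' k) *\<^sub>R ginv (g k ** h k)) \<longlonglongrightarrow> (d * d' * (tang z \<bullet> y)) *\<^sub>R outer w (tang x)"
    by (simp add: scaleR_matrix_mult matrix_mult_scaleR outer_mult_outer mult_ac inv_mult gD hD)
  have st: "(\<lambda>k. s k * s' k) \<longlonglongrightarrow> 0" "(\<lambda>k. t k * t' k) \<longlonglongrightarrow> 0"
    using tendsto_mult[OF gD(4) hD(4)] tendsto_mult[OF gD(5) hD(5)] by auto
  show ?thesis unfolding converges_def
    using 1 2 st gD hD yz autC_mult tang_pos[of y z] tang_pos[of z y] by auto
qed

text \<open>The limit of the ratio of the scalings is known for \<open>g\<close>, for \<open>h\<close> and
  for the products \<open>g k ** h k\<close>, and the last one is the product of the first two.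
  The factors \<open>c\<close> and \<open>d\<close> cancel.\<close>

lemma four_cycle:
  assumes g: "converges g s t c d x y" and h: "converges h s' t' c' d' z w"
    and ne: "x \<noteq> y" "y \<noteq> z" "z \<noteq> w" "w \<noteq> x"
  shows "(tang y \<bullet> x) * (tang x \<bullet> w) * (tang w \<bullet> z) * (tang z \<bullet> y) =
         (tang x \<bullet> y) * (tang w \<bullet> x) * (tang z \<bullet> w) * (tang y \<bullet> z)"
proof -
  note gD = convergesD[OF g] note hD = convergesD[OF h]
  have "(\<lambda>k. (s k / t k) * (s' k / t' k)) \<longlonglongrightarrow>
     (c * (tang y \<bullet> x)) / (d * (tang x \<bullet> y)) * ((c' * (tang w \<bullet> z)) / (d' * (tang z \<bullet> w)))"
    by (intro tendsto_mult ratio_limit[OF g ne(1)] ratio_limit[OF h ne(3)])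
  moreover have "(\<lambda>k. (s k * s' k) / (t k * t' k)) \<longlonglongrightarrow>
     (c * c' * (tang y \<bullet> z) * (tang w \<bullet> x)) / (d * d' * (tang z \<bullet> y) * (tang x \<bullet> w))"
    using ratio_limit[OF converges_mult[OF g h ne(2)]] ne by simp
  ultimately have "(c * (tang y \<bullet> x)) / (d * (tang x \<bullet> y)) * ((c' * (tang w \<bullet> z)) / (d' * (tang z \<bullet> w))) =
      (c * c' * (tang y \<bullet> z) * (tang w \<bullet> x)) / (d * d' * (tang z \<bullet> y) * (tang x \<bullet> w))"
    by (simp add: LIMSEQ_unique)
  moreover have p: "c > 0" "d > 0" "c' > 0" "d' > 0" "tang x \<bullet> y > 0" "tang z \<bullet> w > 0" "tang z \<bullet> y > 0" "tang x \<bullet> w > 0"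
    using gD hD ne tang_pos by auto
  ultimately have "(c * c' * d * d') * ((tang y \<bullet> x) * (tang x \<bullet> w) * (tang w \<bullet> z) * (tang z \<bullet> y)) =
         (c * c' * d * d') * ((tang x \<bullet> y) * (tang w \<bullet> x) * (tang z \<bullet> w) * (tang y \<bullet> z))"
    by (simp add: field_simps)
  then show ?thesis using p by simp
qed

lemma chord:
  assumes "z \<in> C" "f \<bullet> z = 1" "w \<noteq> 0" "f \<bullet> w = 0" shows "\<exists>r>0. z + r *\<^sub>R w \<in> bdry"
proof -
  obtain r where r: "w + r *\<^sub>R z \<in> closure C" "w + r *\<^sub>R z \<notin> C" using exit_exists[OF assms(1), of w] by blast
  have fr: "f \<bullet> (w + r *\<^sub>R z) = r" using assms by (simp add: inner_add_right)
  have nz: "w + r *\<^sub>R z \<noteq> 0"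
  proof
    assume 0: "w + r *\<^sub>R z = 0"
    then have "r = 0" using fr by simp
    then show False using 0 assms(3) by simp
  qed
  then have r0: "r > 0" using pos[OF r(1)] fr by simp
  have "(1 / r) *\<^sub>R (w + r *\<^sub>R z) \<in> bdry" using normalize_bdry[OF r nz] by (simp only: fr)
  moreover have "(1 / r) *\<^sub>R (w + r *\<^sub>R z) = z + (1 / r) *\<^sub>R w" using r0 by (simp add: scaleR_add_right)
  ultimately show ?thesis using r0 by (intro exI[of _ "1 / r"]) auto
qed

end

section \<open>Recurrent groups and their limit points\<close>

text \<open>The assumption \<open>finite_bounded\<close> is discreteness. The assumption
  \<open>recurrent\<close> says that no neighbourhood of a boundary point embeds into the
  quotient by the group.\<close>

locale recurrent_group = smooth_cone C f for C :: "(real^'m::finite) set" and f +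
  fixes \<Gamma> :: "(real^'m^'m) set"
  assumes aut: "g \<in> \<Gamma> \<Longrightarrow> autC g"
    and mult_closed: "g \<in> \<Gamma> \<Longrightarrow> h \<in> \<Gamma> \<Longrightarrow> g ** h \<in> \<Gamma>"
    and inv_closed: "g \<in> \<Gamma> \<Longrightarrow> ginv g \<in> \<Gamma>"
    and finite_bounded: "finite {g \<in> \<Gamma>. norm g \<le> R}"
    and recurrent: "open U \<Longrightarrow> p \<in> bdry \<Longrightarrow> p \<in> U \<Longrightarrow>
      \<exists>g\<in>\<Gamma>. \<exists>v\<in>C. f \<bullet> v = 1 \<and> v \<in> U \<and> act g v \<in> U \<and> act g v \<noteq> v"
    and three_points: "\<exists>x\<in>bdry. \<exists>y\<in>bdry. \<exists>z\<in>bdry. x \<noteq> y \<and> y \<noteq> z \<and> z \<noteq> x"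
begin

definition limit_pair :: "real^'m \<Rightarrow> real^'m \<Rightarrow> bool" where
  "limit_pair x y \<longleftrightarrow> (\<exists>g s t c d. (\<forall>k. g k \<in> \<Gamma>) \<and> converges g s t c d x y)"

lemma limit_pairI: "(\<And>k. g k \<in> \<Gamma>) \<Longrightarrow> converges g s t c d x y \<Longrightarrow> limit_pair x y"
  unfolding limit_pair_def by blast

lemma limit_pair_sym: "limit_pair x y \<Longrightarrow> limit_pair y x"
  unfolding limit_pair_def using converges_inv inv_closed by metis

lemma limit_pairE:
  assumes "limit_pair x y"
  obtains g s t c d where "\<And>k. g k \<in> \<Gamma>" "converges g s t c d x y"
  using assms unfolding limit_pair_def by blast

lemma limit_pair_bdry: assumes "limit_pair x y" shows "x \<in> bdry" "y \<in> bdry"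
  using limit_pairE[OF assms] convergesD(8,9) by metis+

definition base_orbit :: "(real^'m) set" where
  "base_orbit = (\<lambda>g. act g base) ` \<Gamma>"

lemma limit_pair_closure: assumes "limit_pair x y" shows "x \<in> closure base_orbit"
proof -
  obtain g s t c d where g: "\<And>k. g k \<in> \<Gamma>" "converges g s t c d x y"
    using limit_pairE[OF assms] by blast
  have "(\<lambda>k. act (g k) base) \<longlonglongrightarrow> x"
    using base_C closure_subset zero_notin_C tang_pos_C convergesD[OF g(2)]
    by (intro converges_apply[OF g(2) tendsto_const]) auto
  moreover have "act (g k) base \<in> base_orbit" for k using g(1) by (auto simp: base_orbit_def)
  ultimately show ?thesis unfolding closure_sequential by (intro exI[of _ "\<lambda>k. act (g k) base"]) auto
qed

lemma limit_pair_of_unbounded: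
  assumes g: "\<And>k. g k \<in> \<Gamma>" and top: "filterlim (\<lambda>k. norm (g k)) at_top sequentially"
  shows "\<exists>r s t c d x y. strict_mono r \<and> converges (\<lambda>k. g (r k)) s t c d x y \<and> limit_pair x y"
proof -
  obtain r c d x y where r: "strict_mono r"
    "converges (\<lambda>k. g (r k)) (\<lambda>k. 1 / norm (g (r k))) (\<lambda>k. 1 / norm (ginv (g (r k)))) c d x y"
    using convergence_subseq[OF aut[OF g] top] by blast
  moreover have "limit_pair x y" by (rule limit_pairI[OF _ r(2)]) (rule g)
  ultimately show ?thesis by blast
qed

lemma norm_top:
  assumes "\<And>Z. eventually (\<lambda>k. norm (g k) > Z) sequentially"
  shows "filterlim (\<lambda>k. norm (g k)) at_top sequentially"
  unfolding filterlim_at_top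
proof
  fix Z show "eventually (\<lambda>k. Z \<le> norm (g k)) sequentially" by (rule eventually_mono[OF assms[of Z]]) simp
qed

text \<open>Elements of bounded norm account for finitely many points of the orbit, all of them interior.
  So the norms tend to infinity along orbit points converging to \<open>p\<close>, and
  \<open>p\<close> is the attracting point of a subsequence.\<close>

lemma limit_pair_of_closure:
  assumes p: "p \<in> bdry" "p \<in> closure base_orbit" shows "\<exists>q. limit_pair p q"
proof -
  obtain b where b: "\<And>k::nat. b k \<in> base_orbit" "b \<longlonglongrightarrow> p"
    using p(2) unfolding closure_sequential by blast
  have "\<forall>k. \<exists>h. h \<in> \<Gamma> \<and> act h base = b k"
  proof
    fix k
    have "b k \<in> (\<lambda>h. act h base) ` \<Gamma>" using b(1)[of k] by (simp only: base_orbit_def)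
    then show "\<exists>h. h \<in> \<Gamma> \<and> act h base = b k" by (rule imageE) (intro exI conjI, assumption, rule sym)
  qed
  from choice[OF this] obtain g where g: "\<And>k. g k \<in> \<Gamma>" "\<And>k. act (g k) base = b k" by blast
  have "eventually (\<lambda>k. norm (g k) > Z) sequentially" for Z
  proof -
    let ?F = "(\<lambda>g. act g base) ` {g \<in> \<Gamma>. norm g \<le> Z}"
    have "act h base \<in> C" if "h \<in> \<Gamma>" for h
      using that aut autC_C base_C C_pos by (auto simp: act_def intro!: cone_C)
    then have "p \<notin> ?F" using p bdryD by auto
    moreover have "closed ?F" using finite_bounded by (intro finite_imp_closed finite_imageI)
    ultimately have "eventually (\<lambda>k. b k \<in> - ?F) sequentially"
      using b(2) by (intro topological_tendstoD) auto
    then show ?thesis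
    proof eventually_elim
      case (elim k)
      show ?case
      proof (rule ccontr)
        assume "\<not> ?case"
        then have "b k \<in> ?F" using g[of k] by (metis (mono_tags, lifting) image_eqI mem_Collect_eq not_less)
        then show False using elim by simp
      qed
    qed
  qed
  then obtain r s t c d x y where r: "strict_mono r" "converges (\<lambda>k. g (r k)) s t c d x y" "limit_pair x y"
    using limit_pair_of_unbounded[of g, OF g(1) norm_top] by blast
  have "(\<lambda>k. act (g (r k)) base) \<longlonglongrightarrow> x"
    using base_C closure_subset zero_notin_C tang_pos_C convergesD[OF r(2)]
    by (intro converges_apply[OF r(2) tendsto_const]) auto
  moreover have "(\<lambda>k. act (g (r k)) base) \<longlonglongrightarrow> p"
    using LIMSEQ_subseq_LIMSEQ[OF b(2) r(1)] g(2) by (simp add: o_def)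
  ultimately have "x = p" by (rule LIMSEQ_unique)
  then show ?thesis using r(3) by blast
qed

lemma two_others: assumes "p \<in> bdry" shows "\<exists>y\<in>bdry. \<exists>z\<in>bdry. y \<noteq> p \<and> z \<noteq> p \<and> y \<noteq> z"
  using three_points by metis

text \<open>By strict convexity the caps cut off by hyperplanes parallel to the tangent hyperplane at
  \<open>p\<close> shrink to \<open>p\<close>.\<close>

lemma small_cap:
  assumes p: "p \<in> bdry" "p \<in> U" and U: "open U"
  shows "\<exists>e>0. \<forall>v\<in>slice. tang p \<bullet> v < e \<longrightarrow> v \<in> U"
proof (cases "slice - U = {}")
  case True
  then show ?thesis by (intro exI[of _ 1]) auto
next
  case False
  have "compact (slice - U)" using compact_slice U by (rule compact_diff)
  moreover have "continuous_on (slice - U) (\<lambda>v. tang p \<bullet> v)" by (intro continuous_intros)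
  ultimately obtain m where m: "m \<in> slice - U" "\<And>v. v \<in> slice - U \<Longrightarrow> tang p \<bullet> m \<le> tang p \<bullet> v"
    using continuous_attains_inf[OF _ False] by blast
  have "tang p \<bullet> m > 0" using m(1) p tang_pos_slice[of p m] by auto
  then show ?thesis using m(2) by (intro exI[of _ "tang p \<bullet> m"]) (auto simp: not_less[symmetric])
qed

text \<open>The combination of \<open>y - p\<close> and \<open>z - p\<close> on which \<open>tang
  p\<close> vanishes is nonzero, as otherwise three boundary points would be collinear.\<close>

lemma tangent_direction:
  assumes p: "p \<in> bdry" shows "\<exists>w. w \<noteq> 0 \<and> f \<bullet> w = 0 \<and> tang p \<bullet> w = 0"
proof -
  obtain y z where yz: "y \<in> bdry" "z \<in> bdry" "y \<noteq> p" "z \<noteq> p" "y \<noteq> z" using two_others p by blast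
  define a where "a = tang p \<bullet> z"
  define b where "b = tang p \<bullet> y"
  have ab: "a > 0" "b > 0" using tang_pos p yz by (auto simp: a_def b_def)
  define w where "w = a *\<^sub>R (y - p) - b *\<^sub>R (z - p)"
  have tw: "f \<bullet> w = 0" "tang p \<bullet> w = 0"
    using yz p bdryD tang_self[OF p] by (auto simp: w_def inner_diff_right a_def b_def)
  have "w \<noteq> 0"
  proof
    assume "w = 0"
    then have eq: "a *\<^sub>R y + (b - a) *\<^sub>R p = b *\<^sub>R z" by (simp add: w_def algebra_simps)
    have scaled: "s *\<^sub>R v \<in> C \<Longrightarrow> s > 0 \<Longrightarrow> v \<in> C" for s v using cone_C[of "s *\<^sub>R v" "1 / s"] by simp
    consider "b > a" | "a > b" | "a = b" by linarith
    then show False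
    proof cases
      case 1
      then have "b *\<^sub>R z \<in> C" using strict[OF yz(1) p yz(3) ab(1), of "b - a"] eq by simp
      then show False using scaled ab yz(2) bdryD by blast
    next
      case 2
      have "b *\<^sub>R z + (a - b) *\<^sub>R p = a *\<^sub>R y" using eq by (simp add: algebra_simps)
      then have "a *\<^sub>R y \<in> C" using strict[OF yz(2) p yz(4) ab(2), of "a - b"] 2 by simp
      then show False using scaled ab yz(1) bdryD by blast
    next
      case 3
      then show False using eq ab yz by simp
    qed
  qed
  then show ?thesis using tw by blast
qed

text \<open>The points \<open>a\<close> and \<open>b\<close> are the ends of a chord through an interior
  point \<open>z\<close> close to \<open>p\<close> that is parallel to the tangent hyperplane at
  \<open>p\<close>.\<close>

lemma cap_points:
  assumes p: "p \<in> bdry" "p \<in> U" and U: "open U"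
  shows "\<exists>z w a b r s. z \<in> C \<and> f \<bullet> z = 1 \<and> w \<noteq> 0 \<and> f \<bullet> w = 0 \<and> r > 0 \<and> s > 0 \<and>
     a = z + r *\<^sub>R w \<and> b = z - s *\<^sub>R w \<and> a \<in> bdry \<inter> U \<and> b \<in> bdry \<inter> U \<and> a \<noteq> p \<and> b \<noteq> p \<and> a \<noteq> b \<and>
     (\<forall>q\<in>slice. tang p \<bullet> q \<le> tang p \<bullet> z \<longrightarrow> q \<in> U)"
proof -
  obtain e where e: "e > 0" "\<And>v. v \<in> slice \<Longrightarrow> tang p \<bullet> v < e \<Longrightarrow> v \<in> U" using small_cap[OF assms] by blast
  define h where "h = min (1/2) (e / 2)"
  have h: "0 < h" "h < 1" "h < e" using e by (auto simp: h_def)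
  define z where "z = (1 - h) *\<^sub>R p + h *\<^sub>R base"
  have zC: "z \<in> C" unfolding z_def
    using h bdryD(1)[OF p(1)] by (intro add_closure_C closure_scale cone_C base_C) auto
  have fz: "f \<bullet> z = 1" using bdryD(3)[OF p(1)] f_base by (simp add: z_def inner_add_right)
  have tz: "tang p \<bullet> z = h" using tang_self tang_base p by (simp add: z_def inner_add_right)
  obtain w where w: "w \<noteq> 0" "f \<bullet> w = 0" "tang p \<bullet> w = 0" using tangent_direction[OF p(1)] by blast
  obtain r where r: "r > 0" "z + r *\<^sub>R w \<in> bdry" using chord[OF zC fz w(1,2)] by blast
  obtain s where s: "s > 0" "z + s *\<^sub>R (- w) \<in> bdry" using chord[OF zC fz, of "-w"] w by auto
  have t: "tang p \<bullet> (z + r *\<^sub>R w) = h" "tang p \<bullet> (z - s *\<^sub>R w) = h"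
    using tz w by (simp_all add: inner_add_right inner_diff_right)
  have "z + r *\<^sub>R w \<noteq> z - s *\<^sub>R w"
  proof
    assume "z + r *\<^sub>R w = z - s *\<^sub>R w"
    then have "(r + s) *\<^sub>R w = 0" by (simp add: algebra_simps)
    then show False using r s w by simp
  qed
  moreover have "z + r *\<^sub>R w \<noteq> p" "z - s *\<^sub>R w \<noteq> p" using t tang_self[OF p(1)] h by auto
  moreover have "z + r *\<^sub>R w \<in> U" "z - s *\<^sub>R w \<in> U"
    using e(2) bdryD(5)[OF r(2)] bdryD(5)[OF s(2)] t h by auto
  moreover have "\<forall>q\<in>slice. tang p \<bullet> q \<le> tang p \<bullet> z \<longrightarrow> q \<in> U" using e(2) tz h by auto
  moreover have "z - s *\<^sub>R w \<in> bdry" using s(2) by simp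
  moreover note zC fz w(1,2) r s(1)
  ultimately show ?thesis
    by (intro exI[of _ z] exI[of _ w] exI[of _ "z + r *\<^sub>R w"] exI[of _ "z - s *\<^sub>R w"] exI[of _ r] exI[of _ s]
        conjI IntI) (assumption | rule refl)+
qed

text \<open>Both eigenvalues are the factor by which \<open>g\<close> multiplies \<open>tang p\<close>.\<close>

lemma eigenvalues_agree:
  assumes g: "autC g" and b: "p \<in> bdry" "q \<in> bdry" "r \<in> bdry" and ne: "p \<noteq> q" "p \<noteq> r"
    and e: "g *v p = l *\<^sub>R p" "g *v q = m *\<^sub>R q" "g *v r = n *\<^sub>R r"
  shows "m = n"
proof -
  have "m * (tang p \<bullet> q) = n * (tang p \<bullet> q)"
    using tang_eigen[OF g b(1) e(1) b(2) e(2) ne(1), of q] tang_eigen[OF g b(1) e(1) b(3) e(3) ne(2), of q] by metis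
  then show ?thesis using tang_pos[OF b(1,2) ne(1)] by auto
qed

text \<open>By \<open>eigenvalues_agree\<close> all boundary points in \<open>U\<close> have the same
  eigenvalue \<open>l\<close>, and the chord through \<open>z\<close> makes \<open>z\<close> an
  eigenvector for \<open>l\<close> as well. Every line through \<open>z\<close> in the slice has
  an end below \<open>z\<close>, hence in \<open>U\<close>, so \<open>g\<close> is the scalar
  \<open>l\<close>.\<close>

lemma fixes_open_imp_trivial:
  assumes g: "autC g" and p: "p \<in> bdry" "p \<in> U" and U: "open U"
    and fxd: "\<And>q. q \<in> bdry \<Longrightarrow> q \<in> U \<Longrightarrow> act g q = q" and v: "v \<in> slice"
  shows "act g v = v"
proof -
  obtain z w a b r s where z: "z \<in> C" "f \<bullet> z = 1" and w: "w \<noteq> 0" "f \<bullet> w = 0" and rs: "r > 0" "s > 0"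
     and ab: "a = z + r *\<^sub>R w" "b = z - s *\<^sub>R w" "a \<in> bdry" "a \<in> U" "b \<in> bdry" "b \<in> U" "a \<noteq> p" "b \<noteq> p" "a \<noteq> b"
     and near: "\<And>q. q \<in> slice \<Longrightarrow> tang p \<bullet> q \<le> tang p \<bullet> z \<Longrightarrow> q \<in> U"
    using cap_points[OF p U] by auto
  have eig: "g *v q = (f \<bullet> (g *v q)) *\<^sub>R q" if "q \<in> bdry" "q \<in> U" for q
    using fxd[OF that] act_fixed_iff[OF g bdryD(5)[OF that(1)]] by simp
  define l where "l = f \<bullet> (g *v a)"
  have all: "g *v q = l *\<^sub>R q" if q: "q \<in> bdry" "q \<in> U" for q
  proof (cases "q = p")
    case True
    have "f \<bullet> (g *v p) = f \<bullet> (g *v a)"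
      by (rule eigenvalues_agree[OF g ab(5) p(1) ab(3) _ _ eig[OF ab(5,6)] eig[OF p] eig[OF ab(3,4)]]) (use ab in auto)
    then show ?thesis using eig[OF p] True l_def by simp
  next
    case False
    have "f \<bullet> (g *v q) = f \<bullet> (g *v a)"
      by (rule eigenvalues_agree[OF g p(1) q(1) ab(3) _ _ eig[OF p] eig[OF q] eig[OF ab(3,4)]]) (use ab False in auto)
    then show ?thesis using eig[OF q] l_def by simp
  qed
  have zab: "(r + s) *\<^sub>R z = s *\<^sub>R a + r *\<^sub>R b" by (simp add: ab algebra_simps)
  have "(r + s) *\<^sub>R (g *v z) = g *v ((r + s) *\<^sub>R z)" by (simp add: matrix_vector_mult_scaleR)
  also have "\<dots> = l *\<^sub>R ((r + s) *\<^sub>R z)"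
    unfolding zab using all[OF ab(3,4)] all[OF ab(5,6)]
    by (simp add: matrix_vector_right_distrib matrix_vector_mult_scaleR scaleR_add_right mult.commute)
  finally have "(1 / (r + s)) *\<^sub>R ((r + s) *\<^sub>R (g *v z)) = (1 / (r + s)) *\<^sub>R (l *\<^sub>R ((r + s) *\<^sub>R z))" by simp
  then have gz: "g *v z = l *\<^sub>R z" using rs by simp
  have dir: "g *v u = l *\<^sub>R u" if u: "f \<bullet> u = 0" "tang p \<bullet> u \<le> 0" for u
  proof (cases "u = 0")
    case False
    obtain k where k: "k > 0" "z + k *\<^sub>R u \<in> bdry" using chord[OF z False u(1)] by blast
    have "tang p \<bullet> (z + k *\<^sub>R u) \<le> tang p \<bullet> z"
      using u k by (simp add: inner_add_right mult_nonneg_nonpos)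
    then have "g *v (z + k *\<^sub>R u) = l *\<^sub>R (z + k *\<^sub>R u)" using all k near bdryD(5) by blast
    then have "k *\<^sub>R (g *v u) = k *\<^sub>R (l *\<^sub>R u)"
      by (simp add: matrix_vector_right_distrib matrix_vector_mult_scaleR gz algebra_simps)
    then show ?thesis using k(1) by (simp only: scaleR_cancel_left) simp
  qed simp
  have dir2: "g *v u = l *\<^sub>R u" if u: "f \<bullet> u = 0" for u
  proof (cases "tang p \<bullet> u \<le> 0")
    case False
    then have "g *v (- u) = l *\<^sub>R (- u)" using u by (intro dir) auto
    then show ?thesis by (simp add: linear_neg)
  qed (use dir u in auto)
  have fv: "f \<bullet> v = 1" using v by (simp add: slice_def)
  have "g *v (v - z) = l *\<^sub>R (v - z)" using fv z by (intro dir2) (simp add: inner_diff_right)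
  then have "g *v v = l *\<^sub>R v" using gz by (simp add: matrix_vector_mult_diff_distrib scaleR_diff_right)
  then show ?thesis using fv unfolding act_fixed_iff[OF g v] by simp
qed

text \<open>By \<open>fixes_open_imp_trivial\<close> an automorphism acting nontrivially moves boundary
  points arbitrarily close to a given one; a small neighbourhood of such a point is disjoint
  from its image. Finitely many automorphisms are treated one after the other.\<close>

lemma generic_neighbourhood:
  assumes "finite F" "F \<subseteq> {g. autC g}" and p: "p \<in> bdry" "p \<in> U" and U: "open U"
  shows "\<exists>p' U'. open U' \<and> U' \<subseteq> U \<and> p' \<in> bdry \<and> p' \<in> U' \<and>
     (\<forall>g\<in>F. (\<forall>v\<in>slice. act g v = v) \<or> (\<forall>v\<in>slice. v \<in> U' \<longrightarrow> act g v \<notin> U'))"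
  using assms(1,2)
proof (induction F)
  case empty
  then show ?case using p U by blast
next
  case (insert g F)
  then obtain p' U' where 1: "open U'" "U' \<subseteq> U" "p' \<in> bdry" "p' \<in> U'"
     "\<And>g. g \<in> F \<Longrightarrow> (\<forall>v\<in>slice. act g v = v) \<or> (\<forall>v\<in>slice. v \<in> U' \<longrightarrow> act g v \<notin> U')" by auto
  have g: "autC g" using insert by auto
  show ?case
  proof (cases "\<forall>v\<in>slice. act g v = v")
    case True
    then show ?thesis using 1 by blast
  next
    case False
    then obtain q where q: "q \<in> bdry" "q \<in> U'" "act g q \<noteq> q"
      using fixes_open_imp_trivial[OF g 1(3,4,1)] by blast
    obtain A B where AB: "open A" "open B" "q \<in> A" "act g q \<in> B" "A \<inter> B = {}"
      using hausdorff[OF q(3)] by blast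
    obtain W where W: "open W" "q \<in> W" "\<And>v. v \<in> W \<Longrightarrow> v \<in> slice \<Longrightarrow> act g v \<in> B"
      using continuous_act[OF g] AB(2,4) bdryD(5)[OF q(1)] unfolding continuous_on_topological by metis
    show ?thesis
    proof (intro exI conjI ballI)
      show "open (U' \<inter> A \<inter> W)" using 1 AB W by auto
      fix h assume "h \<in> insert g F"
      then consider "h = g" | "h \<in> F" by blast
      then show "(\<forall>v\<in>slice. act h v = v) \<or> (\<forall>v\<in>slice. v \<in> U' \<inter> A \<inter> W \<longrightarrow> act h v \<notin> U' \<inter> A \<inter> W)"
      proof cases
        case 1
        then show ?thesis using W AB by blast
      next
        case 2
        then show ?thesis using \<open>\<And>g. g \<in> F \<Longrightarrow> (\<forall>v\<in>slice. act g v = v) \<or> (\<forall>v\<in>slice. v \<in> U' \<longrightarrow> act g v \<notin> U')\<close>[OF 2] by blast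
      qed
    qed (use 1 q AB W in auto)
  qed
qed

text \<open>If \<open>p\<close> is not a limit point, then only finitely many elements map some point of a
  small neighbourhood \<open>U\<close> of \<open>p\<close> into \<open>U\<close>: an infinite
  family of them would have attracting and repelling points that are limit points, hence outside
  \<open>U\<close>, and would eventually move all points of \<open>U\<close> out of it. By
  \<open>generic_neighbourhood\<close> a smaller neighbourhood of some boundary point meets its
  images only under elements acting trivially, contrary to \<open>recurrent\<close>.\<close>

lemma every_point_limit:
  assumes p: "p \<in> bdry" shows "\<exists>q. limit_pair p q"
proof (rule ccontr)
  assume "\<not> ?thesis"
  then have pc: "p \<notin> closure base_orbit" using limit_pair_of_closure[OF p] by blast
  then obtain r where r: "r > 0" "ball p r \<subseteq> - closure base_orbit"
    using openE[of "- closure base_orbit" p] by auto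
  define U where "U = ball p (r / 2)"
  have clU: "cball p (r / 2) \<inter> closure base_orbit = {}" using r by (force simp: subset_iff)
  define F where "F = {g \<in> \<Gamma>. \<exists>v\<in>slice. v \<in> U \<and> act g v \<in> U}"
  have "finite F"
  proof (rule ccontr)
    assume "infinite F"
    then obtain g :: "nat \<Rightarrow> _" where g: "inj g" "range g \<subseteq> F" using infinite_countable_subset by blast
    then have gF: "g k \<in> F" for k by auto
    then have "\<forall>k. \<exists>v\<in>slice. v \<in> U \<and> act (g k) v \<in> U" by (simp add: F_def)
    then obtain v where v: "\<And>k. v k \<in> slice \<and> v k \<in> U \<and> act (g k) (v k) \<in> U" by metis
    have "v k \<in> slice" for k using v by blast
    then have "\<exists>l q. l \<in> slice \<and> strict_mono q \<and> (\<lambda>k. v (q k)) \<longlonglongrightarrow> l"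
      by (rule compact_subseq[OF compact_slice])
    then obtain l and q :: "nat \<Rightarrow> nat" where q: "l \<in> slice" "strict_mono q" "(\<lambda>k. v (q k)) \<longlonglongrightarrow> l" by blast
    have gq: "g (q k) \<in> \<Gamma>" for k using gF by (simp add: F_def)
    have "eventually (\<lambda>k. norm (g (q k)) > Z) sequentially" for Z
    proof -
      have "inj (\<lambda>k. g (q k))" using inj_compose[OF g(1) strict_mono_imp_inj_on[OF q(2)]] by (simp add: o_def)
      then have "finite ((\<lambda>k. g (q k)) -` {g \<in> \<Gamma>. norm g \<le> Z})"
        by (intro finite_vimageI finite_bounded)
      moreover have "(\<lambda>k. g (q k)) -` {g \<in> \<Gamma>. norm g \<le> Z} = {k. \<not> norm (g (q k)) > Z}"
        using gq by auto
      ultimately show ?thesis by (simp add: cofinite_eq_sequentially[symmetric] eventually_cofinite)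
    qed
    then obtain n s t c d x y where n: "strict_mono n" "converges (\<lambda>k. g (q (n k))) s t c d x y" "limit_pair x y"
      using limit_pair_of_unbounded[of "\<lambda>k. g (q k)", OF gq norm_top] by blast
    have lim: "(\<lambda>k. v (q (n k))) \<longlonglongrightarrow> l" using LIMSEQ_subseq_LIMSEQ[OF q(3) n(1)] by (simp add: o_def)
    have inU: "v (q (n k)) \<in> cball p (r/2)" "act (g (q (n k))) (v (q (n k))) \<in> cball p (r/2)" for k
      using v[of "q (n k)"] by (auto simp: U_def)
    have "l \<in> cball p (r/2)" using closed_sequentially[OF closed_cball inU(1) lim] .
    then have "l \<noteq> y" using clU limit_pair_closure[OF limit_pair_sym[OF n(3)]] by blast
    then have "tang y \<bullet> l > 0" using tang_pos_slice[OF limit_pair_bdry(2)[OF n(3)] q(1)] by simp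
    moreover have "v (q (n k)) \<in> closure C" "v (q (n k)) \<noteq> 0" for k
      using v[of "q (n k)"] by (auto simp: slice_def)
    ultimately have "(\<lambda>k. act (g (q (n k))) (v (q (n k)))) \<longlonglongrightarrow> x"
      using converges_apply[OF n(2) lim] by blast
    then have "x \<in> cball p (r/2)" by (rule closed_sequentially[OF closed_cball inU(2)])
    then show False using clU limit_pair_closure[OF n(3)] by blast
  qed
  moreover have "F \<subseteq> {g. autC g}" using aut by (auto simp: F_def)
  moreover have "p \<in> U" "open U" using r by (auto simp: U_def)
  ultimately obtain p' U' where U': "open U'" "U' \<subseteq> U" "p' \<in> bdry" "p' \<in> U'"
     "\<And>g. g \<in> F \<Longrightarrow> (\<forall>v\<in>slice. act g v = v) \<or> (\<forall>v\<in>slice. v \<in> U' \<longrightarrow> act g v \<notin> U')"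
    using generic_neighbourhood[OF _ _ p] by metis
  obtain g v where gv: "g \<in> \<Gamma>" "v \<in> C" "f \<bullet> v = 1" "v \<in> U'" "act g v \<in> U'" "act g v \<noteq> v"
    using recurrent[OF U'(1,3,4)] by blast
  have vs: "v \<in> slice" using gv closure_subset by (auto simp: slice_def)
  then have "g \<in> F" using gv U'(2) by (auto simp: F_def)
  then show False using U'(5) vs gv by blast
qed

end

section \<open>All pairs of boundary points are limit pairs\<close>

definition matrix_pow :: "real^'a::finite^'a \<Rightarrow> nat \<Rightarrow> real^'a^'a" where
  "matrix_pow h k = (((**) h) ^^ k) (mat 1)"

lemma matrix_pow_0: "matrix_pow h 0 = mat 1" and matrix_pow_Suc: "matrix_pow h (Suc k) = h ** matrix_pow h k"
  by (simp_all add: matrix_pow_def)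

lemma matrix_pow_eigen: "h *v v = l *\<^sub>R v \<Longrightarrow> matrix_pow h k *v v = l ^ k *\<^sub>R v"
proof (induction k)
  case (Suc k)
  have "matrix_pow h (Suc k) *v v = h *v (matrix_pow h k *v v)" by (simp only: matrix_pow_Suc matrix_vector_mul_assoc)
  also have "\<dots> = l ^ Suc k *\<^sub>R v" using Suc by (simp add: matrix_vector_mult_scaleR mult.commute)
  finally show ?case .
qed (simp add: matrix_pow_0)

context smooth_cone
begin

lemma act_eq_self: assumes "autC g" "v \<in> slice" "act g v = v" shows "g *v v = (f \<bullet> (g *v v)) *\<^sub>R v"
  using act_fixed_iff[OF assms(1,2)] assms(3) by blast

lemma act_self_of_eigen: assumes "v \<in> slice" "g *v v = l *\<^sub>R v" "l \<noteq> 0" shows "act g v = v"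
  using assms by (simp add: act_def slice_def)

lemma act_inj: assumes "autC g" "u \<in> slice" "v \<in> slice" "act g u = act g v" shows "u = v"
proof -
  have nz: "u \<noteq> 0" "v \<noteq> 0" "u \<in> closure C" "v \<in> closure C" using assms by (auto simp: slice_def)
  have "ginv g *v act g w = (1 / (f \<bullet> (g *v w))) *\<^sub>R w" for w
    by (simp add: act_def matrix_vector_mult_scaleR inv_apply assms)
  then have eq: "(1 / (f \<bullet> (g *v u))) *\<^sub>R u = (1 / (f \<bullet> (g *v v))) *\<^sub>R v" using assms(4) by metis
  then have "f \<bullet> ((1 / (f \<bullet> (g *v u))) *\<^sub>R u) = f \<bullet> ((1 / (f \<bullet> (g *v v))) *\<^sub>R v)" by simp
  then have "1 / (f \<bullet> (g *v u)) = 1 / (f \<bullet> (g *v v))" using assms by (simp add: slice_def)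
  then show ?thesis using eq autC_f_pos[OF assms(1) nz(3,1)] by simp
qed

lemma converges_fixed:
  assumes c: "converges g s t c d x y" and z: "z \<in> slice" "z \<noteq> y" "\<And>k. act (g k) z = z" shows "z = x"
proof -
  have "tang y \<bullet> z > 0" using tang_pos_slice convergesD(9)[OF c] z by blast
  then have "(\<lambda>k. act (g k) z) \<longlonglongrightarrow> x"
    using z by (intro converges_apply[OF c tendsto_const]) (auto simp: slice_def)
  then show ?thesis using z(3) LIMSEQ_unique[OF tendsto_const] by simp
qed

lemma converges_left:
  assumes c: "converges g s t c d x y" and h: "autC h"
  shows "\<exists>c' d'. converges (\<lambda>k. h ** g k) s t c' d' (act h x) y"
proof -
  note cD = convergesD[OF c]
  have hx: "act h x \<in> bdry" using act_bdry h cD by blast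
  have fx: "f \<bullet> (h *v x) > 0" using autC_f_pos[OF h] bdryD[OF cD(8)] by blast
  have hxe: "h *v x = (f \<bullet> (h *v x)) *\<^sub>R act h x" using fx by (simp add: act_def)
  define a where "a = transpose (ginv h) *v tang x"
  have a: "a \<bullet> v = tang x \<bullet> (ginv h *v v)" for v unfolding a_def by (rule transpose_inner)
  have aC: "a \<bullet> v > 0" if "v \<in> C" for v using that a tang_pos_C cD(8) autC_C[OF autC_inv[OF h]] by simp
  have "a \<bullet> act h x = 0"
    using a inv_apply(1)[OF h] tang_self[OF cD(8)] by (simp add: act_def matrix_vector_mult_scaleR)
  then have "supports a (act h x)" using aC aC[OF base_C] by (auto simp: supports_def less_imp_le)
  then have ae: "a = (a \<bullet> base) *\<^sub>R tang (act h x)" by (rule supports_eq_tang[OF hx])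
  have "(\<lambda>k. h ** (s k *\<^sub>R g k)) \<longlonglongrightarrow> h ** (c *\<^sub>R outer x (tang y))"
    by (intro tendsto_matrix_mult tendsto_const cD)
  moreover have "h ** (c *\<^sub>R outer x (tang y)) = (c * (f \<bullet> (h *v x))) *\<^sub>R outer (act h x) (tang y)"
    unfolding matrix_mult_scaleR mult_outer by (subst hxe) (simp add: outer_scaleR_left)
  ultimately have 1: "(\<lambda>k. s k *\<^sub>R (h ** g k)) \<longlonglongrightarrow> (c * (f \<bullet> (h *v x))) *\<^sub>R outer (act h x) (tang y)"
    by (simp add: matrix_mult_scaleR)
  have "(\<lambda>k. (t k *\<^sub>R ginv (g k)) ** ginv h) \<longlonglongrightarrow> (d *\<^sub>R outer y (tang x)) ** ginv h"
    by (intro tendsto_matrix_mult tendsto_const cD)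
  moreover have "(d *\<^sub>R outer y (tang x)) ** ginv h = (d * (a \<bullet> base)) *\<^sub>R outer y (tang (act h x))"
    unfolding scaleR_matrix_mult outer_mult_matrix a_def[symmetric] by (subst ae) (simp add: outer_scaleR_right)
  ultimately have 2: "(\<lambda>k. t k *\<^sub>R ginv (h ** g k)) \<longlonglongrightarrow> (d * (a \<bullet> base)) *\<^sub>R outer y (tang (act h x))"
    by (simp add: scaleR_matrix_mult inv_mult h cD(1))
  have "converges (\<lambda>k. h ** g k) s t (c * (f \<bullet> (h *v x))) (d * (a \<bullet> base)) (act h x) y"
    unfolding converges_def using 1 2 cD fx aC[OF base_C] hx autC_mult[OF h] by auto
  then show ?thesis by blast
qed

end

context recurrent_group
begin

lemma Gamma_nonempty: "\<exists>g. g \<in> \<Gamma>"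
  using three_points recurrent[of UNIV] by auto

lemma one_closed: "mat 1 \<in> \<Gamma>"
proof -
  obtain g where "g \<in> \<Gamma>" using Gamma_nonempty by blast
  then show ?thesis using mult_closed[OF _ inv_closed, of g g] inv_right[OF aut] by simp
qed

lemma matrix_pow_closed: "h \<in> \<Gamma> \<Longrightarrow> matrix_pow h k \<in> \<Gamma>"
  by (induction k) (simp_all add: matrix_pow_0 matrix_pow_Suc one_closed mult_closed)

lemma exists_other_point:
  assumes "finite A" "p \<in> bdry" shows "\<exists>a\<in>bdry. a \<noteq> p \<and> a \<notin> A"
proof -
  have "open (- (A - {p}))" using assms(1) by (intro open_Compl finite_imp_closed) auto
  moreover have "p \<in> - (A - {p})" by simp
  ultimately show ?thesis using cap_points[OF assms(2), of "- (A - {p})"]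
  proof (elim exE conjE meta_impE)
    fix a assume "a \<in> bdry \<inter> - (A - {p})" "a \<noteq> p"
    then show ?thesis by blast
  qed
qed

text \<open>A sequence whose attracting point \<open>p\<close> differs from the common fixed point
  \<open>x\<close> must have \<open>x\<close> as its repelling point. Its late members expand a
  second fixed point near \<open>p\<close> and contract \<open>x\<close>.\<close>

lemma hyperbolic_element:
  assumes x: "x \<in> bdry" and fxd: "\<And>g. g \<in> \<Gamma> \<Longrightarrow> act g x = x"
  shows "\<exists>h\<in>\<Gamma>. \<exists>v\<in>bdry. \<exists>l m. v \<noteq> x \<and> h *v v = l *\<^sub>R v \<and> h *v x = m *\<^sub>R x \<and> l > 1 \<and> 0 < m \<and> m < 1"
proof -
  have xs: "x \<in> slice" by (rule bdryD(5)[OF x])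
  obtain p where p: "p \<in> bdry" "p \<noteq> x" using exists_other_point[of "{}" x] x by auto
  obtain q where q: "limit_pair p q" using every_point_limit p by blast
  obtain g s t c d where g: "\<And>k. g k \<in> \<Gamma>" "converges g s t c d p q" using limit_pairE[OF q] by blast
  have "q = x"
  proof (rule ccontr)
    assume "q \<noteq> x"
    then have "x = p" using converges_fixed[OF g(2) xs] fxd g(1) by blast
    then show False using p by simp
  qed
  then have cx: "converges g s t c d p x" using g(2) by simp
  note cD = convergesD[OF cx]
  obtain v where v: "v \<longlonglongrightarrow> p" "eventually (\<lambda>k. v k \<in> slice \<and> act (g k) (v k) = v k) sequentially"
     "(\<lambda>k. s k * (f \<bullet> (g k *v v k))) \<longlonglongrightarrow> c * (tang x \<bullet> p)" using fixed_sequence[OF cx p(2)] by blast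
  have L: "c * (tang x \<bullet> p) > 0" "d * (tang p \<bullet> x) > 0" using tang_pos cD p x by auto
  have e1: "eventually (\<lambda>k. f \<bullet> (g k *v v k) > 1) sequentially" by (rule eventually_gt_one[OF v(3) L(1) cD(4,2)])
  have "(\<lambda>k. f \<bullet> ((t k *\<^sub>R ginv (g k)) *v x)) \<longlonglongrightarrow> f \<bullet> ((d *\<^sub>R outer x (tang p)) *v x)"
    by (intro tendsto_intros tendsto_matrix_vector cD)
  then have "(\<lambda>k. t k * (f \<bullet> (ginv (g k) *v x))) \<longlonglongrightarrow> d * (tang p \<bullet> x)"
    using bdryD(3)[OF x] by (simp add: scaleR_matrix_vector)
  then have e2: "eventually (\<lambda>k. f \<bullet> (ginv (g k) *v x) > 1) sequentially"
    by (rule eventually_gt_one[OF _ L(2) cD(5,3)])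
  have e3: "eventually (\<lambda>k. v k \<in> - {x}) sequentially"
    using v(1) p(2) by (intro topological_tendstoD) auto
  have "eventually (\<lambda>k. v k \<in> slice \<and> act (g k) (v k) = v k \<and> f \<bullet> (g k *v v k) > 1 \<and>
       f \<bullet> (ginv (g k) *v x) > 1 \<and> v k \<noteq> x) sequentially"
    using v(2) e1 e2 e3 by eventually_elim auto
  then have "\<exists>k. v k \<in> slice \<and> act (g k) (v k) = v k \<and> f \<bullet> (g k *v v k) > 1 \<and>
       f \<bullet> (ginv (g k) *v x) > 1 \<and> v k \<noteq> x" by (rule eventually_happens'[OF sequentially_bot])
  then obtain k where k: "v k \<in> slice" "act (g k) (v k) = v k" "f \<bullet> (g k *v v k) > 1"
       "f \<bullet> (ginv (g k) *v x) > 1" "v k \<noteq> x" by blast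
  have gk: "autC (g k)" by (rule cD)
  define l where "l = f \<bullet> (g k *v v k)"
  define m where "m = 1 / (f \<bullet> (ginv (g k) *v x))"
  have gv: "g k *v v k = l *\<^sub>R v k" using act_eq_self[OF gk k(1,2)] by (simp add: l_def)
  have "ginv (g k) *v x = (f \<bullet> (ginv (g k) *v x)) *\<^sub>R x"
    using act_eq_self[OF autC_inv[OF gk] xs fxd[OF inv_closed[OF g(1)]]] .
  then have gx: "g k *v x = m *\<^sub>R x"
    using ginv_eigen[OF autC_inv[OF gk], of x "f \<bullet> (ginv (g k) *v x)"] k(4) by (simp add: m_def inv_inv[OF gk])
  have lm: "l > 1" "0 < m" "m < 1" using k by (auto simp: l_def m_def)
  then have "m < l" by linarith
  then have "v k \<notin> C"
    using repelled_notin_C[OF gk gv xs gx lm(2)] k(1) by (simp add: slice_def)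
  then have "v k \<in> bdry" using k(1) by (auto simp: slice_def bdry_def)
  then show ?thesis using g(1) k(5) gv gx lm by blast
qed

text \<open>Since \<open>g\<close> fixes \<open>x\<close>, the conjugates of \<open>g\<close> by the
  powers of \<open>h\<close> are bounded on the vector \<open>v + x\<close>; by discreteness two
  of them coincide, and \<open>g\<close> commutes with a nontrivial power of \<open>h\<close>.
  If \<open>g\<close> moved \<open>v\<close>, this power would have three fixed boundary points
  and hence a single eigenvalue at them.\<close>

lemma commutes_with_hyperbolic:
  assumes x: "x \<in> bdry" and v: "v \<in> bdry" "v \<noteq> x" and h: "h \<in> \<Gamma>" "h *v v = l *\<^sub>R v" "h *v x = m *\<^sub>R x"
    and lm: "l > 1" "0 < m" "m < 1" and g: "g \<in> \<Gamma>" "act g x = x"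
  shows "act g v = v"
proof -
  let ?H = "matrix_pow h"
  have Hv: "?H k *v v = l ^ k *\<^sub>R v" and Hx: "?H k *v x = m ^ k *\<^sub>R x" for k
    using matrix_pow_eigen h by blast+
  have H: "?H k \<in> \<Gamma>" for k using matrix_pow_closed h by blast
  have HA: "autC (?H k)" for k using aut H by blast
  have ga: "autC g" using aut g by blast
  have vs: "v \<in> slice" "x \<in> slice" using v x bdryD by auto
  have vn: "norm v > 0" using bdryD(4)[OF v(1)] by simp
  have "eventually (\<lambda>k. norm (?H k) > Z) sequentially" for Z
  proof -
    have lb: "l ^ k \<le> real CARD('m) * norm (?H k)" for k
    proof -
      have "norm (?H k *v v) = l ^ k * norm v" using lm by (simp add: Hv)
      then have "l ^ k * norm v \<le> (real CARD('m) * norm (?H k)) * norm v"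
        using norm_matrix_vector_le[of "?H k" v] by simp
      then show ?thesis using vn by (simp only: mult_le_cancel_right_pos)
    qed
    obtain n where n: "real CARD('m) * \<bar>Z\<bar> < l ^ n" using real_arch_pow[OF lm(1)] by blast
    have "norm (?H k) > Z" if "k \<ge> n" for k
    proof -
      have "l ^ n \<le> l ^ k" using that lm by (intro power_increasing) auto
      then have "real CARD('m) * \<bar>Z\<bar> < real CARD('m) * norm (?H k)" using n lb[of k] by linarith
      then show ?thesis by simp
    qed
    then show ?thesis unfolding eventually_sequentially by blast
  qed
  then obtain r s t c d a b where r: "strict_mono r" "converges (\<lambda>k. ?H (r k)) s t c d a b"
    using limit_pair_of_unbounded[of ?H, OF H norm_top] by blast
  note cD = convergesD[OF r(2)]
  have fix2: "act (?H k) v = v" "act (?H k) x = x" for k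
    using act_self_of_eigen[OF vs(1) Hv] act_self_of_eigen[OF vs(2) Hx] lm by auto
  have limv: "(\<lambda>k. s k *\<^sub>R (?H (r k) *v u)) \<longlonglongrightarrow> (c * (tang b \<bullet> u)) *\<^sub>R a" for u
    using tendsto_matrix_vector[OF cD(10) tendsto_const[of u]] by (simp add: scaleR_matrix_vector)
  have bx: "b = x"
  proof (rule ccontr)
    assume "b \<noteq> x"
    have "(\<lambda>k. s k * (1 * norm x)) \<longlonglongrightarrow> 0" using tendsto_mult_right[OF cD(4), of "1 * norm x"] by simp
    moreover have "norm (s k *\<^sub>R (?H (r k) *v x)) \<le> s k * (1 * norm x)" for k
    proof -
      have "m ^ r k \<le> 1" using lm by (intro power_le_one) auto
      then have "s k * (m ^ r k * norm x) \<le> s k * (1 * norm x)"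
        using cD(2)[of k] by (intro mult_left_mono mult_right_mono) auto
      then show ?thesis using cD(2)[of k] lm by (simp add: Hx mult.assoc)
    qed
    ultimately have "(\<lambda>k. s k *\<^sub>R (?H (r k) *v x)) \<longlonglongrightarrow> 0"
      by (rule Lim_null_comparison[OF always_eventually, OF allI, rotated])
    then have "(c * (tang b \<bullet> x)) *\<^sub>R a = 0" using LIMSEQ_unique limv by blast
    then show False using tang_pos[OF cD(9) x \<open>b \<noteq> x\<close>] cD(6) bdryD(4)[OF cD(8)] by simp
  qed
  have av: "a = v" using converges_fixed[OF r(2) vs(1)] v(2) bx fix2 by metis
  define L where "L = c * (tang x \<bullet> v)"
  have L: "L > 0" using cD(6) tang_pos x v by (simp add: L_def)
  have limL: "(\<lambda>k. s k * l ^ r k) \<longlonglongrightarrow> L"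
  proof -
    have "(\<lambda>k. f \<bullet> (s k *\<^sub>R (?H (r k) *v v))) \<longlonglongrightarrow> f \<bullet> ((c * (tang b \<bullet> v)) *\<^sub>R a)"
      by (intro tendsto_intros limv)
    then show ?thesis using bdryD(3)[OF v(1)] by (simp add: Hv av bx L_def)
  qed
  define w where "w = g *v v"
  define n where "n = f \<bullet> (g *v x)"
  have gx: "g *v x = n *\<^sub>R x" unfolding n_def by (rule act_eq_self[OF ga vs(2) g(2)])
  \<comment> \<open>The image of \<open>v + x\<close> under \<open>M k\<close> converges: \<open>x\<close> is an
    eigenvector of both factors, and the powers of \<open>h\<close>, scaled by their eigenvalue
    at \<open>v\<close>, converge.\<close>
  define M where "M k = ?H (r k) ** g ** ginv (?H (r k))" for k
  have MG: "M k \<in> \<Gamma>" for k unfolding M_def using mult_closed inv_closed H g by blast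
  have oC: "v + x \<in> C" using strict[OF v(1) x v(2), of 1 1] by simp
  have Mo: "M k *v (v + x) = (1 / (s k * l ^ r k)) *\<^sub>R (s k *\<^sub>R (?H (r k) *v w)) + n *\<^sub>R x" for k
  proof -
    have lp: "l ^ r k \<noteq> 0" "m ^ r k \<noteq> 0" "s k \<noteq> 0" using lm cD(2)[of k] by auto
    have "ginv (?H (r k)) *v (v + x) = (1 / l ^ r k) *\<^sub>R v + (1 / m ^ r k) *\<^sub>R x"
      using ginv_eigen[OF HA Hv] ginv_eigen[OF HA Hx] lp by (simp add: matrix_vector_right_distrib)
    then have "M k *v (v + x) = ?H (r k) *v (g *v ((1 / l ^ r k) *\<^sub>R v + (1 / m ^ r k) *\<^sub>R x))"
      by (simp only: M_def matrix_vector_mul_assoc[symmetric])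
    also have "g *v ((1 / l ^ r k) *\<^sub>R v + (1 / m ^ r k) *\<^sub>R x)
        = (1 / l ^ r k) *\<^sub>R w + (n / m ^ r k) *\<^sub>R x"
      by (simp add: matrix_vector_right_distrib matrix_vector_mult_scaleR w_def gx)
    also have "?H (r k) *v \<dots> = (1 / l ^ r k) *\<^sub>R (?H (r k) *v w) + n *\<^sub>R x"
      using lp by (simp add: matrix_vector_right_distrib matrix_vector_mult_scaleR Hx)
    finally show ?thesis using lp by simp
  qed
  have "(\<lambda>k. M k *v (v + x)) \<longlonglongrightarrow> (1 / L) *\<^sub>R ((c * (tang b \<bullet> w)) *\<^sub>R a) + n *\<^sub>R x"
    unfolding Mo using L by (intro tendsto_intros limL limv) auto
  then have "(\<lambda>k. f \<bullet> (M k *v (v + x))) \<longlonglongrightarrow> f \<bullet> ((1 / L) *\<^sub>R ((c * (tang b \<bullet> w)) *\<^sub>R a) + n *\<^sub>R x)"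
    by (intro tendsto_intros)
  then have "Bseq (\<lambda>k. f \<bullet> (M k *v (v + x)))" by (intro convergent_imp_Bseq convergentI)
  then obtain K where K: "\<And>k. \<bar>f \<bullet> (M k *v (v + x))\<bar> \<le> K" unfolding Bseq_def by auto
  obtain B where B: "B > 0" "\<And>g. autC g \<Longrightarrow> norm g \<le> B * (f \<bullet> (g *v (v + x)))"
    using autC_norm_bound[OF oC] by blast
  have "norm (M k) \<le> B * K" for k
  proof -
    have "B * (f \<bullet> (M k *v (v + x))) \<le> B * K" using K[of k] B(1) by (intro mult_left_mono) auto
    then show ?thesis using B(2)[OF aut[OF MG], of k] by linarith
  qed
  then have "range M \<subseteq> {g \<in> \<Gamma>. norm g \<le> B * K}" using MG by auto
  then have "finite (range M)" using finite_bounded finite_subset by blast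
  then obtain i where "infinite {k. M k = M i}" using pigeonhole_infinite[of UNIV M] by auto
  then have "\<not> {k. M k = M i} \<subseteq> {i}" using finite_subset by blast
  then obtain j where j: "M j = M i" "j \<noteq> i" by blast
  have rij: "r j \<noteq> r i" using j(2) strict_mono_eq[OF r(1)] by simp
  define N where "N = ginv (?H (r i)) ** ?H (r j)"
  have NA: "autC N" unfolding N_def using autC_mult autC_inv HA by blast
  have comm: "N ** g = g ** N"
  proof -
    have "N ** g = ginv (?H (r i)) ** (M j ** ?H (r j))"
      unfolding N_def M_def using inv_left[OF HA] by (simp add: matrix_mul_assoc[symmetric])
    also have "\<dots> = ginv (?H (r i)) ** (M i ** ?H (r j))" by (simp only: j)
    also have "\<dots> = g ** N"
      unfolding N_def M_def using inv_left[OF HA] by (simp add: matrix_mul_assoc)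
    finally show ?thesis .
  qed
  have Nv: "N *v v = (l ^ r j * (1 / l ^ r i)) *\<^sub>R v"
    using ginv_eigen[OF HA Hv, of "r i"] lm
    by (simp add: N_def matrix_vector_mul_assoc[symmetric] Hv matrix_vector_mult_scaleR del: matrix_vector_mul_assoc)
  have Nx: "N *v x = (m ^ r j * (1 / m ^ r i)) *\<^sub>R x"
    using ginv_eigen[OF HA Hx, of "r i"] lm
    by (simp add: N_def matrix_vector_mul_assoc[symmetric] Hx matrix_vector_mult_scaleR del: matrix_vector_mul_assoc)
  have ne: "l ^ r j * (1 / l ^ r i) \<noteq> m ^ r j * (1 / m ^ r i)"
  proof (cases "r i < r j")
    case True
    have "l ^ r i < l ^ r j" "m ^ r j < m ^ r i"
      using True lm by (auto intro: power_strict_increasing power_strict_decreasing)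
    moreover have "0 < l ^ r i" "0 < m ^ r i" using lm by auto
    ultimately have "l ^ r j * (1 / l ^ r i) > 1" "m ^ r j * (1 / m ^ r i) < 1" by simp_all
    then show ?thesis by linarith
  next
    case False
    then have "r j < r i" using rij by simp
    then have "l ^ r j < l ^ r i" "m ^ r i < m ^ r j"
      using lm by (auto intro: power_strict_increasing power_strict_decreasing)
    moreover have "0 < l ^ r i" "0 < m ^ r i" using lm by auto
    ultimately have "l ^ r j * (1 / l ^ r i) < 1" "m ^ r j * (1 / m ^ r i) > 1" by simp_all
    then show ?thesis by linarith
  qed
  have gvb: "act g v \<in> bdry" using act_bdry[OF ga v(1)] .
  have "N *v w = (l ^ r j * (1 / l ^ r i)) *\<^sub>R w"
  proof -
    have "N *v w = (N ** g) *v v" by (simp only: w_def matrix_vector_mul_assoc)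
    also have "\<dots> = g *v (N *v v)" by (simp only: comm matrix_vector_mul_assoc)
    finally show ?thesis by (simp add: Nv w_def matrix_vector_mult_scaleR)
  qed
  then have Nw: "N *v act g v = (l ^ r j * (1 / l ^ r i)) *\<^sub>R act g v"
    by (simp add: act_def matrix_vector_mult_scaleR flip: w_def)
  have "act g v \<noteq> x" using act_inj[OF ga vs] g(2) v(2) by metis
  show ?thesis
  proof (rule ccontr)
    assume "act g v \<noteq> v"
    then show False
      using eigenvalues_agree[OF NA gvb v(1) x _ \<open>act g v \<noteq> x\<close> Nw Nv Nx] ne by blast
  qed
qed

text \<open>A common fixed point \<open>x\<close> comes with a second one, \<open>v\<close>. A sequence
  attracting to a third boundary point would move at least one of them.\<close>

lemma no_global_fixed_point:
  assumes x: "x \<in> bdry" shows "\<exists>g\<in>\<Gamma>. act g x \<noteq> x"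
proof (rule ccontr)
  assume "\<not> ?thesis"
  then have fxd: "act g x = x" if "g \<in> \<Gamma>" for g using that by blast
  obtain h v l m where v: "h \<in> \<Gamma>" "v \<in> bdry" "v \<noteq> x" "h *v v = l *\<^sub>R v" "h *v x = m *\<^sub>R x" "l > 1" "0 < m" "m < 1"
    using hyperbolic_element[OF x fxd] by blast
  have fxv: "act g v = v" if "g \<in> \<Gamma>" for g
    by (rule commutes_with_hyperbolic[OF x v(2,3,1,4-8) that fxd[OF that]])
  obtain p where p: "p \<in> bdry" "p \<noteq> x" "p \<noteq> v" using exists_other_point[of "{v}" x] x by auto
  obtain q where q: "limit_pair p q" using every_point_limit p by blast
  obtain g s t c d where g: "\<And>k. g k \<in> \<Gamma>" "converges g s t c d p q" using limit_pairE[OF q] by blast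
  show False
  proof (cases "q = x")
    case True
    then have "v = p" using converges_fixed[OF g(2) bdryD(5)[OF v(2)]] v(3) fxv[OF g(1)] by blast
    then show False using p by simp
  next
    case False
    then have "x = p" using converges_fixed[OF g(2) bdryD(5)[OF x]] fxd[OF g(1)] by blast
    then show False using p by simp
  qed
qed

text \<open>A sequence attracting to \<open>x\<close> is composed with one repelling from
  \<open>y\<close>. Since the group has no fixed point, an element \<open>h\<close> inserted
  between them separates the repelling point of the first from the attracting point of the
  second.\<close>

lemma all_limit_pairs:
  assumes x: "x \<in> bdry" and y: "y \<in> bdry" shows "limit_pair x y"
proof -
  obtain q p where q: "limit_pair x q" and p: "limit_pair p y"
    using every_point_limit x y limit_pair_sym by metis
  have pb: "p \<in> bdry" using limit_pair_bdry[OF p] by simp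
  have "\<exists>h\<in>\<Gamma>. act h p \<noteq> q"
  proof (rule ccontr)
    assume n: "\<not> ?thesis"
    have "act (mat 1) p = p" using bdryD(3)[OF pb] by (simp add: act_def)
    then have "q = p" using n one_closed by metis
    then show False using n no_global_fixed_point[OF pb] by blast
  qed
  then obtain h where h: "h \<in> \<Gamma>" "q \<noteq> act h p" by metis
  obtain g s t c d where g: "\<And>k. g k \<in> \<Gamma>" "converges g s t c d x q" using limit_pairE[OF q] by blast
  obtain g' s' t' c' d' where g': "\<And>k. g' k \<in> \<Gamma>" "converges g' s' t' c' d' p y" using limit_pairE[OF p] by blast
  obtain c'' d'' where "converges (\<lambda>k. h ** g' k) s' t' c'' d'' (act h p) y"
    using converges_left[OF g'(2) aut[OF h(1)]] by blast
  from converges_mult[OF g(2) this h(2)] show ?thesis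
    by (rule limit_pairI[rotated]) (intro mult_closed g(1) h(1) g'(1))
qed

lemma four_cycle_identity:
  assumes "x \<in> bdry" "y \<in> bdry" "z \<in> bdry" "w \<in> bdry" "x \<noteq> y" "y \<noteq> z" "z \<noteq> w" "w \<noteq> x"
  shows "(tang y \<bullet> x) * (tang x \<bullet> w) * (tang w \<bullet> z) * (tang z \<bullet> y) =
         (tang x \<bullet> y) * (tang w \<bullet> x) * (tang z \<bullet> w) * (tang y \<bullet> z)"
proof -
  obtain g s t c d where g: "\<And>k. g k \<in> \<Gamma>" "converges g s t c d x y"
    using limit_pairE[OF all_limit_pairs[OF assms(1,2)]] by blast
  obtain g' s' t' c' d' where g': "\<And>k. g' k \<in> \<Gamma>" "converges g' s' t' c' d' z w"
    using limit_pairE[OF all_limit_pairs[OF assms(3,4)]] by blast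
  show ?thesis by (rule four_cycle[OF g(2) g'(2) assms(5-8)])
qed

text \<open>With a further boundary point \<open>w\<close>, the identities of the cycles \<open>x y z
  w\<close>, \<open>x z y w\<close> and \<open>y x z w\<close> combine to the square of the
  claim, and all factors are positive.\<close>

lemma triple_identity:
  assumes "x \<in> bdry" "y \<in> bdry" "z \<in> bdry" "x \<noteq> y" "y \<noteq> z" "z \<noteq> x"
  shows "(tang x \<bullet> y) * (tang y \<bullet> z) * (tang z \<bullet> x) = (tang y \<bullet> x) * (tang z \<bullet> y) * (tang x \<bullet> z)"
proof -
  obtain w where w: "w \<in> bdry" "w \<noteq> x" "w \<noteq> y" "w \<noteq> z"
    using exists_other_point[of "{y, z}" x] assms by auto
  define r where "r u v = (tang u \<bullet> v) / (tang v \<bullet> u)" for u v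
  have pos': "tang u \<bullet> v > 0" if "u \<in> bdry" "v \<in> bdry" "u \<noteq> v" for u v using tang_pos that by blast
  have cyc: "r x' y' * r y' z' * r z' w' * r w' x' = 1"
    if "x' \<in> bdry" "y' \<in> bdry" "z' \<in> bdry" "w' \<in> bdry" "x' \<noteq> y'" "y' \<noteq> z'" "z' \<noteq> w'" "w' \<noteq> x'" for x' y' z' w'
  proof -
    have p: "tang x' \<bullet> y' > 0" "tang y' \<bullet> x' > 0" "tang y' \<bullet> z' > 0" "tang z' \<bullet> y' > 0"
      "tang z' \<bullet> w' > 0" "tang w' \<bullet> z' > 0" "tang w' \<bullet> x' > 0" "tang x' \<bullet> w' > 0"
      using pos' that by metis+
    then show ?thesis using four_cycle_identity[OF that] by (simp add: r_def field_simps)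
  qed
  have rinv: "r u v * r v u = 1" "r u v > 0" if "u \<in> bdry" "v \<in> bdry" "u \<noteq> v" for u v
    using pos'[OF that] pos'[of v u] that by (auto simp: r_def)
  define a where "a = r x y * r y z * r z x"
  have A: "r x y * r y z * r z w * r w x = 1" by (rule cyc) (use assms w in auto)
  have B: "r x z * r z y * r y w * r w x = 1" by (rule cyc) (use assms w in auto)
  have D: "r y x * r x z * r z w * r w y = 1" by (rule cyc) (use assms w in auto)
  have i: "r x y * r y x = 1" "r y z * r z y = 1" "r z x * r x z = 1" "r y w * r w y = 1" "r x w * r w x = 1" "r z w * r w z = 1"
    using rinv(1) assms w by metis+
  have pp: "r x y > 0" "r y z > 0" "r z x > 0" "r y w > 0" "r w x > 0" "r z w > 0" "r w y > 0"
    using rinv(2) assms w by metis+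
  have j: "r y x = 1 / r x y" "r z y = 1 / r y z" "r x z = 1 / r z x" "r w y = 1 / r y w"
    using i pp by (auto simp: field_simps)
  have A': "r z w * r w x = 1 / (r x y * r y z)" using A pp by (simp add: field_simps)
  have B': "r y w * r w x = r z x * r y z" using B pp unfolding j by (simp add: field_simps)
  have D': "r z w = r x y * r z x * r y w" using D pp unfolding j by (simp add: field_simps)
  have "r x y * r z x * (r y w * r w x) = 1 / (r x y * r y z)"
    using A' unfolding D' by (simp add: mult_ac)
  then have "r x y * r z x * (r z x * r y z) = 1 / (r x y * r y z)" unfolding B' .
  then have "a\<^sup>2 = 1" using pp by (simp add: a_def power2_eq_square field_simps)
  moreover have "a > 0" using pp by (simp add: a_def)
  ultimately have "a = 1" by (simp add: power2_eq_1_iff)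
  moreover have "tang y \<bullet> x > 0" "tang z \<bullet> y > 0" "tang x \<bullet> z > 0" using pos' assms by metis+
  ultimately show ?thesis unfolding a_def r_def by (simp add: field_simps)
qed

end

section \<open>Cones with symmetric triple products\<close>

text \<open>Gram--Schmidt orthonormalization, started at the index \<open>k0\<close> with the prescribed
  vector \<open>o1\<close>.\<close>

lemma exists_orthonormal_family:
  fixes b :: "real^'m::finite \<Rightarrow> real^'m \<Rightarrow> real" and k0 :: 'm
  assumes bil: "bilinear b" and sym: "\<And>u v. b u v = b v u" and posdef: "\<And>v. v \<noteq> 0 \<Longrightarrow> b v v > 0"
    and o: "b o1 o1 = 1"
  shows "\<exists>e. e k0 = o1 \<and> (\<forall>i j. b (e i) (e j) = (if i = j then 1 else 0))"
proof -
  have add: "b (x + y) z = b x z + b y z" "b z (x + y) = b z x + b z y" for x y z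
    using bil by (simp_all add: bilinear_ladd bilinear_radd)
  have diff: "b (x - y) z = b x z - b y z" for x y z using bil by (simp add: bilinear_lsub)
  have scale: "b (c *\<^sub>R x) z = c * b x z" "b z (c *\<^sub>R x) = c * b z x" for c x z
    using bil by (simp_all add: bilinear_lmul bilinear_rmul)
  have lin: "linear (\<lambda>x. b x z)" for z using bil by (simp add: bilinear_def)
  have sumb: "b (\<Sum>i\<in>I. g i) z = (\<Sum>i\<in>I. b (g i) z)" for I and g :: "'m \<Rightarrow> _" and z
    by (rule linear_sum[OF lin])
  have "\<exists>e. e k0 = o1 \<and> (\<forall>i\<in>insert k0 J. \<forall>j\<in>insert k0 J. b (e i) (e j) = (if i = j then 1 else 0))"
    if "finite J" for J
    using that
  proof (induction J)
    case empty
    then show ?case using o by (intro exI[of _ "\<lambda>_. o1"]) simp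
  next
    case (insert k J)
    then obtain e where e: "e k0 = o1" "\<And>i j. i \<in> insert k0 J \<Longrightarrow> j \<in> insert k0 J \<Longrightarrow> b (e i) (e j) = (if i = j then 1 else 0)"
      by blast
    let ?I = "insert k0 J"
    show ?case
    proof (cases "k \<in> ?I")
      case True
      then have "insert k0 (insert k J) = ?I" by blast
      then show ?thesis using e by metis
    next
      case False
      have "dim (e ` ?I) \<le> card (e ` ?I)" using insert(1) by (intro dim_le_card') auto
      also have "\<dots> \<le> card ?I" using insert(1) by (intro card_image_le) auto
      also have "\<dots> < card (insert k ?I)" using False insert(1) by simp
      also have "\<dots> \<le> CARD('m)" by (intro card_mono) auto
      finally have "dim (e ` ?I) < DIM(real^'m)" by simp
      then have "span (e ` ?I) \<noteq> UNIV" by (metis dim_UNIV dim_span less_irrefl)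
      then obtain v where v: "v \<notin> span (e ` ?I)" by blast
      define w where "w = v - (\<Sum>i\<in>?I. b v (e i) *\<^sub>R e i)"
      have "(\<Sum>i\<in>?I. b v (e i) *\<^sub>R e i) \<in> span (e ` ?I)"
        by (intro span_sum span_scale span_base) auto
      then have wn: "w \<noteq> 0" using v by (auto simp: w_def)
      have wo: "b w (e j) = 0" if j: "j \<in> ?I" for j
      proof -
        have "b w (e j) = b v (e j) - (\<Sum>i\<in>?I. b v (e i) * b (e i) (e j))"
          by (simp only: w_def diff sumb scale)
        also have "(\<Sum>i\<in>?I. b v (e i) * b (e i) (e j)) = (\<Sum>i\<in>?I. if i = j then b v (e i) else 0)"
          using e(2)[OF _ j] by (intro sum.cong) auto
        also have "\<dots> = b v (e j)" using j insert(1) by (simp add: sum.delta)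
        finally show ?thesis by simp
      qed
      define u where "u = (1 / sqrt (b w w)) *\<^sub>R w"
      have uu: "b u u = 1" using posdef[OF wn] by (simp add: u_def scale)
      have ue: "b u (e j) = 0" "b (e j) u = 0" if "j \<in> ?I" for j
        using wo[OF that] sym[of "e j" u] by (simp_all add: u_def scale)
      have "k \<noteq> k0" using False by simp
      show ?thesis
      proof (rule exI[of _ "e(k := u)"], intro conjI ballI)
        show "(e(k := u)) k0 = o1" using \<open>k \<noteq> k0\<close> e(1) by simp
        fix i j assume "i \<in> insert k0 (insert k J)" "j \<in> insert k0 (insert k J)"
        then have "i = k \<or> i \<in> ?I" "j = k \<or> j \<in> ?I" by blast+
        then show "b ((e(k := u)) i) ((e(k := u)) j) = (if i = j then 1 else 0)"
          using e(2)[of i j] ue uu False by auto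
      qed
    qed
  qed
  from this[of UNIV] show ?thesis by auto
qed

context smooth_cone
begin

lemma base_between:
  assumes "CARD('m) \<ge> 2"
  shows "\<exists>x\<in>bdry. \<exists>y\<in>bdry. \<exists>s>0. \<exists>t>0. x \<noteq> y \<and> base = s *\<^sub>R x + t *\<^sub>R y"
proof -
  have "\<not> (\<forall>i j::'m. i = j)"
  proof
    assume a: "\<forall>i j::'m. i = j"
    then have "(UNIV::'m set) \<subseteq> {undefined}" by auto
    then have "CARD('m) \<le> card {undefined::'m}" by (intro card_mono) auto
    then show False using assms by simp
  qed
  then obtain i j :: 'm where ij: "i \<noteq> j" by blast
  define w where "w = (if f \<bullet> axis i 1 = 0 then axis i 1 else (f \<bullet> axis j 1) *\<^sub>R axis i 1 - (f \<bullet> axis i 1) *\<^sub>R axis j (1::real))"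
  have fw: "f \<bullet> w = 0" by (simp add: w_def inner_diff_right mult.commute)
  have "w \<noteq> 0"
  proof (cases "f \<bullet> axis i 1 = 0")
    case True
    then show ?thesis by (simp add: w_def axis_eq_0_iff)
  next
    case False
    then have "w $ j = - (f \<bullet> axis i 1)" using ij by (simp add: w_def axis_def)
    then show ?thesis using False by auto
  qed
  then have w: "w \<noteq> 0" "f \<bullet> w = 0" using fw by auto
  obtain r where r: "r > 0" "base + r *\<^sub>R w \<in> bdry" using chord[OF base_C f_base w] by blast
  obtain s where s: "s > 0" "base + s *\<^sub>R (- w) \<in> bdry" using chord[OF base_C f_base, of "-w"] w by auto
  define x where "x = base + r *\<^sub>R w"
  define y where "y = base + s *\<^sub>R (- w)"
  define a where "a = s / (r + s)"
  define b where "b = r / (r + s)"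
  have "x \<noteq> y"
  proof
    assume "x = y"
    then have "(r + s) *\<^sub>R w = 0" by (simp add: x_def y_def algebra_simps)
    then show False using r s w by simp
  qed
  moreover have "base = a *\<^sub>R x + b *\<^sub>R y"
  proof -
    have "a + b = 1" "a * r = b * s" using r s by (simp_all add: a_def b_def add_divide_distrib[symmetric])
    moreover have "a *\<^sub>R x + b *\<^sub>R y = (a + b) *\<^sub>R base + (a * r - b * s) *\<^sub>R w"
      by (simp add: x_def y_def algebra_simps)
    ultimately show ?thesis by simp
  qed
  moreover have "a > 0" "b > 0" using r s by (simp_all add: a_def b_def)
  moreover have "x \<in> bdry" "y \<in> bdry" using r s by (simp_all add: x_def y_def)
  ultimately show ?thesis by blast
qed

lemma span_bdry: assumes "CARD('m) \<ge> 2" shows "span bdry = UNIV"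
proof -
  obtain x y s t where xy: "x \<in> bdry" "y \<in> bdry" "base = s *\<^sub>R x + t *\<^sub>R y" using base_between[OF assms] by blast
  have b: "base \<in> span bdry" unfolding xy(3) using xy by (intro span_add span_scale span_base)
  have "v \<in> span bdry" for v
  proof -
    obtain r where r: "v + r *\<^sub>R base \<in> closure C" "v + r *\<^sub>R base \<notin> C" using exit_exists[OF base_C, of v] by blast
    have "v + r *\<^sub>R base \<in> span bdry"
    proof (cases "v + r *\<^sub>R base = 0")
      case False
      have "(f \<bullet> (v + r *\<^sub>R base)) *\<^sub>R ((1 / (f \<bullet> (v + r *\<^sub>R base))) *\<^sub>R (v + r *\<^sub>R base)) \<in> span bdry"
        by (intro span_scale span_base normalize_bdry r False)
      then show ?thesis using pos[OF r(1) False] by simp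
    qed (simp add: span_zero)
    then have "(v + r *\<^sub>R base) - r *\<^sub>R base \<in> span bdry" using b by (intro span_diff span_scale)
    then show ?thesis by simp
  qed
  then show ?thesis by blast
qed

definition triple_symmetric :: bool where
  "triple_symmetric \<longleftrightarrow> (\<forall>x\<in>bdry. \<forall>y\<in>bdry. \<forall>z\<in>bdry. x \<noteq> y \<longrightarrow> y \<noteq> z \<longrightarrow> z \<noteq> x \<longrightarrow>
    (tang x \<bullet> y) * (tang y \<bullet> z) * (tang z \<bullet> x) = (tang y \<bullet> x) * (tang z \<bullet> y) * (tang x \<bullet> z))"

text \<open>Rescaling the tangent functionals by \<open>h\<close>, chosen with respect to a fixed boundary
  point \<open>e\<close>, makes \<open>h x * (tang x \<bullet> y)\<close> symmetric in
  \<open>x\<close> and \<open>y\<close>: this is the triple identity for \<open>e\<close>,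
  \<open>x\<close> and \<open>y\<close>. The symmetry makes the linear extension from a basis of
  boundary points agree with \<open>h x *\<^sub>R tang x\<close> at all others.\<close>

lemma symmetric_form:
  assumes sym: triple_symmetric and card: "CARD('m) \<ge> 2"
  shows "\<exists>\<beta>. linear \<beta> \<and> (\<forall>u v. \<beta> u \<bullet> v = \<beta> v \<bullet> u) \<and> (\<forall>x\<in>bdry. \<exists>h>0. \<beta> x = h *\<^sub>R tang x)"
proof -
  obtain e where e: "e \<in> bdry" using base_between[OF card] by blast
  define h where "h x = (if x = e then 1 else (tang e \<bullet> x) / (tang x \<bullet> e))" for x
  have hp: "h x > 0" if "x \<in> bdry" for x using that e tang_pos by (auto simp: h_def)
  have hs: "h x * (tang x \<bullet> y) = h y * (tang y \<bullet> x)" if xy: "x \<in> bdry" "y \<in> bdry" for x y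
  proof -
    consider "x = y" | "x \<noteq> y" "x = e" | "x \<noteq> y" "y = e" | "x \<noteq> y" "x \<noteq> e" "y \<noteq> e" by blast
    then show ?thesis
    proof cases
      case 2
      have "tang y \<bullet> e > 0" using 2 xy e tang_pos by auto
      then show ?thesis using 2 by (simp add: h_def)
    next
      case 3
      have "tang x \<bullet> e > 0" using 3 xy e tang_pos by auto
      then show ?thesis using 3 by (simp add: h_def)
    next
      case 4
      have p: "tang x \<bullet> e > 0" "tang y \<bullet> e > 0" using 4 xy e tang_pos by auto
      have "(tang e \<bullet> x) * (tang x \<bullet> y) * (tang y \<bullet> e) = (tang x \<bullet> e) * (tang y \<bullet> x) * (tang e \<bullet> y)"
        using sym e xy 4 unfolding triple_symmetric_def by metis
      then show ?thesis using 4 p by (simp add: h_def field_simps)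
    qed simp
  qed
  obtain B where B: "B \<subseteq> bdry" "independent B" "bdry \<subseteq> span B"
    using maximal_independent_subset[of bdry] by blast
  have spB: "span B = UNIV" using B(3) span_bdry[OF card] span_minimal[OF B(3) subspace_span] by blast
  obtain \<beta> where \<beta>: "linear \<beta>" "\<And>x. x \<in> B \<Longrightarrow> \<beta> x = h x *\<^sub>R tang x"
    using linear_independent_extend[OF B(2), of "\<lambda>x. h x *\<^sub>R tang x"] by blast
  have eqB: "\<beta> v \<bullet> y = h y * (tang y \<bullet> v)" if y: "y \<in> B" for v y
  proof -
    have "linear (\<lambda>v. \<beta> v \<bullet> y)" "linear (\<lambda>v. h y * (tang y \<bullet> v))"
      using \<beta>(1) by (auto simp: linear_iff inner_add_left inner_add_right algebra_simps)
    moreover have "\<beta> x \<bullet> y = h y * (tang y \<bullet> x)" if "x \<in> B" for x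
      using hs[of x y] that y B(1) \<beta>(2) by auto
    moreover have "v \<in> span B" using spB by simp
    ultimately show ?thesis
      using linear_eq_on_span[of "\<lambda>v. \<beta> v \<bullet> y" "\<lambda>v. h y * (tang y \<bullet> v)" B v] by blast
  qed
  have \<beta>x: "\<beta> x = h x *\<^sub>R tang x" if x: "x \<in> bdry" for x
  proof -
    have "\<beta> x \<bullet> v = (h x *\<^sub>R tang x) \<bullet> v" for v
    proof -
      have "linear (\<lambda>v. \<beta> x \<bullet> v)" "linear (\<lambda>v. (h x *\<^sub>R tang x) \<bullet> v)"
        by (auto simp: linear_iff inner_add_right distrib_left)
      moreover have "\<beta> x \<bullet> y = (h x *\<^sub>R tang x) \<bullet> y" if "y \<in> B" for y
        using eqB[OF that, of x] hs[of x y] x that B(1) by auto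
      moreover have "v \<in> span B" using spB by simp
      ultimately show ?thesis
        using linear_eq_on_span[of "\<lambda>v. \<beta> x \<bullet> v" "\<lambda>v. (h x *\<^sub>R tang x) \<bullet> v" B v] by blast
    qed
    then show ?thesis by (metis vector_eq_rdot)
  qed
  have "\<beta> u \<bullet> v = \<beta> v \<bullet> u" for u v
  proof -
    have "linear (\<lambda>v. \<beta> u \<bullet> v)" "linear (\<lambda>v. \<beta> v \<bullet> u)"
      using \<beta>(1) by (auto simp: linear_iff inner_add_left inner_add_right)
    moreover have "\<beta> u \<bullet> y = \<beta> y \<bullet> u" if "y \<in> B" for y
      using eqB[OF that, of u] \<beta>(2)[OF that] by simp
    moreover have "v \<in> span B" using spB by simp
    ultimately show ?thesis
      using linear_eq_on_span[of "\<lambda>v. \<beta> u \<bullet> v" "\<lambda>v. \<beta> v \<bullet> u" B v] by blast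
  qed
  then show ?thesis using \<beta>(1) \<beta>x hp by blast
qed

text \<open>The quadratic form \<open>Q\<close> of \<open>symmetric_form\<close> vanishes on the boundary
  vectors. Along lines in the direction of an interior vector \<open>o1\<close> with \<open>Q o1
  = 1\<close> it is a quadratic polynomial of the parameter with a zero where the line leaves
  the cone; this determines the sign of \<open>Q\<close> and shows that the cone is given by
  \<open>Q v > 0\<close> and \<open>l v > 0\<close>, where \<open>l\<close> is the polar form of
  \<open>o1\<close>. It also shows that \<open>Q\<close> is negative definite on the kernel of
  \<open>l\<close>, so reversing its sign there yields a positive definite form
  \<open>b\<close>, and a \<open>b\<close>-orthonormal basis containing \<open>o1\<close>
  diagonalizes \<open>Q\<close>.\<close>

lemma lorentz_cone:
  assumes sym: triple_symmetric and card: "CARD('m) \<ge> 2"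
  shows "\<exists>T :: real^'m^'m. invertible T \<and>
     C = (*v) T ` {v. v $ k0 > 0 \<and> (\<Sum>i\<in>UNIV - {k0}. (v $ i)\<^sup>2) < (v $ k0)\<^sup>2}"
proof -
  obtain \<beta> where lin: "linear \<beta>" and \<beta>s: "\<And>u v. \<beta> u \<bullet> v = \<beta> v \<bullet> u"
     and \<beta>x: "\<And>x. x \<in> bdry \<Longrightarrow> \<exists>h>0. \<beta> x = h *\<^sub>R tang x" using symmetric_form[OF assms] by blast
  have \<beta>add: "\<beta> (u + v) = \<beta> u + \<beta> v" and \<beta>sc: "\<beta> (r *\<^sub>R u) = r *\<^sub>R \<beta> u" and \<beta>neg: "\<beta> (- u) = - \<beta> u" for u v r
    using lin by (simp_all add: linear_add linear_scale linear_neg)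
  define Q where "Q v = \<beta> v \<bullet> v" for v
  have Qx: "Q v = 0" if v: "v \<in> closure C" "v \<notin> C" for v
  proof (cases "v = 0")
    case False
    define u where "u = (1 / (f \<bullet> v)) *\<^sub>R v"
    have u: "u \<in> bdry" unfolding u_def by (rule normalize_bdry[OF v False])
    then obtain h where "\<beta> u = h *\<^sub>R tang u" using \<beta>x by blast
    then have "\<beta> u \<bullet> u = 0" using tang_self[OF u] by simp
    then show ?thesis using pos[OF v(1) False] by (simp add: u_def \<beta>sc Q_def)
  qed (simp add: Q_def)
  obtain x y s t where xy: "x \<in> bdry" "y \<in> bdry" "s > 0" "t > 0" "base = s *\<^sub>R x + t *\<^sub>R y"
    using base_between[OF card] by blast
  obtain hx hy where hxy: "hx > 0" "\<beta> x = hx *\<^sub>R tang x" "hy > 0" "\<beta> y = hy *\<^sub>R tang y"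
    using \<beta>x xy by metis
  have bb: "\<beta> base \<bullet> v = s * hx * (tang x \<bullet> v) + t * hy * (tang y \<bullet> v)" for v
    using hxy by (subst xy(5)) (simp add: \<beta>add \<beta>sc inner_add_left)
  have bcl: "\<beta> base \<bullet> v \<ge> 0" if "v \<in> closure C" for v
    unfolding bb using xy hxy tang_nonneg that by (intro add_nonneg_nonneg mult_nonneg_nonneg) auto
  have bC: "\<beta> base \<bullet> v > 0" if "v \<in> C" for v
    unfolding bb using xy hxy tang_pos_C that by (intro add_pos_pos mult_pos_pos) auto
  define N where "N = Q base"
  have N: "N > 0" using bC[OF base_C] by (simp add: N_def Q_def)
  define o1 where "o1 = (1 / sqrt N) *\<^sub>R base"
  have o1C: "o1 \<in> C" unfolding o1_def using N by (intro cone_C base_C) simp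
  define l where "l v = \<beta> o1 \<bullet> v" for v
  have lcl: "v \<in> closure C \<Longrightarrow> l v \<ge> 0" and lC: "v \<in> C \<Longrightarrow> l v > 0" for v
    using bcl[of v] bC[of v] N by (simp_all add: l_def o1_def \<beta>sc)
  have "l o1 = N / (sqrt N * sqrt N)" by (simp add: l_def o1_def \<beta>sc N_def Q_def)
  then have lo: "l o1 = 1" using N by simp
  have ladd: "l (u + v) = l u + l v" and lsc: "l (r *\<^sub>R u) = r * l u" for u v r
    by (simp_all add: l_def inner_add_right)
  have Qexp: "Q (v + r *\<^sub>R o1) = Q v + 2 * r * l v + r\<^sup>2" for v r
  proof -
    have "Q (v + r *\<^sub>R o1) = \<beta> v \<bullet> v + r * (\<beta> v \<bullet> o1) + r * (\<beta> o1 \<bullet> v) + r * (r * (\<beta> o1 \<bullet> o1))"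
      by (simp add: Q_def \<beta>add \<beta>sc inner_add_left inner_add_right algebra_simps)
    also have "\<dots> = Q v + 2 * r * l v + r\<^sup>2"
      using \<beta>s[of v o1] lo by (simp add: Q_def l_def power2_eq_square)
    finally show ?thesis .
  qed
  have C_iff: "v \<in> C \<longleftrightarrow> l v > 0 \<and> Q v > 0" for v
  proof -
    obtain r where r: "v + r *\<^sub>R o1 \<in> closure C" "v + r *\<^sub>R o1 \<notin> C" "\<And>s. s > r \<Longrightarrow> v + s *\<^sub>R o1 \<in> C"
      using exit_exists[OF o1C, of v] by blast
    have q: "Q v = - 2 * r * l v - r\<^sup>2" using Qx[OF r(1,2)] Qexp[of v r] by simp
    have ll: "l v \<ge> - r" using lcl[OF r(1)] by (simp add: ladd lsc lo)
    show ?thesis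
    proof
      assume v: "v \<in> C"
      have "r < 0"
      proof (rule ccontr)
        assume "\<not> r < 0"
        then have "v + r *\<^sub>R o1 \<in> C"
          using v add_C[OF v cone_C[OF o1C, of r]] by (cases "r = 0") auto
        then show False using r by blast
      qed
      have "(- r) * (- r) \<le> (- r) * l v" using ll \<open>r < 0\<close> by (intro mult_left_mono) auto
      moreover have "r\<^sup>2 > 0" using \<open>r < 0\<close> by simp
      ultimately have "Q v > 0" unfolding q by (simp add: power2_eq_square)
      then show "l v > 0 \<and> Q v > 0" using lC[OF v] by blast
    next
      assume v: "l v > 0 \<and> Q v > 0"
      show "v \<in> C"
      proof (rule ccontr)
        assume "v \<notin> C"
        then have "r \<ge> 0" using r(3)[of 0] by force
        then have "r * l v \<ge> 0" using v by simp
        then have "Q v \<le> 0" unfolding q using zero_le_power2[of r] by (simp only: mult.assoc)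
        then show False using v by simp
      qed
    qed
  qed
  define b where "b u v = 2 * (l u * l v) - \<beta> u \<bullet> v" for u v
  have bil: "bilinear b"
    unfolding bilinear_def linear_iff b_def
    by (auto simp: ladd lsc \<beta>add \<beta>sc inner_add_left inner_add_right algebra_simps)
  have bsym: "b u v = b v u" for u v by (simp add: b_def \<beta>s[of u v] mult.commute)
  have neg: "Q w < 0" if w: "w \<noteq> 0" "l w = 0" for w
  proof -
    have r0: "\<exists>r. u + r *\<^sub>R o1 \<in> closure C \<and> Q u = - r\<^sup>2" if "l u = 0" for u
    proof -
      obtain r where r: "u + r *\<^sub>R o1 \<in> closure C" "u + r *\<^sub>R o1 \<notin> C" using exit_exists[OF o1C, of u] by blast
      then show ?thesis using Qx[OF r] Qexp[of u r] that by (intro exI[of _ r]) simp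
    qed
    obtain r where r: "w + r *\<^sub>R o1 \<in> closure C" "Q w = - r\<^sup>2" using r0 w by blast
    have "l (- w) = 0" using lsc[of "-1" w] w by simp
    then obtain r' where r': "- w + r' *\<^sub>R o1 \<in> closure C" "Q (- w) = - r'\<^sup>2" using r0 by blast
    show ?thesis
    proof (rule ccontr)
      assume "\<not> Q w < 0"
      then have "r\<^sup>2 = 0" using r(2) zero_le_power2[of r] by linarith
      moreover have "Q (- w) = Q w" by (simp add: Q_def \<beta>neg)
      ultimately have "r'\<^sup>2 = 0" using r' r by simp
      then have "w \<in> closure C" "- w \<in> closure C" using r r' \<open>r\<^sup>2 = 0\<close> by auto
      then show False using pointed w by blast
    qed
  qed
  have posdef: "b v v > 0" if v: "v \<noteq> 0" for v
  proof -
    define w where "w = v + (- l v) *\<^sub>R o1"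
    have lw: "l w = 0" unfolding w_def by (simp only: ladd lsc lo)
    have vw: "v = w + (l v) *\<^sub>R o1" by (simp add: w_def)
    have "Q v = Q w + (l v)\<^sup>2" using Qexp[of w "l v"] lw vw by simp
    then have bv: "b v v = (l v)\<^sup>2 - Q w" by (simp add: b_def Q_def[symmetric] power2_eq_square)
    show ?thesis
    proof (cases "w = 0")
      case True
      then have "l v \<noteq> 0" using vw v by auto
      then show ?thesis using True by (simp add: bv Q_def)
    next
      case False
      then show ?thesis using neg[OF False lw] zero_le_power2[of "l v"] unfolding bv by linarith
    qed
  qed
  have bo: "b o1 v = l v" for v by (simp add: b_def lo) (simp add: l_def)
  obtain e where e: "e k0 = o1" "\<And>i j. b (e i) (e j) = (if i = j then 1 else 0)"
    using exists_orthonormal_family[OF bil bsym posdef, of o1 k0] bo lo by auto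
  define T :: "real^'m^'m" where "T = (\<chi> i j. e j $ i)"
  have T: "T *v v = (\<Sum>j\<in>UNIV. v $ j *\<^sub>R e j)" for v
    by (simp add: T_def matrix_vector_mult_def vec_eq_iff mult.commute)
  have bT: "b (T *v v) (e i) = v $ i" for v i
  proof -
    have lin1: "linear (\<lambda>x. b x (e i))" using bil by (simp add: bilinear_def)
    have "b (T *v v) (e i) = (\<Sum>j\<in>UNIV. v $ j * b (e j) (e i))"
      unfolding T linear_sum[OF lin1] using bil by (simp add: bilinear_lmul)
    also have "\<dots> = (\<Sum>j\<in>UNIV. if j = i then v $ j else 0)" using e(2) by (intro sum.cong) auto
    finally show ?thesis by simp
  qed
  have bTT: "b (T *v v) (T *v v) = (\<Sum>i\<in>UNIV. (v $ i)\<^sup>2)" for v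
  proof -
    have lin2: "linear (\<lambda>x. b (T *v v) x)" using bil by (simp add: bilinear_def)
    have "b (T *v v) (T *v v) = (\<Sum>i\<in>UNIV. v $ i * b (T *v v) (e i))"
      by (subst (2) T) (simp add: linear_sum[OF lin2] bilinear_rmul[OF bil])
    then show ?thesis by (simp add: bT power2_eq_square)
  qed
  have "inj ((*v) T)"
  proof (rule injI)
    fix u v assume "T *v u = T *v v"
    then have "u $ i = v $ i" for i using bT[of u i] bT[of v i] by simp
    then show "u = v" by (simp add: vec_eq_iff)
  qed
  then have inv: "invertible T"
    by (simp add: invertible_left_inverse matrix_left_invertible_injective)
  have lT: "l (T *v v) = v $ k0" for v using bo[of "T *v v"] bsym[of o1] bT[of v k0] e(1) by simp
  have QT: "Q (T *v v) = (v $ k0)\<^sup>2 - (\<Sum>i\<in>UNIV - {k0}. (v $ i)\<^sup>2)" for v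
  proof -
    have "Q (T *v v) = 2 * (v $ k0)\<^sup>2 - (\<Sum>i\<in>UNIV. (v $ i)\<^sup>2)"
      using bTT[of v] by (simp add: b_def lT Q_def power2_eq_square)
    also have "(\<Sum>i\<in>UNIV. (v $ i)\<^sup>2) = (v $ k0)\<^sup>2 + (\<Sum>i\<in>UNIV - {k0}. (v $ i)\<^sup>2)"
      by (rule sum.remove) auto
    finally show ?thesis by simp
  qed
  have "surj ((*v) T)" using inv by (simp add: invertible_right_inverse matrix_right_invertible_surjective)
  then have "C = (*v) T ` {v. T *v v \<in> C}" by (auto simp: surj_def image_iff)
  also have "{v. T *v v \<in> C} = {v. v $ k0 > 0 \<and> (\<Sum>i\<in>UNIV - {k0}. (v $ i)\<^sup>2) < (v $ k0)\<^sup>2}"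
    by (simp add: C_iff lT QT)
  finally show ?thesis using inv by blast
qed

end

section \<open>Busemann volume near the boundary\<close>

text \<open>The slab is contained in the image of a fixed ball under the linear map that contracts the
  normal direction by \<open>e\<close>.\<close>

lemma slab_measure:
  assumes R: "R > 0"
  shows "\<exists>K>0. \<forall>(n :: real^'n::finite) e. norm n = 1 \<longrightarrow> 0 < e \<longrightarrow> emeasure lborel {v. norm v \<le> R \<and> \<bar>n \<bullet> v\<bar> \<le> e} \<le> ennreal (K * e)"
proof -
  define K where "K = measure lebesgue (cball (0::real^'n) (2 * R + 2))"
  have K: "K > 0" unfolding K_def using content_cball_pos[of "2 * R + 2" "0::real^'n"] R by simp
  have "emeasure lborel {v. norm v \<le> R \<and> \<bar>n \<bullet> v\<bar> \<le> e} \<le> ennreal (K * e)"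
    if n: "norm n = 1" and e: "0 < e" for n :: "real^'n" and e
  proof -
    define S where "S = mat 1 + outer ((e - 1) *\<^sub>R n) n"
    have nn: "n \<bullet> n = 1" using n by (simp add: norm_eq_1)
    have detS: "det S = e" using nn by (simp add: S_def det_rank_one_update)
    have Sv: "S *v v = v + ((e - 1) * (n \<bullet> v)) *\<^sub>R n" for v
      by (simp add: S_def matrix_vector_mult_add_rdistrib mult.commute)
    have sub: "{v. norm v \<le> R \<and> \<bar>n \<bullet> v\<bar> \<le> e} \<subseteq> (*v) S ` cball 0 (2 * R + 2)"
    proof
      fix v assume "v \<in> {v. norm v \<le> R \<and> \<bar>n \<bullet> v\<bar> \<le> e}"
      then have v: "norm v \<le> R" "\<bar>n \<bullet> v\<bar> \<le> e" by auto
      define u where "u = v + ((1 / e - 1) * (n \<bullet> v)) *\<^sub>R n"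
      have nu: "n \<bullet> u = (n \<bullet> v) / e" using nn e by (simp add: u_def inner_add_right field_simps)
      have "S *v u = u + ((e - 1) * ((n \<bullet> v) / e)) *\<^sub>R n" by (simp add: Sv nu)
      also have "\<dots> = v + ((1 / e - 1) * (n \<bullet> v) + (e - 1) * ((n \<bullet> v) / e)) *\<^sub>R n"
        by (simp add: u_def scaleR_add_left)
      also have "(1 / e - 1) * (n \<bullet> v) + (e - 1) * ((n \<bullet> v) / e) = 0" using e by (simp add: field_simps)
      finally have "v = S *v u" by simp
      moreover have "norm u \<le> 2 * R + 2"
      proof -
        have "\<bar>n \<bullet> v\<bar> \<le> R" using Cauchy_Schwarz_ineq2[of n v] n v by simp
        moreover have "\<bar>(n \<bullet> v) / e\<bar> \<le> 1" using v e by simp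
        moreover have "(1 / e - 1) * (n \<bullet> v) = (n \<bullet> v) / e - n \<bullet> v" by (simp add: left_diff_distrib)
        ultimately have "\<bar>(1 / e - 1) * (n \<bullet> v)\<bar> \<le> 1 + R" by linarith
        then have "norm (((1 / e - 1) * (n \<bullet> v)) *\<^sub>R n) \<le> 1 + R" using n by simp
        then have "norm u \<le> R + (1 + R)" unfolding u_def using v(1) by (intro norm_triangle_le add_mono)
        then show ?thesis by simp
      qed
      ultimately show "v \<in> (*v) S ` cball 0 (2 * R + 2)" by auto
    qed
    have im: "measure lebesgue ((*v) S ` cball 0 (2 * R + 2)) = e * K"
      using measure_matrix_image[of "cball 0 (2 * R + 2)" S] e by (simp add: detS K_def)
    have cS: "compact ((*v) S ` cball 0 (2 * R + 2))"
      by (intro compact_continuous_image matrix_vector_mult_linear_continuous_on compact_cball)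
    have "emeasure lborel {v. norm v \<le> R \<and> \<bar>n \<bullet> v\<bar> \<le> e} \<le> emeasure lborel ((*v) S ` cball 0 (2 * R + 2))"
      using sub compact_imp_closed[OF cS] by (intro emeasure_mono) (auto intro: borel_closed)
    also have "\<dots> = ennreal (measure lebesgue ((*v) S ` cball 0 (2 * R + 2)))"
      using emeasure_eq_ennreal_measure[of lborel] emeasure_compact_finite[OF cS]
        borel_closed[OF compact_imp_closed[OF cS]] by (simp add: measure_def less_top)
    finally show ?thesis unfolding im by (simp only: mult.commute)
  qed
  then show ?thesis using K by blast
qed

text \<open>By convexity the ray meets the frontier in one point only, so the description in
  \<open>exit_point\<close> denotes it.\<close>

lemma exit_point_in:
  fixes D :: "(real^'n::finite) set"
  assumes D: "open D" "convex D" "bounded D" and x: "x \<in> D" and v: "v \<noteq> 0"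
  shows "\<exists>t>0. exit_point D x v = x + t *\<^sub>R v \<and> (\<forall>s. 0 \<le> s \<longrightarrow> s < t \<longrightarrow> x + s *\<^sub>R v \<in> D)"
proof -
  have int: "x \<in> interior D" using D x by (simp add: interior_open)
  obtain t where t: "0 < t" "x + t *\<^sub>R v \<in> frontier D" "\<And>e. 0 \<le> e \<Longrightarrow> e < t \<Longrightarrow> x + e *\<^sub>R v \<in> interior D"
    using ray_to_frontier[OF D(3) int v] by metis
  have inD: "x + s *\<^sub>R v \<in> D" if "0 \<le> s" "s < t" for s using t(3)[OF that] interior_subset by blast
  have "exit_point D x v = x + t *\<^sub>R v"
    unfolding exit_point_def
  proof (rule the_equality)
    show "x + t *\<^sub>R v \<in> frontier D \<and> (\<exists>s\<ge>0. x + t *\<^sub>R v = x + s *\<^sub>R v)" using t by (intro conjI exI[of _ t]) auto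
  next
    fix y assume "y \<in> frontier D \<and> (\<exists>s\<ge>0. y = x + s *\<^sub>R v)"
    then obtain s where s: "y \<in> frontier D" "s \<ge> 0" "y = x + s *\<^sub>R v" by blast
    have "s \<ge> t"
    proof (rule ccontr)
      assume "\<not> s \<ge> t"
      then have "y \<in> interior D" using t(3) s by auto
      then show False using s by (simp add: frontier_def)
    qed
    moreover have "\<not> s > t"
    proof
      assume st: "s > t"
      have "y \<in> closure D" using s by (simp add: frontier_def)
      then have "y - (1 - t / s) *\<^sub>R (y - x) \<in> interior D"
        using st t(1) by (intro mem_interior_closure_convex_shrink[OF D(2) int]) auto
      moreover have "y - (1 - t / s) *\<^sub>R (y - x) = x + t *\<^sub>R v"
      proof -
        have "s - (1 - t / s) * s = t" using st t(1) by (simp add: field_simps)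
        moreover have "y - (1 - t / s) *\<^sub>R (y - x) = x + (s - (1 - t / s) * s) *\<^sub>R v"
          unfolding s(3) by (simp add: scaleR_left_diff_distrib)
        ultimately show ?thesis by simp
      qed
      ultimately show False using t(2) by (simp add: frontier_def)
    qed
    ultimately have "s = t" by simp
    then show "y = x + t *\<^sub>R v" using s by simp
  qed
  then show ?thesis using t(1) inD by blast
qed

text \<open>Each of the two summands of the norm is less than 1, so half of \<open>v\<close> does not
  reach the exit points.\<close>

lemma finsler_ball_subset:
  fixes D :: "(real^'n::finite) set"
  assumes D: "open D" "convex D" "bounded D" and x: "x \<in> D" and F: "finsler_norm D x v < 1"
  shows "x + (1/2) *\<^sub>R v \<in> D" "x - (1/2) *\<^sub>R v \<in> D"
proof -
  have *: "x + (1/2) *\<^sub>R w \<in> D" if w: "w \<noteq> 0" "norm w / 2 * (1 / dist x (exit_point D x w)) < 1" for w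
  proof -
    obtain t where t: "t > 0" "exit_point D x w = x + t *\<^sub>R w" "\<And>s. 0 \<le> s \<Longrightarrow> s < t \<Longrightarrow> x + s *\<^sub>R w \<in> D"
      using exit_point_in[OF D x w(1)] by blast
    have "1 / (2 * t) < 1" using w t(1) by (simp add: t(2) dist_norm)
    then have "1/2 < t" using t(1) by (simp add: field_simps)
    then show ?thesis using t(3)[of "1/2"] by simp
  qed
  have "x + (1/2) *\<^sub>R v \<in> D \<and> x + (1/2) *\<^sub>R (- v) \<in> D"
  proof (cases "v = 0")
    case False
    have nn: "norm v / 2 * (1 / dist x (exit_point D x w)) \<ge> 0" for w by simp
    have "norm v / 2 * (1 / dist x (exit_point D x (- v))) + norm v / 2 * (1 / dist x (exit_point D x v)) < 1"
      using F by (simp only: finsler_norm_def distrib_left)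
    then have "norm v / 2 * (1 / dist x (exit_point D x v)) < 1" "norm v / 2 * (1 / dist x (exit_point D x (- v))) < 1"
      using nn[of v] nn[of "-v"] by linarith+
    then show ?thesis using False by (intro conjI *) auto
  qed (use x in simp)
  then show "x + (1/2) *\<^sub>R v \<in> D" "x - (1/2) *\<^sub>R v \<in> D" by auto
qed

lemma ennreal_divide_lower_bound:
  assumes "M \<le> ennreal c" "V > 0" "c > 0" shows "ennreal (V / c) \<le> ennreal V / M"
proof (cases M)
  case (real m)
  show ?thesis
  proof (cases "m = 0")
    case True
    then show ?thesis using real assms by (simp add: divide_ennreal_def ennreal_mult_top)
  next
    case False
    then have "m > 0" "m \<le> c" using real assms by auto
    then show ?thesis using assms by (simp add: real divide_ennreal ennreal_leI divide_left_mono)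
  qed
next
  case top
  then show ?thesis using assms by (simp add: top_unique)
qed

text \<open>Moving \<open>x\<close> by \<open>e *\<^sub>R u\<close> leaves the domain, and a hyperplane
  through the resulting point does not meet the domain. By \<open>finsler_ball_subset\<close>
  the unit ball of the norm at \<open>x\<close> lies in a slab parallel to this hyperplane, of
  width proportional to \<open>e\<close>.\<close>

lemma density_lower_bound:
  fixes D :: "(real^'n::finite) set"
  assumes D: "open D" "convex D" "bounded D" and u: "u \<noteq> 0"
  shows "\<exists>k>0. \<forall>x e. x \<in> D \<longrightarrow> e > 0 \<longrightarrow> x + e *\<^sub>R u \<notin> D \<longrightarrow> busemann_density D x \<ge> ennreal (k / e)"
proof -
  obtain R0 where R0: "\<And>x. x \<in> D \<Longrightarrow> norm x \<le> R0" using D(3) bounded_iff by metis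
  define R where "R = 4 * (\<bar>R0\<bar> + 1)"
  have R: "R > 0" by (simp add: R_def add_nonneg_pos)
  define V where "V = measure lebesgue (ball (0::real^'n) 1)"
  have V: "V > 0" unfolding V_def using content_ball_pos[of 1 "0::real^'n"] by simp
  have eV: "emeasure lborel (ball (0::real^'n) 1) = ennreal V"
    using emeasure_eq_ennreal_measure[of lborel "ball (0::real^'n) 1"] emeasure_lborel_ball_finite[of "0::real^'n" 1]
    by (simp add: V_def measure_def less_top)
  obtain K where K: "K > 0" "\<And>(n::real^'n) e. norm n = 1 \<Longrightarrow> 0 < e \<Longrightarrow>
      emeasure lborel {v. norm v \<le> R \<and> \<bar>n \<bullet> v\<bar> \<le> e} \<le> ennreal (K * e)"
    using slab_measure[OF R, where 'n = 'n] by blast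
  have un: "norm u > 0" using u by simp
  define k where "k = V / (K * (2 * norm u))"
  have k: "k > 0" using V K un by (simp add: k_def)
  have "busemann_density D x \<ge> ennreal (k / e)" if x: "x \<in> D" and e: "e > 0" and q: "x + e *\<^sub>R u \<notin> D" for x e
  proof -
    have "D \<noteq> {}" using x by blast
    then have "\<exists>a b. a \<noteq> 0 \<and> (\<forall>z\<in>D. a \<bullet> z \<le> b) \<and> (\<forall>z\<in>{x + e *\<^sub>R u}. a \<bullet> z \<ge> b)"
      using separating_hyperplane_sets[OF D(2) convex_singleton[of "x + e *\<^sub>R u"]] q by blast
    then obtain a b where a: "a \<noteq> 0" "\<And>z. z \<in> D \<Longrightarrow> a \<bullet> z \<le> b" "a \<bullet> (x + e *\<^sub>R u) \<ge> b" by blast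
    define n where "n = (1 / norm a) *\<^sub>R a"
    have n: "norm n = 1" using a by (simp add: n_def)
    have nz: "n \<bullet> z \<le> n \<bullet> x + e * norm u" if "z \<in> D" for z
    proof -
      have "a \<bullet> z \<le> a \<bullet> (x + e *\<^sub>R u)" using a that by (meson order_trans)
      then have "n \<bullet> z \<le> n \<bullet> (x + e *\<^sub>R u)" using a(1) by (simp add: n_def divide_right_mono)
      also have "\<dots> = n \<bullet> x + e * (n \<bullet> u)" by (simp add: inner_add_right)
      also have "\<dots> \<le> n \<bullet> x + e * (norm n * norm u)"
        using e norm_cauchy_schwarz[of n u] by (intro add_left_mono mult_left_mono) auto
      finally show ?thesis by (simp add: n)
    qed
    have "{v. finsler_norm D x v < 1} \<subseteq> {v. norm v \<le> R \<and> \<bar>n \<bullet> v\<bar> \<le> 2 * norm u * e}"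
    proof
      fix v assume "v \<in> {v. finsler_norm D x v < 1}"
      then have v: "x + (1/2) *\<^sub>R v \<in> D" "x - (1/2) *\<^sub>R v \<in> D"
        using finsler_ball_subset[OF D x] by auto
      have "v = (x + (1/2) *\<^sub>R v) - (x - (1/2) *\<^sub>R v)" by (simp add: scaleR_add_left[symmetric])
      then have "norm v \<le> norm (x + (1/2) *\<^sub>R v) + norm (x - (1/2) *\<^sub>R v)" by (metis norm_triangle_ineq4)
      then have "norm v \<le> R" using R0[OF v(1)] R0[OF v(2)] by (simp add: R_def)
      moreover have "\<bar>n \<bullet> v\<bar> \<le> 2 * norm u * e"
        using nz[OF v(1)] nz[OF v(2)] by (simp add: inner_add_right inner_diff_right abs_le_iff field_simps)
      ultimately show "v \<in> {v. norm v \<le> R \<and> \<bar>n \<bullet> v\<bar> \<le> 2 * norm u * e}" by simp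
    qed
    moreover have "closed {v. norm v \<le> R \<and> \<bar>n \<bullet> v\<bar> \<le> 2 * norm u * e}"
      by (intro closed_Collect_conj closed_Collect_le continuous_intros)
    ultimately have "emeasure lborel {v. finsler_norm D x v < 1} \<le>
        emeasure lborel {v. norm v \<le> R \<and> \<bar>n \<bullet> v\<bar> \<le> 2 * norm u * e}"
      by (intro emeasure_mono) (auto intro: borel_closed)
    also have "\<dots> \<le> ennreal (K * (2 * norm u * e))" using K(2)[OF n] un e by simp
    finally have le: "emeasure lborel {v. finsler_norm D x v < 1} \<le> ennreal (K * (2 * norm u * e))" .
    have "ennreal (k / e) = ennreal (V / (K * (2 * norm u * e)))" by (simp add: k_def mult.assoc)
    also have "\<dots> \<le> ennreal V / emeasure lborel {v. finsler_norm D x v < 1}"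
      using V K un e by (intro ennreal_divide_lower_bound le) auto
    finally show ?thesis by (simp add: busemann_density_def eV)
  qed
  then show ?thesis using k by blast
qed

text \<open>In a thin tube around the direction \<open>u\<close>, let \<open>E r\<close> consist of the
  points that leave the domain when moved by \<open>r *\<^sub>R u\<close>. Translation along the
  tube shows that \<open>E (2 * r)\<close> has twice the volume of \<open>E r\<close>, so the
  layer between them has volume proportional to \<open>r\<close>, while the density there is at
  least of the order of \<open>1 / r\<close>. The layers with \<open>r = a / 2\<^sup>j\<close>
  are disjoint, lie in \<open>U\<close> and contribute equal amounts.\<close>

lemma infinite_volume_near_boundary:
  fixes D :: "(real^'n::finite) set"
  assumes D: "open D" "convex D" "bounded D" and p: "p \<in> frontier D" and U: "open U" "p \<in> U"
  shows "(\<integral>\<^sup>+ x. busemann_density D x * indicator (D \<inter> U) x \<partial>lborel) = \<infinity>"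
proof -
  have intD: "interior D = D" using D by (simp add: interior_open)
  have "D \<noteq> {}" using p by auto
  then obtain z0 where z0: "z0 \<in> D" by blast
  have pcl: "p \<in> closure D" "p \<notin> D" using p intD by (auto simp: frontier_def)
  define u where "u = p - z0"
  have u: "u \<noteq> 0" using z0 pcl by (auto simp: u_def)
  have un: "norm u > 0" using u by simp
  have pz: "p = z0 + u" by (simp add: u_def)
  obtain \<rho> where \<rho>: "\<rho> > 0" "ball p \<rho> \<subseteq> U" using U openE by blast
  \<comment> \<open>Over a small ball around \<open>z0\<close>, the tube leaves the domain between the
    parameters \<open>1 - a\<close> and \<open>1 + a\<close>; the choice of \<open>a\<close> and
    of the radius \<open>\<eta>\<close> keeps this part of the tube in \<open>U\<close>.\<close>
  define a where "a = min (1/4) (\<rho> / (4 * norm u))"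
  have a: "0 < a" "a \<le> 1/4" "a * norm u \<le> \<rho> / 4"
    using \<rho> un by (auto simp: a_def min_def field_simps)
  have inner: "z0 + s *\<^sub>R u \<in> D" if "0 \<le> s" "s < 1" for s
  proof -
    have "p - (1 - s) *\<^sub>R (p - z0) \<in> interior D"
      using that pcl z0 intD by (intro mem_interior_closure_convex_shrink[OF D(2)]) auto
    moreover have "p - (1 - s) *\<^sub>R (p - z0) = z0 + s *\<^sub>R u" by (simp add: u_def algebra_simps)
    ultimately show ?thesis using intD by simp
  qed
  have outer: "z0 + s *\<^sub>R u \<notin> closure D" if "s > 1" for s
  proof
    assume "z0 + s *\<^sub>R u \<in> closure D"
    then have "(z0 + s *\<^sub>R u) - (1 - 1 / s) *\<^sub>R ((z0 + s *\<^sub>R u) - z0) \<in> interior D"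
      using that z0 intD by (intro mem_interior_closure_convex_shrink[OF D(2)]) auto
    moreover have "(z0 + s *\<^sub>R u) - (1 - 1 / s) *\<^sub>R ((z0 + s *\<^sub>R u) - z0) = p"
      using that by (simp add: pz algebra_simps)
    ultimately show False using pcl intD by simp
  qed
  have seg: "w + t *\<^sub>R u \<in> D" if "w + r *\<^sub>R u \<in> D" "w + s *\<^sub>R u \<in> D" "r \<le> t" "t \<le> s" for w r s t
  proof (cases "r = s")
    case False
    define c where "c = (t - r) / (s - r)"
    have c: "0 \<le> c" "c \<le> 1" "c * (s - r) = t - r" using that False by (auto simp: c_def field_simps)
    have "(1 - c) *\<^sub>R (w + r *\<^sub>R u) + c *\<^sub>R (w + s *\<^sub>R u) \<in> D"
      using D(2) that c by (intro convexD) auto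
    moreover have "(1 - c) *\<^sub>R (w + r *\<^sub>R u) + c *\<^sub>R (w + s *\<^sub>R u) = w + (r + c * (s - r)) *\<^sub>R u"
      by (simp add: algebra_simps)
    ultimately show ?thesis by (simp add: c(3))
  qed (use that in auto)
  obtain e1 where e1: "e1 > 0" "ball z0 e1 \<subseteq> D" using D(1) z0 openE by blast
  have "z0 + (1 - a) *\<^sub>R u \<in> D" using a by (intro inner) auto
  then obtain e2 where e2: "e2 > 0" "ball (z0 + (1 - a) *\<^sub>R u) e2 \<subseteq> D" using D(1) openE by blast
  have "z0 + (1 + a) *\<^sub>R u \<in> - closure D" using a outer[of "1 + a"] by simp
  then obtain e3 where e3: "e3 > 0" "ball (z0 + (1 + a) *\<^sub>R u) e3 \<subseteq> - closure D"
    using openE[of "- closure D"] by blast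
  define \<eta> where "\<eta> = min (min e1 e2) (min e3 (\<rho> / 4))"
  have \<eta>: "\<eta> > 0" "\<eta> \<le> e1" "\<eta> \<le> e2" "\<eta> \<le> e3" "\<eta> \<le> \<rho> / 4" using e1 e2 e3 \<rho> by (auto simp: \<eta>_def)
  have tube: "b \<in> D" "b + (1 - a) *\<^sub>R u \<in> D" "b + (1 + a) *\<^sub>R u \<notin> D" if "b \<in> ball z0 \<eta>" for b
  proof -
    show "b \<in> D" using that e1 \<eta> by (auto simp: subset_iff)
    have "b + s *\<^sub>R u \<in> ball (z0 + s *\<^sub>R u) \<eta>" for s using that by (simp add: dist_norm)
    then have "b + (1 - a) *\<^sub>R u \<in> ball (z0 + (1 - a) *\<^sub>R u) e2" "b + (1 + a) *\<^sub>R u \<in> ball (z0 + (1 + a) *\<^sub>R u) e3"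
      using \<eta> subset_ball by blast+
    then show "b + (1 - a) *\<^sub>R u \<in> D" "b + (1 + a) *\<^sub>R u \<notin> D" using e2 e3 closure_subset by blast+
  qed
  define M where "M = (\<Union>s. ball (z0 + s *\<^sub>R u) \<eta>)"
  have oM: "open M" unfolding M_def by (intro open_UN ballI open_ball)
  have M_iff: "z \<in> M \<longleftrightarrow> (\<exists>b\<in>ball z0 \<eta>. \<exists>s. z = b + s *\<^sub>R u)" for z
  proof
    assume "z \<in> M"
    then obtain s where "z \<in> ball (z0 + s *\<^sub>R u) \<eta>" by (auto simp: M_def)
    then have "z - s *\<^sub>R u \<in> ball z0 \<eta>" by (simp add: dist_norm algebra_simps)
    then show "\<exists>b\<in>ball z0 \<eta>. \<exists>s. z = b + s *\<^sub>R u" by (intro bexI[of _ "z - s *\<^sub>R u"] exI[of _ s]) auto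
  next
    assume "\<exists>b\<in>ball z0 \<eta>. \<exists>s. z = b + s *\<^sub>R u"
    then obtain b s where "b \<in> ball z0 \<eta>" "z = b + s *\<^sub>R u" by blast
    then have "z \<in> ball (z0 + s *\<^sub>R u) \<eta>" by (simp add: dist_norm)
    then show "z \<in> M" by (auto simp: M_def)
  qed
  have Mshift: "z + r *\<^sub>R u \<in> M" if zM: "z \<in> M" for z r
  proof -
    obtain b s where b: "b \<in> ball z0 \<eta>" and z: "z = b + s *\<^sub>R u" using zM unfolding M_iff by blast
    have "z + r *\<^sub>R u = b + (s + r) *\<^sub>R u" unfolding z by (simp add: scaleR_add_left add.assoc)
    then show ?thesis unfolding M_iff using b by blast
  qed
  define E where "E r = {z \<in> D \<inter> M. z + r *\<^sub>R u \<notin> D}" for r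
  have Eloc: "\<exists>b\<in>ball z0 \<eta>. \<exists>s. z = b + s *\<^sub>R u \<and> 1 - a - r < s \<and> s < 1 + a" if z: "z \<in> E r" "0 < r" for z r
  proof -
    have zE: "z \<in> D" "z \<in> M" "z + r *\<^sub>R u \<notin> D" using z by (simp_all add: E_def)
    obtain b s where b: "b \<in> ball z0 \<eta>" "z = b + s *\<^sub>R u" using zE(2) unfolding M_iff by blast
    have zD: "b + s *\<^sub>R u \<in> D" "b + (s + r) *\<^sub>R u \<notin> D"
      using zE(1,3) unfolding b(2) by (simp_all add: scaleR_add_left add.assoc)
    have b0: "b + 0 *\<^sub>R u \<in> D" using tube(1)[OF b(1)] by simp
    have "s < 1 + a"
    proof (rule ccontr)
      assume "\<not> s < 1 + a"
      then have "b + (1 + a) *\<^sub>R u \<in> D" using a by (intro seg[OF b0 zD(1)]) auto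
      then show False using tube(3)[OF b(1)] by blast
    qed
    moreover have "1 - a - r < s"
    proof (rule ccontr)
      assume n: "\<not> 1 - a - r < s"
      have "b + (s + r) *\<^sub>R u \<in> D"
      proof (cases "0 \<le> s + r")
        case True
        then show ?thesis using n by (intro seg[OF b0 tube(2)[OF b(1)]]) auto
      next
        case False
        then show ?thesis using z(2) by (intro seg[OF zD(1) b0]) auto
      qed
      then show False using zD by blast
    qed
    ultimately show ?thesis using b by blast
  qed
  have Esub: "E r \<subseteq> D \<inter> U" if r: "0 < r" "r \<le> a" for r
  proof
    fix z assume z: "z \<in> E r"
    obtain b s where b: "b \<in> ball z0 \<eta>" "z = b + s *\<^sub>R u" "1 - a - r < s" "s < 1 + a" using Eloc[OF z r(1)] by blast
    have "\<bar>s - 1\<bar> \<le> 2 * a" using b r by (simp add: abs_le_iff)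
    then have "norm ((s - 1) *\<^sub>R u) \<le> 2 * (a * norm u)" by (simp add: mult_right_mono mult.assoc[symmetric])
    moreover have "norm (b - z0) < \<eta>" using b by (simp add: dist_norm norm_minus_commute)
    moreover have "z - p = (b - z0) + (s - 1) *\<^sub>R u" by (simp add: b pz algebra_simps)
    then have "norm (z - p) \<le> norm (b - z0) + norm ((s - 1) *\<^sub>R u)" by (simp only: norm_triangle_ineq)
    ultimately have "norm (z - p) < \<rho>" using a \<eta> \<rho> by linarith
    then have "z \<in> ball p \<rho>" by (simp add: dist_norm norm_minus_commute)
    then show "z \<in> D \<inter> U" using \<rho> z by (auto simp: E_def)
  qed
  have Eborel: "E r \<in> sets borel" for r
  proof -
    have "E r = (D \<inter> M) \<inter> (\<lambda>z. z + r *\<^sub>R u) -` (- D)" by (auto simp: E_def)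
    moreover have "closed ((\<lambda>z. z + r *\<^sub>R u) -` (- D))"
      using D(1) by (intro closed_vimage continuous_intros) (simp add: closed_Compl)
    ultimately show ?thesis using D(1) oM by (metis borel_closed borel_open open_Int sets.Int)
  qed
  have Elm: "E r \<in> lmeasurable" for r
    using Eborel[of r] bounded_subset[OF D(3)] by (intro bounded_set_imp_lmeasurable) (auto simp: E_def)
  have double: "measure lebesgue (E (2 * r)) = 2 * measure lebesgue (E r)" if r: "0 < r" "2 * r \<le> a" for r
  proof -
    have shift: "z \<in> (+) (- (r *\<^sub>R u)) ` E r \<longleftrightarrow> z + r *\<^sub>R u \<in> E r" for z
      by (auto simp: image_iff algebra_simps intro: bexI[of _ "z + r *\<^sub>R u"])
    have mono: "E r \<subseteq> E (2 * r)"
    proof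
      fix z assume z: "z \<in> E r"
      have "z + (2 * r) *\<^sub>R u \<notin> D"
      proof
        assume "z + (2 * r) *\<^sub>R u \<in> D"
        then have "z + r *\<^sub>R u \<in> D" using seg[of z 0 "2 * r" r] z r by (auto simp: E_def)
        then show False using z by (simp add: E_def)
      qed
      then show "z \<in> E (2 * r)" using z by (simp add: E_def)
    qed
    have eq: "E (2 * r) = E r \<union> (+) (- (r *\<^sub>R u)) ` E r"
    proof (intro equalityI subsetI)
      fix z assume z: "z \<in> E (2 * r)"
      show "z \<in> E r \<union> (+) (- (r *\<^sub>R u)) ` E r"
      proof (cases "z + r *\<^sub>R u \<in> D")
        case True
        have eq2: "z + r *\<^sub>R u + r *\<^sub>R u = z + (2 * r) *\<^sub>R u"
          by (simp only: add.assoc scaleR_add_left[symmetric] mult_2)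
        have zE: "z \<in> D" "z \<in> M" "z + (2 * r) *\<^sub>R u \<notin> D" using z by (simp_all add: E_def)
        have "z + r *\<^sub>R u \<in> E r" unfolding E_def using True Mshift[OF zE(2), of r] zE(3)
          by (simp only: eq2 mem_Collect_eq Int_iff simp_thms)
        then show ?thesis using shift by blast
      qed (use z in \<open>auto simp: E_def\<close>)
    next
      fix z assume "z \<in> E r \<union> (+) (- (r *\<^sub>R u)) ` E r"
      then consider "z \<in> E r" | "z + r *\<^sub>R u \<in> E r" using shift by blast
      then show "z \<in> E (2 * r)"
      proof cases
        case 1 then show ?thesis using mono by blast
      next
        case 2
        obtain b s where b: "b \<in> ball z0 \<eta>" "z + r *\<^sub>R u = b + s *\<^sub>R u" "1 - a - r < s" "s < 1 + a" using Eloc[OF 2 r(1)] by blast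
        have zb: "z = b + (s - r) *\<^sub>R u" using b(2) by (simp add: algebra_simps)
        have b0: "b + 0 *\<^sub>R u \<in> D" using tube(1)[OF b(1)] by simp
        have bs: "b + s *\<^sub>R u \<in> D" using 2 by (simp add: E_def flip: b(2))
        have "z \<in> D" unfolding zb using r a b by (intro seg[OF b0 bs]) linarith+
        moreover have "z \<in> M" using Mshift[of "z + r *\<^sub>R u" "- r"] 2 by (simp add: E_def)
        moreover have "z + (2 * r) *\<^sub>R u = z + r *\<^sub>R u + r *\<^sub>R u" by (simp only: add.assoc scaleR_add_left[symmetric] mult_2)
        then have "z + (2 * r) *\<^sub>R u \<notin> D"
          using 2 unfolding E_def by (simp only: mem_Collect_eq simp_thms)
        ultimately show ?thesis by (simp add: E_def)
      qed
    qed
    have disj: "E r \<inter> (+) (- (r *\<^sub>R u)) ` E r = {}"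
      using shift by (auto simp: E_def)
    have lm2: "(+) (- (r *\<^sub>R u)) ` E r \<in> lmeasurable" by (rule measurable_translation[OF Elm])
    have "measure lebesgue (E (2 * r)) = measure lebesgue (E r) + measure lebesgue ((+) (- (r *\<^sub>R u)) ` E r)"
      unfolding eq
      using fmeasurableD2[OF Elm[of r]] fmeasurableD2[OF lm2]
      by (intro measure_Union fmeasurableD Elm lm2 disj) (simp_all add: infinity_ennreal_def)
    moreover have "measure lebesgue ((+) (- (r *\<^sub>R u)) ` E r) = measure lebesgue (E r)" by (rule measure_translation)
    ultimately show ?thesis by linarith
  qed
  define m where "m = measure lebesgue (E a)"
  have mpos: "m > 0"
  proof -
    define z where "z = z0 + (1 - a/2) *\<^sub>R u"
    define G where "G = D \<inter> M \<inter> (\<lambda>z. z + a *\<^sub>R u) -` (- closure D)"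
    have "open G" unfolding G_def
      using D(1) oM by (intro open_Int open_vimage continuous_intros) auto
    moreover have "z \<in> G"
    proof -
      have "z \<in> D" unfolding z_def using a by (intro inner) auto
      moreover have "z \<in> M" unfolding M_iff z_def using \<eta> by (intro bexI[of _ z0] exI[of _ "1 - a/2"]) auto
      moreover have "z + a *\<^sub>R u = z0 + (1 + a/2) *\<^sub>R u"
      proof -
        have "z + a *\<^sub>R u = z0 + ((1 - a/2) + a) *\<^sub>R u" by (simp only: z_def scaleR_add_left add.assoc)
        moreover have "(1 - a/2) + a = 1 + a/2" by simp
        ultimately show ?thesis by (simp only:)
      qed
      moreover have "z0 + (1 + a/2) *\<^sub>R u \<notin> closure D" using a by (intro outer) auto
      ultimately show ?thesis by (auto simp: G_def)
    qed
    ultimately obtain e where e: "e > 0" "ball z e \<subseteq> G" by (rule openE)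
    have "G \<subseteq> E a" using closure_subset by (auto simp: G_def E_def)
    then have "measure lebesgue (ball z e) \<le> m" unfolding m_def
      using e by (intro measure_mono_fmeasurable Elm) auto
    moreover have "measure lebesgue (ball z e) > 0" using content_ball_pos[OF e(1), of z] by simp
    ultimately show ?thesis by linarith
  qed
  have halves: "measure lebesgue (E (a / 2 ^ j)) = m / 2 ^ j" for j
  proof (induction j)
    case (Suc j)
    have "a / 2 ^ j \<le> a / 1" using a by (intro divide_left_mono) auto
    then have "measure lebesgue (E (2 * (a / 2 ^ Suc j))) = 2 * measure lebesgue (E (a / 2 ^ Suc j))"
      using a by (intro double) auto
    then show ?case using Suc by simp
  qed (simp add: m_def)
  define Y where "Y j = E (a / 2 ^ j) - E (a / 2 ^ Suc j)" for j
  have Emono: "E r \<subseteq> E r'" if "0 < r" "r \<le> r'" for r r'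
  proof
    fix z assume z: "z \<in> E r"
    have "z + r' *\<^sub>R u \<notin> D"
    proof
      assume "z + r' *\<^sub>R u \<in> D"
      then have "z + r *\<^sub>R u \<in> D" using seg[of z 0 r' r] z that by (auto simp: E_def)
      then show False using z by (simp add: E_def)
    qed
    then show "z \<in> E r'" using z by (simp add: E_def)
  qed
  have Emono2: "E (a / 2 ^ i) \<subseteq> E (a / 2 ^ j)" if "j \<le> i" for i j
    using a that by (intro Emono divide_left_mono power_increasing) auto
  have Ym: "measure lebesgue (Y j) = m / 2 ^ Suc j" for j
  proof -
    have "measure lebesgue (Y j) = measure lebesgue (E (a / 2 ^ j)) - measure lebesgue (E (a / 2 ^ Suc j))"
      unfolding Y_def using Emono2[of j "Suc j"] Elm
      by (intro measurable_measure_Diff) (auto simp: fmeasurableD)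
    then show ?thesis by (simp only: halves) (simp add: field_simps)
  qed
  have Ybor: "Y j \<in> sets borel" for j using Eborel by (auto simp: Y_def)
  have Yem: "emeasure lborel (Y j) = ennreal (m / 2 ^ Suc j)" for j
  proof -
    have "Y j \<in> lmeasurable" unfolding Y_def using Elm by (intro fmeasurable.Diff) auto
    then have "emeasure lebesgue (Y j) = ennreal (measure lebesgue (Y j))" by (rule emeasure_eq_measure2)
    then show ?thesis using Ybor[of j] by (simp add: Ym)
  qed
  have Ydisj: "Y i \<inter> Y j = {}" if "i < j" for i j
    using Emono2[of "Suc i" j] that by (auto simp: Y_def)
  obtain k where k: "k > 0" "\<And>x e. x \<in> D \<Longrightarrow> e > 0 \<Longrightarrow> x + e *\<^sub>R u \<notin> D \<Longrightarrow> busemann_density D x \<ge> ennreal (k / e)"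
    using density_lower_bound[OF D u] by blast
  let ?I = "\<integral>\<^sup>+ x. busemann_density D x * indicator (D \<inter> U) x \<partial>lborel"
  have lower: "ennreal (real J * (k * m / (2 * a))) \<le> ?I" for J
  proof -
    have pt: "(\<Sum>j<J. ennreal (k / (a / 2 ^ j)) * indicator (Y j) x) \<le> busemann_density D x * indicator (D \<inter> U) x" for x
    proof (cases "\<exists>j<J. x \<in> Y j")
      case True
      then obtain j where j: "j < J" "x \<in> Y j" by blast
      have "i = j" if "x \<in> Y i" for i
        using Ydisj[of i j] Ydisj[of j i] that j by (metis disjoint_iff linorder_neqE_nat)
      then have "x \<in> Y i \<longleftrightarrow> i = j" for i using j(2) by metis
      then have "indicator (Y i) x = (if i = j then 1 else 0 :: ennreal)" for i by (simp add: indicator_def)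
      then have "(\<Sum>i<J. ennreal (k / (a / 2 ^ i)) * indicator (Y i) x) = (\<Sum>i<J. if i = j then ennreal (k / (a / 2 ^ i)) else 0)"
        by (intro sum.cong) auto
      also have "\<dots> = ennreal (k / (a / 2 ^ j))" using j by simp
      also have "\<dots> \<le> busemann_density D x"
        using j(2) a by (intro k(2)) (auto simp: Y_def E_def)
      finally have "(\<Sum>i<J. ennreal (k / (a / 2 ^ i)) * indicator (Y i) x) \<le> busemann_density D x" .
      moreover have "a / 2 ^ j \<le> a / 1" using a by (intro divide_left_mono) auto
      then have "x \<in> D \<inter> U" using j(2) Esub[of "a / 2 ^ j"] a by (auto simp: Y_def)
      ultimately show ?thesis by simp
    next
      case False
      then have "(\<Sum>j<J. ennreal (k / (a / 2 ^ j)) * indicator (Y j) x) = 0" by (intro sum.neutral) auto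
      then show ?thesis by simp
    qed
    have "(\<integral>\<^sup>+ x. (\<Sum>j<J. ennreal (k / (a / 2 ^ j)) * indicator (Y j) x) \<partial>lborel) =
        (\<Sum>j<J. \<integral>\<^sup>+ x. ennreal (k / (a / 2 ^ j)) * indicator (Y j) x \<partial>lborel)"
      using Ybor by (intro nn_integral_sum) simp
    also have "\<dots> = (\<Sum>j<J. ennreal (k * m / (2 * a)))"
    proof (rule sum.cong)
      fix j
      have "(\<integral>\<^sup>+ x. ennreal (k / (a / 2 ^ j)) * indicator (Y j) x \<partial>lborel) = ennreal (k / (a / 2 ^ j)) * ennreal (m / 2 ^ Suc j)"
        using Ybor[of j] by (simp only: nn_integral_cmult_indicator sets_lborel Yem)
      also have "\<dots> = ennreal (k * m / (2 * a))"
        using k a mpos by (simp add: ennreal_mult[symmetric])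
      finally show "(\<integral>\<^sup>+ x. ennreal (k / (a / 2 ^ j)) * indicator (Y j) x \<partial>lborel) = ennreal (k * m / (2 * a))" .
    qed simp
    also have "\<dots> = ennreal (real J * (k * m / (2 * a)))"
    proof -
      have "k * m / (2 * a) \<ge> 0" using k a mpos by simp
      then show ?thesis by (simp only: sum_constant card_lessThan ennreal_of_nat_eq_real_of_nat ennreal_mult[OF of_nat_0_le_iff])
    qed
    finally have "ennreal (real J * (k * m / (2 * a))) = (\<integral>\<^sup>+ x. (\<Sum>j<J. ennreal (k / (a / 2 ^ j)) * indicator (Y j) x) \<partial>lborel)" by simp
    also have "\<dots> \<le> ?I" by (intro nn_integral_mono pt)
    finally show ?thesis .
  qed
  show ?thesis
  proof (rule ccontr)
    assume "?I \<noteq> \<infinity>"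
    then obtain r where r: "?I = ennreal r" "r \<ge> 0" by (metis ennreal_cases infinity_ennreal_def)
    have c: "k * m / (2 * a) > 0" using k mpos a by simp
    obtain J :: nat where J: "r / (k * m / (2 * a)) < real J" using reals_Archimedean2 by blast
    have "real J * (k * m / (2 * a)) \<le> r" using lower[of J] r c by simp
    moreover have "r < real J * (k * m / (2 * a))" using J by (simp only: pos_divide_less_eq[OF c])
    ultimately show False by linarith
  qed
qed

section \<open>The cone over a properly convex domain\<close>

lemma proj_ex: "\<exists>v. v \<noteq> 0 \<and> p = proj_of v"
proof -
  obtain v where v: "v \<noteq> 0" "line_of p = span {v}" using line_of[of p] by blast
  then have "p = proj_of v" by (metis line_of_inverse proj_of_def)
  then show ?thesis using v by blast
qed

lemma line_of_proj_of: "v \<noteq> 0 \<Longrightarrow> line_of (proj_of v) = span {v}"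
  unfolding proj_of_def by (rule Abs_proj_inverse) blast

lemma span_scaleR: fixes v :: "'a::real_vector" assumes "c \<noteq> 0" shows "span {c *\<^sub>R v} = span {v}"
proof -
  have "c *\<^sub>R v \<in> span {v}" by (intro span_scale span_base) simp
  moreover have "(1 / c) *\<^sub>R (c *\<^sub>R v) \<in> span {c *\<^sub>R v}" by (intro span_scale span_base) simp
  then have "v \<in> span {c *\<^sub>R v}" using assms by simp
  ultimately show ?thesis by (intro equalityI span_minimal) auto
qed

lemma proj_of_scale: "c \<noteq> 0 \<Longrightarrow> proj_of (c *\<^sub>R v) = proj_of v"
  by (simp add: proj_of_def span_scaleR)

lemma proj_of_eqD:
  assumes "v \<noteq> 0" "w \<noteq> 0" "proj_of v = proj_of w" shows "\<exists>c. c \<noteq> 0 \<and> w = c *\<^sub>R v"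
proof -
  have "w \<in> span {v}" using assms line_of_proj_of by (metis span_base singletonI)
  then obtain c where "w = c *\<^sub>R v" unfolding span_singleton by blast
  then show ?thesis using assms(2) by (intro exI[of _ c]) auto
qed

lemma proj_act_proj_of:
  assumes "v \<noteq> 0" shows "proj_act g (proj_of v) = proj_of (g *v v)"
proof -
  have "(*v) g ` span {v} = span {g *v v}"
    using linear_span_image[of "(*v) g" "{v}"] by simp
  then show ?thesis unfolding proj_act_def line_of_proj_of[OF assms] by (simp add: proj_of_def)
qed

lemma open_proj_iff: "open U \<longleftrightarrow> open {v. v \<noteq> 0 \<and> proj_of v \<in> U}"
  by (rule open_proj_def)

lemma proj_of_closure:
  assumes v: "v \<in> closure {w. w \<noteq> 0 \<and> proj_of w \<in> S}" "v \<noteq> 0" shows "proj_of v \<in> closure S"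
proof (rule ccontr)
  assume n: "proj_of v \<notin> closure S"
  have "open (- closure S)" by (simp add: open_Compl)
  then have o: "open {w. w \<noteq> 0 \<and> proj_of w \<in> - closure S}" by (simp only: open_proj_iff)
  have "v \<in> {w. w \<noteq> 0 \<and> proj_of w \<in> - closure S} \<inter> closure {w. w \<noteq> 0 \<and> proj_of w \<in> S}"
    using v n by simp
  then have "{w. w \<noteq> 0 \<and> proj_of w \<in> - closure S} \<inter> {w. w \<noteq> 0 \<and> proj_of w \<in> S} \<noteq> {}"
    using open_Int_closure_eq_empty[OF o] by blast
  then show False using closure_subset by blast
qed

text \<open>The homogeneous coordinates of a direction, that is of a point at infinity.\<close>

definition hom_dir :: "real ^ 'n \<Rightarrow> ('n::finite) hvec" where
  "hom_dir x = (\<chi> i. case i of None \<Rightarrow> 0 | Some j \<Rightarrow> x $ j)"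

lemma hom_coords_add: "hom_coords (x + y) = hom_coords x + hom_dir y"
  by (auto simp: hom_coords_def hom_dir_def vec_eq_iff split: option.split)

lemma hom_dir_add: "hom_dir (x + y) = hom_dir x + hom_dir y"
  by (auto simp: hom_dir_def vec_eq_iff split: option.split)

lemma hom_dir_scale: "hom_dir (c *\<^sub>R x) = c *\<^sub>R hom_dir x"
  by (auto simp: hom_dir_def vec_eq_iff split: option.split)

lemma hom_coords_None [simp]: "hom_coords x $ None = 1" and hom_coords_Some [simp]: "hom_coords x $ Some j = x $ j"
  by (simp_all add: hom_coords_def)

lemma hom_coords_convex: "a + b = 1 \<Longrightarrow> hom_coords (a *\<^sub>R x + b *\<^sub>R y) = a *\<^sub>R hom_coords x + b *\<^sub>R hom_coords y"
  by (auto simp: hom_coords_def vec_eq_iff split: option.split)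

lemma continuous_hom_coords: "continuous_on S (hom_coords :: real^'n::finite \<Rightarrow> _)"
proof -
  have "continuous_on S (\<lambda>x. case i of None \<Rightarrow> 1 | Some j \<Rightarrow> x $ j)" for i :: "'n option"
    by (cases i) (auto intro!: continuous_intros)
  then show ?thesis unfolding hom_coords_def by (rule continuous_on_vec_lambda)
qed

lemma invertible_obtain:
  assumes "invertible (T :: real^'a::finite^'a)" obtains R where "T ** R = mat 1" "R ** T = mat 1"
  using assms unfolding invertible_def by blast

lemma hom_nz:
  fixes T :: "'n::finite hmat"
  assumes i: "invertible T" shows "T *v hom_coords x \<noteq> 0"
proof
  assume z: "T *v hom_coords x = 0"
  obtain R where "T ** R = mat 1" "R ** T = mat 1" using invertible_obtain[OF i] by blast
  then have "hom_coords x = R *v (T *v hom_coords x)" by (simp add: matrix_vector_mul_assoc)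
  then have "hom_coords x $ None = 0" using z by simp
  then show False by simp
qed

locale adapted_domain =
  fixes \<Omega> :: "('n::finite) proj set" and T :: "'n hmat"
  assumes open_Omega: "open \<Omega>" and ne_Omega: "\<Omega> \<noteq> {}" and adapted: "adapted_chart T \<Omega>"
begin

lemma inv_T: "invertible T" and closure_chart: "closure \<Omega> \<subseteq> range (chart T)" and convex_chart: "convex (chart T -` \<Omega>)"
  using adapted by (auto simp: adapted_chart_def)

definition R :: "'n hmat" where "R = (SOME R. T ** R = mat 1 \<and> R ** T = mat 1)"

lemma TR: "T ** R = mat 1" and RT: "R ** T = mat 1"
proof -
  have "\<exists>R. T ** R = mat 1 \<and> R ** T = mat 1" using inv_T unfolding invertible_def .
  from someI_ex[OF this] show "T ** R = mat 1" "R ** T = mat 1" unfolding R_def by auto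
qed

lemma RTv: "R *v (T *v v) = v" and TRv: "T *v (R *v v) = v"
  by (simp_all add: matrix_vector_mul_assoc TR RT)

text \<open>The linear form that vanishes on the hyperplane at infinity of the chart.\<close>

definition height :: "'n hvec" where "height = R $ None"

lemma height: "height \<bullet> v = (R *v v) $ None"
  by (simp add: height_def matrix_vector_mul_component)

lemma height_T: "height \<bullet> (T *v u) = u $ None" by (simp add: height RTv)

definition affine_pt :: "'n hvec \<Rightarrow> real^'n" where
  "affine_pt v = (\<chi> j. (R *v v) $ Some j / (height \<bullet> v))"

lemma affine_pt_T: "affine_pt (T *v hom_coords x) = x"
  by (simp add: affine_pt_def height_T RTv vec_eq_iff)

lemma R_affine_pt: assumes "height \<bullet> v \<noteq> 0" shows "R *v v = (height \<bullet> v) *\<^sub>R hom_coords (affine_pt v)"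
proof -
  have "(R *v v) $ i = ((height \<bullet> v) *\<^sub>R hom_coords (affine_pt v)) $ i" for i
    using assms by (cases i) (simp_all add: height affine_pt_def)
  then show ?thesis by (simp add: vec_eq_iff)
qed

lemma T_affine_pt: assumes "height \<bullet> v \<noteq> 0" shows "v = (height \<bullet> v) *\<^sub>R (T *v hom_coords (affine_pt v))"
proof -
  have "v = T *v (R *v v)" by (simp add: TRv)
  also have "\<dots> = (height \<bullet> v) *\<^sub>R (T *v hom_coords (affine_pt v))"
    by (simp add: R_affine_pt[OF assms] matrix_vector_mult_scaleR)
  finally show ?thesis .
qed

lemma proj_of_chart: assumes "height \<bullet> v \<noteq> 0" shows "proj_of v = chart T (affine_pt v)"
  using T_affine_pt[OF assms] proj_of_scale[OF assms] unfolding chart_def by metis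

definition domain_cone :: "'n hvec set" where "domain_cone = {v. height \<bullet> v > 0 \<and> proj_of v \<in> \<Omega>}"

definition dom :: "(real^'n) set" where "dom = chart T -` \<Omega>"

lemma cone_iff: "height \<bullet> v > 0 \<Longrightarrow> v \<in> domain_cone \<longleftrightarrow> affine_pt v \<in> dom"
  using proj_of_chart[of v] by (simp add: domain_cone_def dom_def)

lemma T_hom_cone: "T *v hom_coords x \<in> domain_cone \<longleftrightarrow> x \<in> dom"
  using cone_iff[of "T *v hom_coords x"] by (simp add: height_T affine_pt_T)

lemma height_closure: assumes "v \<in> closure domain_cone" "v \<noteq> 0" shows "height \<bullet> v > 0" and closure_Omega: "proj_of v \<in> closure \<Omega>"
proof -
  have "domain_cone \<subseteq> {w. w \<noteq> 0 \<and> proj_of w \<in> \<Omega>}" by (auto simp: domain_cone_def)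
  then have "v \<in> closure {w. w \<noteq> 0 \<and> proj_of w \<in> \<Omega>}" using assms(1) closure_mono by blast
  then show p: "proj_of v \<in> closure \<Omega>" using assms(2) by (rule proj_of_closure)
  then obtain x where x: "proj_of v = proj_of (T *v hom_coords x)" using closure_chart by (auto simp: chart_def)
  then obtain c where c: "c \<noteq> 0" "v = c *\<^sub>R (T *v hom_coords x)"
    using proj_of_eqD[OF hom_nz[OF inv_T] assms(2), of x] by metis
  then have "height \<bullet> v \<noteq> 0" by (simp add: height_T)
  moreover have "closure domain_cone \<subseteq> {v. height \<bullet> v \<ge> 0}"
  proof (rule closure_minimal)
    show "closed {v. height \<bullet> v \<ge> 0}" by (intro closed_Collect_le continuous_intros)
  qed (auto simp: domain_cone_def)
  ultimately show "height \<bullet> v > 0" using assms(1) by (auto simp: less_le)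
qed

lemma frontier_iff: "frontier \<Omega> = closure \<Omega> - \<Omega>"
  using open_Omega by (simp add: frontier_def interior_open)

lemma frontier_Omega: assumes "v \<in> closure domain_cone" "v \<notin> domain_cone" "v \<noteq> 0" shows "proj_of v \<in> frontier \<Omega>"
  using assms height_closure[OF assms(1,3)] closure_Omega[OF assms(1,3)] by (auto simp: frontier_iff domain_cone_def)

text \<open>The lines spanned by vectors of the closure of the cone form a closed subset of projective
  space, since their union is, apart from the origin, the union of two closed sets; and it
  contains \<open>\<Omega>\<close>.\<close>

lemma closure_lift:
  assumes v: "v \<noteq> 0" "proj_of v \<in> closure \<Omega>" shows "v \<in> closure domain_cone \<or> - v \<in> closure domain_cone"
proof -
  define Q where "Q = {p. \<exists>v. v \<noteq> 0 \<and> p = proj_of v \<and> v \<in> closure domain_cone}"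
  have scale: "c *\<^sub>R w \<in> closure domain_cone" if w: "w \<in> closure domain_cone" and c: "c > 0" for c w
  proof -
    obtain g where g: "\<And>k::nat. g k \<in> domain_cone" "g \<longlonglongrightarrow> w" using w unfolding closure_sequential by blast
    have "c *\<^sub>R g k \<in> domain_cone" for k using g(1)[of k] c by (simp add: domain_cone_def proj_of_scale)
    moreover have "(\<lambda>k. c *\<^sub>R g k) \<longlonglongrightarrow> c *\<^sub>R w" using g(2) by (intro tendsto_intros)
    ultimately show ?thesis unfolding closure_sequential by (intro exI[of _ "\<lambda>k. c *\<^sub>R g k"]) auto
  qed
  have Q_iff: "proj_of w \<in> Q \<longleftrightarrow> w \<in> closure domain_cone \<or> - w \<in> closure domain_cone" if w: "w \<noteq> 0" for w
  proof
    assume "proj_of w \<in> Q"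
    then obtain u where u: "u \<noteq> 0" "proj_of w = proj_of u" "u \<in> closure domain_cone" by (auto simp: Q_def)
    obtain c where c: "c \<noteq> 0" "w = c *\<^sub>R u" using proj_of_eqD[OF u(1) w] u(2) by metis
    show "w \<in> closure domain_cone \<or> - w \<in> closure domain_cone"
      using scale[OF u(3), of c] scale[OF u(3), of "- c"] c by (cases "c > 0") auto
  next
    assume "w \<in> closure domain_cone \<or> - w \<in> closure domain_cone"
    moreover have "proj_of (- w) = proj_of w" using proj_of_scale[of "-1" w] by simp
    ultimately show "proj_of w \<in> Q" using w unfolding Q_def mem_Collect_eq
      by (metis neg_equal_0_iff_equal)
  qed
  have "open (- Q)"
  proof -
    have "{w. w \<noteq> 0 \<and> proj_of w \<in> - Q} = - {0} \<inter> - closure domain_cone \<inter> uminus -` (- closure domain_cone)"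
      using Q_iff by auto
    moreover have "open (- {0} \<inter> - closure domain_cone \<inter> uminus -` (- closure domain_cone))"
      by (intro open_Int open_Compl open_vimage continuous_intros) auto
    ultimately show ?thesis by (simp only: open_proj_iff)
  qed
  then have "closed Q" by (simp add: closed_def)
  moreover have "\<Omega> \<subseteq> Q"
  proof
    fix p assume p: "p \<in> \<Omega>"
    then obtain x where x: "p = chart T x" using closure_chart closure_subset by blast
    then have "T *v hom_coords x \<in> domain_cone" using p T_hom_cone by (simp add: dom_def)
    then show "p \<in> Q" using x hom_nz[OF inv_T] closure_subset unfolding Q_def chart_def by blast
  qed
  ultimately have "closure \<Omega> \<subseteq> Q" by (simp add: closure_minimal)
  then show ?thesis using v Q_iff by blast
qed

lemma sharp: "sharp_cone domain_cone height"
proof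
  have "domain_cone = {v. v \<noteq> 0 \<and> proj_of v \<in> \<Omega>} \<inter> {v. height \<bullet> v > 0}" by (auto simp: domain_cone_def)
  moreover have "open {v. v \<noteq> 0 \<and> proj_of v \<in> \<Omega>}" using open_Omega by (simp only: open_proj_iff)
  moreover have "open {v. height \<bullet> v > 0}" by (intro open_Collect_less continuous_intros)
  ultimately show "open domain_cone" by auto
  show "convex domain_cone"
  proof (rule convexI)
    fix x y and u v :: real assume xy: "x \<in> domain_cone" "y \<in> domain_cone" and uv: "0 \<le> u" "0 \<le> v" "u + v = 1"
    have hx: "height \<bullet> x > 0" and hy: "height \<bullet> y > 0" using xy by (auto simp: domain_cone_def)
    define z where "z = u *\<^sub>R x + v *\<^sub>R y"
    have hz: "height \<bullet> z = u * (height \<bullet> x) + v * (height \<bullet> y)" by (simp add: z_def inner_add_right)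
    have hz0: "height \<bullet> z > 0"
    proof (cases "u = 0")
      case True
      then show ?thesis using hz hy uv by simp
    next
      case False
      then have "u * (height \<bullet> x) > 0" using uv hx by simp
      moreover have "v * (height \<bullet> y) \<ge> 0" using uv hy by simp
      ultimately show ?thesis using hz by linarith
    qed
    define a where "a = u * (height \<bullet> x) / (height \<bullet> z)"
    define b where "b = v * (height \<bullet> y) / (height \<bullet> z)"
    have ab: "0 \<le> a" "0 \<le> b" "a + b = 1"
      using uv hx hy hz hz0 by (auto simp: a_def b_def add_divide_distrib[symmetric])
    have "affine_pt z = a *\<^sub>R affine_pt x + b *\<^sub>R affine_pt y"
    proof -
      have "affine_pt z $ j = (a *\<^sub>R affine_pt x + b *\<^sub>R affine_pt y) $ j" for j
      proof -
        have "(R *v z) $ Some j = u * (R *v x) $ Some j + v * (R *v y) $ Some j"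
          by (simp add: z_def matrix_vector_right_distrib matrix_vector_mult_scaleR)
        then show ?thesis using hx hy hz0 by (simp add: affine_pt_def a_def b_def add_divide_distrib)
      qed
      then show ?thesis by (simp add: vec_eq_iff)
    qed
    moreover have "affine_pt x \<in> dom" "affine_pt y \<in> dom" using xy cone_iff hx hy by auto
    ultimately have "affine_pt z \<in> dom"
      using convexD[OF convex_chart[folded dom_def], of "affine_pt x" "affine_pt y" a b] ab by simp
    then show "u *\<^sub>R x + v *\<^sub>R y \<in> domain_cone" using cone_iff[OF hz0] by (simp add: z_def)
  qed
  show "t *\<^sub>R v \<in> domain_cone" if "v \<in> domain_cone" "t > 0" for v t using that by (simp add: domain_cone_def proj_of_scale)
  obtain p where p: "p \<in> \<Omega>" using ne_Omega by blast
  then obtain x where "p = chart T x" using closure_chart closure_subset by blast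
  then have "T *v hom_coords x \<in> domain_cone" using p T_hom_cone by (simp add: dom_def)
  then show "domain_cone \<noteq> {}" by blast
  show "height \<bullet> v > 0" if "v \<in> closure domain_cone" "v \<noteq> 0" for v by (rule height_closure[OF that])
qed

sublocale sc: sharp_cone domain_cone height by (rule sharp)

text \<open>If a positive combination of \<open>x\<close> and \<open>y\<close> is not in the cone, no
  point of the segment from \<open>x\<close> to \<open>y\<close> is, because vectors of the
  closure may be added to those of the cone. The segment then projects into the frontier.\<close>

lemma strict_lift:
  assumes sc: "strictly_convex \<Omega>" and x: "x \<in> sc.bdry" and y: "y \<in> sc.bdry" "x \<noteq> y" and st: "s > 0" "t > 0"
  shows "s *\<^sub>R x + t *\<^sub>R y \<in> domain_cone"
proof (rule ccontr)
  assume n: "s *\<^sub>R x + t *\<^sub>R y \<notin> domain_cone"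
  note xD = sc.bdryD[OF x] and yD = sc.bdryD[OF y(1)]
  have seg: "(1 - u) *\<^sub>R x + u *\<^sub>R y \<in> closure domain_cone" "(1 - u) *\<^sub>R x + u *\<^sub>R y \<notin> domain_cone" if u: "0 \<le> u" "u \<le> 1" for u
  proof -
    show "(1 - u) *\<^sub>R x + u *\<^sub>R y \<in> closure domain_cone"
      using u xD yD by (intro sc.closure_add sc.closure_scale) auto
    show "(1 - u) *\<^sub>R x + u *\<^sub>R y \<notin> domain_cone"
    proof
      assume z: "(1 - u) *\<^sub>R x + u *\<^sub>R y \<in> domain_cone"
      have dom1: "s *\<^sub>R x + t *\<^sub>R y \<in> domain_cone" if r: "r > 0" "r * (1 - u) \<le> s" "r * u \<le> t" for r
      proof -
        have "(s - r * (1 - u)) *\<^sub>R x + (t - r * u) *\<^sub>R y + r *\<^sub>R ((1 - u) *\<^sub>R x + u *\<^sub>R y) \<in> domain_cone"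
          by (intro sc.add_closure_C sc.closure_add sc.closure_scale xD(1) yD(1) sc.cone_C[OF z r(1)])
            (use r in auto)
        moreover have "(s - r * (1 - u)) *\<^sub>R x + (t - r * u) *\<^sub>R y + r *\<^sub>R ((1 - u) *\<^sub>R x + u *\<^sub>R y) = s *\<^sub>R x + t *\<^sub>R y"
          by (simp add: algebra_simps)
        ultimately show ?thesis by simp
      qed
      define r where "r = min s t"
      have r: "r > 0" "r \<le> s" "r \<le> t" using st by (auto simp: r_def)
      moreover have "r * (1 - u) \<le> r" "r * u \<le> r" using r u by (auto intro: mult_left_le)
      ultimately have "r > 0" "r * (1 - u) \<le> s" "r * u \<le> t" by linarith+
      then show False using dom1 n by blast
    qed
  qed
  have hx: "x = T *v hom_coords (affine_pt x)" "y = T *v hom_coords (affine_pt y)"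
    using T_affine_pt[of x] T_affine_pt[of y] xD yD by auto
  have "affine_pt x \<noteq> affine_pt y" using hx y(2) by metis
  moreover have "chart T ` closed_segment (affine_pt x) (affine_pt y) \<subseteq> frontier \<Omega>"
  proof
    fix p assume "p \<in> chart T ` closed_segment (affine_pt x) (affine_pt y)"
    then obtain u where u: "0 \<le> u" "u \<le> 1" "p = chart T ((1 - u) *\<^sub>R affine_pt x + u *\<^sub>R affine_pt y)"
      by (auto simp: closed_segment_def)
    have "p = proj_of ((1 - u) *\<^sub>R x + u *\<^sub>R y)"
      unfolding u(3) chart_def
      by (subst hom_coords_convex) (simp_all add: matrix_vector_right_distrib matrix_vector_mult_scaleR flip: hx)
    moreover have "height \<bullet> ((1 - u) *\<^sub>R x + u *\<^sub>R y) = 1" using xD yD by (simp add: inner_add_right)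
    then have "(1 - u) *\<^sub>R x + u *\<^sub>R y \<noteq> 0" by force
    ultimately show "p \<in> frontier \<Omega>" using frontier_Omega[OF seg[OF u(1,2)]] by simp
  qed
  ultimately show False using sc inv_T unfolding strictly_convex_def by blast
qed

text \<open>The frontier near \<open>p\<close> is a graph in some chart \<open>T'\<close>, which need not
  be the chart \<open>T\<close>. On its lift through \<open>p\<close> the functional
  \<open>a\<close> is nonnegative and vanishes at \<open>p\<close>, so its derivative along the
  graph vanishes there (\<open>tangent\<close>). What is left of \<open>a\<close> is the first
  order Taylor remainder of the graph function, up to a factor (\<open>aqy\<close>). The
  displacement in the chart \<open>T'\<close> is then estimated by the one in the cone.\<close>

lemma regular_lift:
  assumes C1: "C1_plus_boundary \<epsilon> \<Omega>" and p: "p \<in> sc.bdry" and a: "sc.supports a p" and eps: "0 < \<epsilon>" "\<epsilon> < 1"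
  shows "\<exists>K>0. \<exists>r>0. \<forall>w. w \<in> closure domain_cone \<longrightarrow> w \<notin> domain_cone \<longrightarrow> norm (w - p) < r \<longrightarrow>
        a \<bullet> w \<le> K * norm (w - p) powr (1 + \<epsilon>)"
proof -
  note pD = sc.bdryD[OF p]
  have ap: "a \<bullet> p = 0" using a by (simp add: sc.supports_def)
  have pF: "proj_of p \<in> frontier \<Omega>" by (rule frontier_Omega[OF pD(1,2,4)])
  have "\<exists>W T' k U \<phi>. open W \<and> proj_of p \<in> W \<and> invertible T' \<and> C1_plus_on \<epsilon> {x. x $ k = 0} U \<phi> \<and>
      frontier \<Omega> \<inter> W = chart T' ` {x + \<phi> x *\<^sub>R axis k 1 | x. x \<in> U}"
    using C1 unfolding C1_plus_boundary_def locally_graph_def by (rule bspec) (rule pF)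
  then obtain W T' k U \<phi> where W': "open W \<and> proj_of p \<in> W \<and> invertible T' \<and> C1_plus_on \<epsilon> {x. x $ k = 0} U \<phi> \<and>
      frontier \<Omega> \<inter> W = chart T' ` {x + \<phi> x *\<^sub>R axis k 1 | x. x \<in> U}"
    by (elim exE)
  then have W: "open W" "proj_of p \<in> W" "invertible T'" "C1_plus_on \<epsilon> {x. x $ k = 0} U \<phi>"
    "frontier \<Omega> \<inter> W = chart T' ` {x + \<phi> x *\<^sub>R axis k 1 | x. x \<in> U}"
    by simp_all
  obtain \<phi>' K0 where grad: "C1_gradient {x. x $ k = 0} U \<phi> \<phi>'" and K0: "K0 > 0"
    and est: "\<And>x y. x \<in> U \<Longrightarrow> y \<in> U \<Longrightarrow> \<bar>\<phi> y - \<phi> x - \<phi>' x \<bullet> (y - x)\<bar> \<le> K0 * norm (x - y) powr (1 + \<epsilon>)"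
    using W(4) unfolding C1_plus_on_def by blast
  obtain R' where R': "T' ** R' = mat 1" "R' ** T' = mat 1" using invertible_obtain[OF W(3)] by blast
  define e where "e = (axis k 1 :: real^'n)"
  define X where "X x = x + \<phi> x *\<^sub>R e" for x
  define q where "q x = T' *v hom_coords (X x)" for x
  have qnz: "q x \<noteq> 0" for x unfolding q_def by (rule hom_nz[OF W(3)])
  have FW: "frontier \<Omega> \<inter> W = (\<lambda>x. proj_of (q x)) ` U"
    unfolding W(5) by (auto simp: q_def X_def chart_def e_def)
  then obtain x0 where x0: "x0 \<in> U" "proj_of p = proj_of (q x0)" using pF W(2) by blast
  obtain c0 where c0: "c0 \<noteq> 0" "p = c0 *\<^sub>R q x0" using proj_of_eqD[OF qnz pD(4)] x0(2) by metis
  have openU: "openin (top_of_set {x. x $ k = 0}) U" and der: "(\<phi> has_derivative (\<lambda>v. \<phi>' x0 \<bullet> v)) (at x0 within U)"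
    using grad x0 by (auto simp: C1_gradient_def)
  obtain V where V: "open V" "U = {x. x $ k = 0} \<inter> V" using openU by (auto simp: openin_open)
  have qdiff: "h \<bullet> q y = h \<bullet> q x0 + h \<bullet> (T' *v hom_dir (y - x0)) + (\<phi> y - \<phi> x0) * (h \<bullet> (T' *v hom_dir e))" for h y
  proof -
    have "X y = X x0 + ((y - x0) + (\<phi> y - \<phi> x0) *\<^sub>R e)" by (simp add: X_def algebra_simps)
    then have "q y = q x0 + T' *v hom_dir (y - x0) + (\<phi> y - \<phi> x0) *\<^sub>R (T' *v hom_dir e)"
      by (simp add: q_def hom_coords_add hom_dir_add hom_dir_scale matrix_vector_right_distrib matrix_vector_mult_scaleR)
    then show ?thesis by (simp add: inner_add_right)
  qed
  have aq0: "a \<bullet> q x0 = 0" using ap c0 by simp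
  have tangent: "a \<bullet> (T' *v hom_dir d) + (\<phi>' x0 \<bullet> d) * (a \<bullet> (T' *v hom_dir e)) = 0" if d: "d $ k = 0" for d
  proof -
    define S where "S = {\<tau>. x0 + \<tau> *\<^sub>R d \<in> U}"
    have S_eq: "S = (\<lambda>\<tau>. x0 + \<tau> *\<^sub>R d) -` V" using V x0(1) d by (auto simp: S_def)
    have oS: "open S" unfolding S_eq using V(1) by (intro open_vimage continuous_intros)
    have S0: "0 \<in> S" using x0 by (simp add: S_def)
    have "((\<lambda>\<tau>. x0 + \<tau> *\<^sub>R d) has_derivative (\<lambda>\<tau>. \<tau> *\<^sub>R d)) (at 0 within S)"
      by (auto intro!: derivative_eq_intros)
    moreover have "(\<phi> has_derivative (\<lambda>v. \<phi>' x0 \<bullet> v)) (at (x0 + 0 *\<^sub>R d) within (\<lambda>\<tau>. x0 + \<tau> *\<^sub>R d) ` S)"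
      using der by (simp, elim has_derivative_subset) (auto simp: S_def)
    ultimately have "((\<lambda>\<tau>. \<phi> (x0 + \<tau> *\<^sub>R d)) has_derivative (\<lambda>\<tau>. \<phi>' x0 \<bullet> (\<tau> *\<^sub>R d))) (at 0 within S)"
      by (rule has_derivative_in_compose)
    then have d1: "((\<lambda>\<tau>. \<phi> (x0 + \<tau> *\<^sub>R d)) has_real_derivative (\<phi>' x0 \<bullet> d)) (at 0)"
    proof -
      assume *: "((\<lambda>\<tau>. \<phi> (x0 + \<tau> *\<^sub>R d)) has_derivative (\<lambda>\<tau>. \<phi>' x0 \<bullet> (\<tau> *\<^sub>R d))) (at 0 within S)"
      have "at 0 within S = at 0" by (rule at_within_open[OF S0 oS])
      moreover have "(\<lambda>\<tau>. \<phi>' x0 \<bullet> (\<tau> *\<^sub>R d)) = (*) (\<phi>' x0 \<bullet> d)"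
        by (rule ext) (simp only: inner_scaleR_right mult.commute)
      ultimately show ?thesis using * by (simp only: has_field_derivative_def)
    qed
    have lineq: "h \<bullet> q (x0 + \<tau> *\<^sub>R d) = h \<bullet> q x0 + \<tau> * (h \<bullet> (T' *v hom_dir d)) + (\<phi> (x0 + \<tau> *\<^sub>R d) - \<phi> x0) * (h \<bullet> (T' *v hom_dir e))" for h \<tau>
      using qdiff[of h "x0 + \<tau> *\<^sub>R d"] by (simp add: hom_dir_scale matrix_vector_mult_scaleR)
    have d2: "((\<lambda>\<tau>. c0 * (h \<bullet> q (x0 + \<tau> *\<^sub>R d))) has_real_derivative
        c0 * (h \<bullet> (T' *v hom_dir d) + (\<phi>' x0 \<bullet> d) * (h \<bullet> (T' *v hom_dir e)))) (at 0)" for h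
      unfolding lineq by (auto intro!: derivative_eq_intros d1)
    have "isCont (\<lambda>\<tau>. c0 * (height \<bullet> q (x0 + \<tau> *\<^sub>R d))) 0" by (rule DERIV_isCont[OF d2])
    moreover have "c0 * (height \<bullet> q (x0 + 0 *\<^sub>R d)) = 1" using pD(3) c0(2) by (metis add.right_neutral inner_scaleR_right scale_zero_left)
    ultimately have "eventually (\<lambda>\<tau>. c0 * (height \<bullet> q (x0 + \<tau> *\<^sub>R d)) > 0) (at 0)"
      unfolding isCont_def by (intro order_tendstoD(1)) auto
    then have ev: "eventually (\<lambda>\<tau>. c0 * (height \<bullet> q (x0 + \<tau> *\<^sub>R d)) > 0) (nhds 0)"
      using \<open>c0 * (height \<bullet> q (x0 + 0 *\<^sub>R d)) = 1\<close> unfolding eventually_at_filter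
      by (auto elim: eventually_mono)
    have "eventually (\<lambda>\<tau>. \<tau> \<in> S) (nhds 0)" using oS S0 by (rule eventually_nhds_in_open)
    with ev have "eventually (\<lambda>\<tau>. 0 \<le> c0 * (a \<bullet> q (x0 + \<tau> *\<^sub>R d))) (nhds 0)"
    proof eventually_elim
      case (elim \<tau>)
      define w where "w = c0 *\<^sub>R q (x0 + \<tau> *\<^sub>R d)"
      have wn: "w \<noteq> 0" using c0 qnz by (simp add: w_def)
      have hw: "height \<bullet> w > 0" using elim by (simp add: w_def)
      have "proj_of w \<in> frontier \<Omega> \<inter> W" unfolding FW w_def using elim(2) c0 by (auto simp: proj_of_scale S_def)
      then have "proj_of w \<in> closure \<Omega>" by (auto simp: frontier_iff)
      then have "w \<in> closure domain_cone \<or> - w \<in> closure domain_cone" by (rule closure_lift[OF wn])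
      then have "w \<in> closure domain_cone" using height_closure[of "- w"] wn hw by auto
      then have "a \<bullet> w \<ge> 0" by (rule sc.supports_nonneg[OF a])
      then show ?case by (simp add: w_def)
    qed
    then obtain \<delta> where \<delta>: "\<delta> > 0" "\<And>\<tau>. dist \<tau> 0 < \<delta> \<Longrightarrow> 0 \<le> c0 * (a \<bullet> q (x0 + \<tau> *\<^sub>R d))"
      unfolding eventually_nhds_metric by blast
    have "c0 * (a \<bullet> (T' *v hom_dir d) + (\<phi>' x0 \<bullet> d) * (a \<bullet> (T' *v hom_dir e))) = 0"
    proof (rule DERIV_local_min[OF d2[of a] \<delta>(1)], intro allI impI)
      fix \<tau> :: real assume "\<bar>0 - \<tau>\<bar> < \<delta>"
      then show "c0 * (a \<bullet> q (x0 + 0 *\<^sub>R d)) \<le> c0 * (a \<bullet> q (x0 + \<tau> *\<^sub>R d))"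
        using \<delta>(2)[of \<tau>] aq0 by simp
    qed
    then show ?thesis using c0 by simp
  qed
  define \<kappa> where "\<kappa> = a \<bullet> (T' *v hom_dir e)"
  have aqy: "a \<bullet> q y = (\<phi> y - \<phi> x0 - \<phi>' x0 \<bullet> (y - x0)) * \<kappa>" if y: "y \<in> U" for y
  proof -
    have "(y - x0) $ k = 0" using y x0(1) V by simp
    from tangent[OF this] have "a \<bullet> (T' *v hom_dir (y - x0)) = - (\<phi>' x0 \<bullet> (y - x0)) * \<kappa>" by (simp add: \<kappa>_def)
    then show ?thesis using qdiff[of a y] aq0 by (simp add: \<kappa>_def algebra_simps)
  qed
  define M where "M = real CARD('n option) * norm R' + 1"
  have M: "M > 0" by (simp add: M_def add_nonneg_pos)
  have RM: "\<bar>(R' *v u) $ i\<bar> \<le> M * norm u" for u i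
  proof -
    have "\<bar>(R' *v u) $ i\<bar> \<le> norm (R' *v u)" by (rule component_le_norm_cart)
    also have "\<dots> \<le> real CARD('n option) * norm R' * norm u" by (rule norm_matrix_vector_le)
    also have "\<dots> \<le> M * norm u" by (intro mult_right_mono) (auto simp: M_def)
    finally show ?thesis .
  qed
  define L1 where "L1 = 2 * M * (1 + norm (X x0)) / \<bar>c0\<bar>"
  define L where "L = real CARD('n) * L1"
  have L1: "L1 > 0" using M c0 by (simp add: L1_def add_pos_nonneg)
  have L: "L > 0" using L1 by (simp add: L_def)
  have "open {v. v \<noteq> 0 \<and> proj_of v \<in> W}" using W(1) by (simp only: open_proj_iff)
  moreover have "p \<in> {v. v \<noteq> 0 \<and> proj_of v \<in> W}" using pD W by simp
  ultimately obtain r1 where r1: "r1 > 0" "ball p r1 \<subseteq> {v. v \<noteq> 0 \<and> proj_of v \<in> W}" by (rule openE)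
  define r where "r = min r1 (\<bar>c0\<bar> / (2 * M))"
  have r: "r > 0" using r1 c0 M by (simp add: r_def)
  define K where "K = 2 * \<bar>c0\<bar> * (\<bar>\<kappa>\<bar> + 1) * K0 * L powr (1 + \<epsilon>)"
  have K: "K > 0" using c0 K0 L by (simp add: K_def add_nonneg_pos)
  have "a \<bullet> w \<le> K * norm (w - p) powr (1 + \<epsilon>)"
    if w: "w \<in> closure domain_cone" "w \<notin> domain_cone" "norm (w - p) < r" for w
  proof -
    have "w \<in> ball p r1" using w(3) by (simp add: r_def dist_norm norm_minus_commute)
    then have "w \<in> {v. v \<noteq> 0 \<and> proj_of v \<in> W}" by (rule subsetD[OF r1(2)])
    then have wW: "w \<noteq> 0" "proj_of w \<in> W" by simp_all
    then have "proj_of w \<in> frontier \<Omega> \<inter> W" using frontier_Omega[OF w(1,2)] by simp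
    then obtain y where y: "y \<in> U" "proj_of w = proj_of (q y)" unfolding FW by blast
    obtain c where c: "c \<noteq> 0" "w = c *\<^sub>R q y" using proj_of_eqD[OF qnz wW(1)] y(2) by metis
    have Rq: "R' *v (s *\<^sub>R q u) = s *\<^sub>R hom_coords (X u)" for s u
      using R'(2) by (simp add: q_def matrix_vector_mult_scaleR matrix_vector_mul_assoc)
    have Rdiff: "R' *v (w - p) = c *\<^sub>R hom_coords (X y) - c0 *\<^sub>R hom_coords (X x0)"
      using Rq c(2) c0(2) by (simp add: matrix_vector_mult_diff_distrib)
    have cc: "\<bar>c - c0\<bar> \<le> M * norm (w - p)" using RM[of "w - p" None] Rdiff by simp
    have "M * norm (w - p) \<le> M * (\<bar>c0\<bar> / (2 * M))" using w(3) M by (intro mult_left_mono) (auto simp: r_def)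
    then have "\<bar>c - c0\<bar> \<le> \<bar>c0\<bar> / 2" using cc M by simp
    then have c2: "\<bar>c\<bar> \<ge> \<bar>c0\<bar> / 2" "\<bar>c\<bar> \<le> 2 * \<bar>c0\<bar>" by linarith+
    \<comment> \<open>The points \<open>X y\<close> and \<open>y\<close> differ in the component
      \<open>k\<close> only, where \<open>y - x0\<close> vanishes.\<close>
    have comp: "\<bar>(y - x0) $ j\<bar> \<le> L1 * norm (w - p)" for j
    proof -
      have "c * X y $ j - c0 * X x0 $ j = (R' *v (w - p)) $ Some j" using Rdiff by simp
      then have "\<bar>c * X y $ j - c0 * X x0 $ j\<bar> \<le> M * norm (w - p)" using RM by metis
      moreover have "\<bar>(c - c0) * X x0 $ j\<bar> \<le> M * norm (w - p) * norm (X x0)"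
        unfolding abs_mult using cc component_le_norm_cart[of "X x0" j] M by (intro mult_mono) auto
      moreover have "c * (X y $ j - X x0 $ j) = (c * X y $ j - c0 * X x0 $ j) - (c - c0) * X x0 $ j"
        by (simp add: algebra_simps)
      ultimately have "\<bar>c * (X y $ j - X x0 $ j)\<bar> \<le> M * norm (w - p) + M * norm (w - p) * norm (X x0)" by linarith
      then have 1: "\<bar>c\<bar> * \<bar>X y $ j - X x0 $ j\<bar> \<le> M * (1 + norm (X x0)) * norm (w - p)"
        unfolding abs_mult by (simp add: distrib_left distrib_right mult_ac)
      have "\<bar>c0\<bar> / 2 * \<bar>X y $ j - X x0 $ j\<bar> \<le> \<bar>c\<bar> * \<bar>X y $ j - X x0 $ j\<bar>" using c2 by (intro mult_right_mono) auto
      then have "\<bar>c0\<bar> / 2 * \<bar>X y $ j - X x0 $ j\<bar> \<le> M * (1 + norm (X x0)) * norm (w - p)" using 1 by linarith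
      then have "\<bar>X y $ j - X x0 $ j\<bar> \<le> L1 * norm (w - p)" using c0 by (simp add: L1_def field_simps)
      moreover have "\<bar>(y - x0) $ j\<bar> \<le> \<bar>X y $ j - X x0 $ j\<bar>"
        using y(1) x0(1) V by (cases "j = k") (auto simp: X_def e_def axis_def)
      ultimately show ?thesis by linarith
    qed
    have "norm (y - x0) \<le> (\<Sum>j\<in>UNIV. \<bar>(y - x0) $ j\<bar>)" by (rule norm_le_l1_cart)
    also have "\<dots> \<le> (\<Sum>j\<in>(UNIV::'n set). L1 * norm (w - p))" by (intro sum_mono comp)
    finally have nyx: "norm (x0 - y) \<le> L * norm (w - p)" by (simp add: L_def norm_minus_commute)
    have "a \<bullet> w \<le> \<bar>c\<bar> * (\<bar>\<phi> y - \<phi> x0 - \<phi>' x0 \<bullet> (y - x0)\<bar> * \<bar>\<kappa>\<bar>)"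
      using aqy[OF y(1)] c(2) abs_ge_self[of "a \<bullet> w"] by (simp add: abs_mult)
    also have "\<dots> \<le> (2 * \<bar>c0\<bar>) * ((K0 * (L * norm (w - p)) powr (1 + \<epsilon>)) * (\<bar>\<kappa>\<bar> + 1))"
    proof (intro mult_mono c2)
      have "norm (x0 - y) powr (1 + \<epsilon>) \<le> (L * norm (w - p)) powr (1 + \<epsilon>)"
        using nyx eps by (intro powr_mono2) auto
      then have "K0 * norm (x0 - y) powr (1 + \<epsilon>) \<le> K0 * (L * norm (w - p)) powr (1 + \<epsilon>)"
        using K0 by (intro mult_left_mono) auto
      then show "\<bar>\<phi> y - \<phi> x0 - \<phi>' x0 \<bullet> (y - x0)\<bar> \<le> K0 * (L * norm (w - p)) powr (1 + \<epsilon>)"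
        using est[OF x0(1) y(1)] by linarith
    qed (use K0 in auto)
    also have "\<dots> = K * norm (w - p) powr (1 + \<epsilon>)" using L by (simp add: K_def powr_mult mult_ac)
    finally show ?thesis .
  qed
  then show ?thesis using K r by blast
qed

end

section \<open>The group acting on the cone\<close>

lemma m_inv_Aut:
  assumes g: "g \<in> carrier (Aut \<Omega>)" and h: "g ** h = mat 1" "h ** g = mat 1"
  shows "m_inv (Aut \<Omega>) g = h" and "h \<in> carrier (Aut \<Omega>)"
proof -
  have gnz: "g *v v \<noteq> 0" if "v \<noteq> 0" for v
  proof
    assume "g *v v = 0"
    then have "h *v (g *v v) = 0" by simp
    then show False using that h by (simp add: matrix_vector_mul_assoc)
  qed
  have "det g * det h = 1" using h by (metis det_I det_mul)
  then have dh: "det h = 1" using g by (simp add: Aut_def)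
  have act: "proj_act h (proj_act g p) = p" for p
  proof -
    obtain v where v: "v \<noteq> 0" "p = proj_of v" using proj_ex by blast
    then show ?thesis using gnz[OF v(1)] h by (simp add: proj_act_proj_of matrix_vector_mul_assoc)
  qed
  have "proj_act h ` \<Omega> = proj_act h ` (proj_act g ` \<Omega>)" using g by (simp add: Aut_def)
  also have "\<dots> = \<Omega>" by (simp add: image_image act)
  finally show hc: "h \<in> carrier (Aut \<Omega>)" using dh by (simp add: Aut_def)
  show "m_inv (Aut \<Omega>) g = h"
    unfolding m_inv_def
  proof (rule the_equality)
    show "h \<in> carrier (Aut \<Omega>) \<and> g \<otimes>\<^bsub>Aut \<Omega>\<^esub> h = \<one>\<^bsub>Aut \<Omega>\<^esub> \<and> h \<otimes>\<^bsub>Aut \<Omega>\<^esub> g = \<one>\<^bsub>Aut \<Omega>\<^esub>"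
      using hc h by (simp add: Aut_def)
    fix y assume "y \<in> carrier (Aut \<Omega>) \<and> g \<otimes>\<^bsub>Aut \<Omega>\<^esub> y = \<one>\<^bsub>Aut \<Omega>\<^esub> \<and> y \<otimes>\<^bsub>Aut \<Omega>\<^esub> g = \<one>\<^bsub>Aut \<Omega>\<^esub>"
    then have "g ** y = mat 1" by (simp add: Aut_def)
    then have "h ** (g ** y) = h" by simp
    then show "y = h" by (simp add: matrix_mul_assoc h)
  qed
qed

text \<open>Infinitely many elements of bounded norm have bounded inverses, so a subsequence converges
  together with its inverses. The quotients of successive members then converge to the identity
  without being equal to it.\<close>

lemma discrete_bounded_finite:
  fixes \<Gamma> :: "(real^'m::finite^'m) set"
  assumes disc: "discrete \<Gamma>" and one: "mat 1 \<in> \<Gamma>"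
    and det: "\<And>g. g \<in> \<Gamma> \<Longrightarrow> det g = 1"
    and inv: "\<And>g. g \<in> \<Gamma> \<Longrightarrow> \<exists>h\<in>\<Gamma>. g ** h = mat 1 \<and> h ** g = mat 1"
    and mult: "\<And>g h. g \<in> \<Gamma> \<Longrightarrow> h \<in> \<Gamma> \<Longrightarrow> g ** h \<in> \<Gamma>"
  shows "finite {g \<in> \<Gamma>. norm g \<le> R}"
proof (rule ccontr)
  assume "infinite {g \<in> \<Gamma>. norm g \<le> R}"
  then obtain g :: "nat \<Rightarrow> _" where g: "inj g" "range g \<subseteq> {g \<in> \<Gamma>. norm g \<le> R}"
    using infinite_countable_subset by blast
  then have gG: "g k \<in> \<Gamma>" "norm (g k) \<le> R" for k by auto
  have "\<forall>k. \<exists>h. h \<in> \<Gamma> \<and> g k ** h = mat 1 \<and> h ** g k = mat 1" using inv gG(1) by blast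
  from choice[OF this] obtain h where h: "\<And>k. h k \<in> \<Gamma>" "\<And>k. g k ** h k = mat 1" "\<And>k. h k ** g k = mat 1" by blast
  obtain R' where R': "\<And>M N :: real^'m^'m. M ** N = mat 1 \<Longrightarrow> \<bar>det M\<bar> = 1 \<Longrightarrow> norm M \<le> R \<Longrightarrow> norm N \<le> R'"
    using norm_inverse_bounded by blast
  have hb: "norm (h k) \<le> R'" for k using R'[OF h(2)] det[OF gG(1)] gG(2) by simp
  have "g k \<in> cball 0 R" for k using gG(2) by simp
  then have "\<exists>l r. l \<in> cball 0 R \<and> strict_mono r \<and> (\<lambda>k. g (r k)) \<longlonglongrightarrow> l"
    by (rule compact_subseq[OF compact_cball])
  then obtain A and r :: "nat \<Rightarrow> nat" where A: "strict_mono r" "(\<lambda>k. g (r k)) \<longlonglongrightarrow> A" by blast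
  have "h (r k) \<in> cball 0 R'" for k using hb by simp
  then have "\<exists>l q. l \<in> cball 0 R' \<and> strict_mono q \<and> (\<lambda>k. h (r (q k))) \<longlonglongrightarrow> l"
    by (rule compact_subseq[OF compact_cball])
  then obtain B and q :: "nat \<Rightarrow> nat" where B: "strict_mono q" "(\<lambda>k. h (r (q k))) \<longlonglongrightarrow> B" by blast
  have Aq: "(\<lambda>k. g (r (q k))) \<longlonglongrightarrow> A" using LIMSEQ_subseq_LIMSEQ[OF A(2) B(1)] by (simp add: o_def)
  have "(\<lambda>k. h (r (q k)) ** g (r (q k))) \<longlonglongrightarrow> B ** A" by (intro tendsto_matrix_mult B Aq)
  then have BA: "B ** A = mat 1" by (simp add: h LIMSEQ_const_iff)
  have "(\<lambda>k. h (r (q k)) ** g (r (q (Suc k)))) \<longlonglongrightarrow> B ** A"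
    by (intro tendsto_matrix_mult B LIMSEQ_Suc[OF Aq])
  then have lim: "(\<lambda>k. h (r (q k)) ** g (r (q (Suc k)))) \<longlonglongrightarrow> mat 1" by (simp only: BA)
  have "mat 1 isolated_in \<Gamma>" using disc one by (simp add: discrete_def)
  then obtain U where U: "open U" "U \<inter> \<Gamma> = {mat 1}" unfolding isolated_in_def by blast
  then have "mat 1 \<in> U" by blast
  then have "eventually (\<lambda>k. h (r (q k)) ** g (r (q (Suc k))) \<in> U) sequentially"
    using lim U(1) topological_tendstoD by blast
  then have "\<exists>k. h (r (q k)) ** g (r (q (Suc k))) \<in> U" by (rule eventually_happens'[OF sequentially_bot])
  then obtain k where "h (r (q k)) ** g (r (q (Suc k))) \<in> U" by blast
  moreover have "h (r (q k)) ** g (r (q (Suc k))) \<in> \<Gamma>" using mult h(1) gG(1) by blast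
  ultimately have "h (r (q k)) ** g (r (q (Suc k))) = mat 1" using U(2) by blast
  then have "g (r (q k)) ** (h (r (q k)) ** g (r (q (Suc k)))) = g (r (q k))" by simp
  then have "g (r (q (Suc k))) = g (r (q k))" by (simp add: matrix_mul_assoc h)
  then have "r (q (Suc k)) = r (q k)" using injD[OF g(1)] by blast
  moreover have "r (q k) < r (q (Suc k))" using A(1) B(1) by (simp add: strict_mono_def)
  ultimately show False by simp
qed

context adapted_domain
begin

lemma dom_bounded: "bounded dom" and dom_open: "open dom" and dom_convex: "convex dom"
proof -
  obtain B where B: "\<And>v. v \<in> sc.slice \<Longrightarrow> norm v \<le> B"
    using compact_imp_bounded[OF sc.compact_slice] bounded_iff by metis
  have "norm x \<le> real CARD('n option) * norm R * B * real CARD('n)" if x: "x \<in> dom" for x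
  proof -
    have "T *v hom_coords x \<in> sc.slice"
      using x T_hom_cone closure_subset by (auto simp: sc.slice_def height_T)
    then have nB: "norm (T *v hom_coords x) \<le> B" by (rule B)
    have comp: "\<bar>x $ j\<bar> \<le> real CARD('n option) * norm R * B" for j
    proof -
      have "\<bar>x $ j\<bar> = \<bar>(R *v (T *v hom_coords x)) $ Some j\<bar>" by (simp add: RTv)
      also have "\<dots> \<le> norm (R *v (T *v hom_coords x))" by (rule component_le_norm_cart)
      also have "\<dots> \<le> real CARD('n option) * norm R * norm (T *v hom_coords x)" by (rule norm_matrix_vector_le)
      also have "\<dots> \<le> real CARD('n option) * norm R * B" by (intro mult_left_mono nB) simp
      finally show ?thesis .
    qed
    have "norm x \<le> (\<Sum>j\<in>UNIV. \<bar>x $ j\<bar>)" by (rule norm_le_l1_cart)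
    also have "\<dots> \<le> (\<Sum>j\<in>(UNIV::'n set). real CARD('n option) * norm R * B)" by (intro sum_mono comp)
    finally show ?thesis by (simp add: mult_ac)
  qed
  then show "bounded dom" unfolding bounded_iff by blast
  have "dom = (\<lambda>x. T *v hom_coords x) -` domain_cone" using T_hom_cone by auto
  moreover have "continuous_on UNIV (\<lambda>x. T *v hom_coords x)"
    by (intro continuous_on_compose2[OF matrix_vector_mult_linear_continuous_on continuous_hom_coords]) auto
  ultimately show "open dom" using open_vimage[OF sc.open_C] by simp
  show "convex dom" using convex_chart by (simp add: dom_def)
qed

lemma frontier_dom: assumes p: "p \<in> sc.bdry" shows "affine_pt p \<in> frontier dom"
proof -
  note pD = sc.bdryD[OF p]
  obtain g where g: "\<And>k::nat. g k \<in> domain_cone" "g \<longlonglongrightarrow> p" using pD(1) unfolding closure_sequential by blast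
  have lim: "(\<lambda>k. affine_pt (g k)) \<longlonglongrightarrow> affine_pt p"
    unfolding affine_pt_def using pD(3)
    by (intro tendsto_vec_lambda tendsto_divide tendsto_vec_nth tendsto_inner tendsto_matrix_vector tendsto_const g(2)) auto
  have gd: "affine_pt (g k) \<in> dom" for k using g(1)[of k] cone_iff by (auto simp: domain_cone_def)
  then have "affine_pt p \<in> closure dom" unfolding closure_sequential
    by (intro exI[of _ "\<lambda>k. affine_pt (g k)"] conjI allI gd lim)
  moreover have "affine_pt p \<notin> dom" using cone_iff[of p] pD by simp
  ultimately show ?thesis using dom_open by (simp add: frontier_def interior_open)
qed

text \<open>An automorphism of \<open>\<Omega>\<close> maps each vector of the cone into the cone or into
  its negative. The choice is the same for all vectors, since otherwise the height of the image
  would vanish at a positive combination of two of them (\<open>uniform\<close>).\<close>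

lemma Aut_sign:
  assumes g: "g \<in> carrier (Aut \<Omega>)"
  shows "(*v) g ` domain_cone = domain_cone \<or> (*v) (- g) ` domain_cone = domain_cone"
proof -
  have dg: "det g = 1" and gO: "proj_act g ` \<Omega> = \<Omega>" using g by (auto simp: Aut_def)
  have "invertible g" using dg by (simp add: invertible_det_nz)
  then obtain h where h: "g ** h = mat 1" "h ** g = mat 1" using invertible_obtain by blast
  have hg: "h \<in> carrier (Aut \<Omega>)" using m_inv_Aut[OF g h] by simp
  have negmul: "(- k) *v v = - (k *v v)" for k :: "'n hmat" and v
    using scaleR_matrix_vector[of "-1" k v] by simp
  have dich: "k *v v \<in> domain_cone \<or> - (k *v v) \<in> domain_cone"
    if k: "k \<in> carrier (Aut \<Omega>)" and v: "v \<in> domain_cone" for k v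
  proof -
    have k1: "det k = 1" "proj_act k ` \<Omega> = \<Omega>" using k by (auto simp: Aut_def)
    have v0: "v \<noteq> 0" using v by (auto simp: domain_cone_def)
    have "invertible k" using k1 by (simp add: invertible_det_nz)
    then obtain l where l: "k ** l = mat 1" "l ** k = mat 1" using invertible_obtain by blast
    have kv: "k *v v \<noteq> 0"
    proof
      assume "k *v v = 0"
      then have "l *v (k *v v) = 0" by simp
      then show False using l v0 by (simp add: matrix_vector_mul_assoc)
    qed
    have "proj_act k (proj_of v) \<in> proj_act k ` \<Omega>" using v by (simp add: domain_cone_def)
    then have "proj_of (k *v v) \<in> \<Omega>" using k1(2) proj_act_proj_of[OF v0, of k] by simp
    moreover have "k *v v \<in> closure domain_cone \<or> - (k *v v) \<in> closure domain_cone"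
      using closure_lift[OF kv] calculation closure_subset by blast
    then have "height \<bullet> (k *v v) > 0 \<or> height \<bullet> (- (k *v v)) > 0"
      using height_closure kv by (metis neg_equal_0_iff_equal)
    moreover have "proj_of (- (k *v v)) = proj_of (k *v v)" using proj_of_scale[of "-1" "k *v v"] by simp
    ultimately show ?thesis by (auto simp: domain_cone_def)
  qed
  have uniform: "k *v v \<in> domain_cone"
    if k: "k \<in> carrier (Aut \<Omega>) \<or> - k \<in> carrier (Aut \<Omega>)" and u: "u \<in> domain_cone" "k *v u \<in> domain_cone" and v: "v \<in> domain_cone"
    for k u v
  proof -
    have d: "k *v w \<in> domain_cone \<or> - (k *v w) \<in> domain_cone" if w: "w \<in> domain_cone" for w
      using k dich[of k w] dich[of "- k" w] w by (auto simp: negmul)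
    show ?thesis
    proof (rule ccontr)
      assume "k *v v \<notin> domain_cone"
      then have mv: "- (k *v v) \<in> domain_cone" using d[OF v] by blast
      define a where "a = height \<bullet> (k *v u)"
      define b where "b = height \<bullet> (- (k *v v))"
      have ab: "a > 0" "b > 0" using u(2) mv by (auto simp: a_def b_def domain_cone_def)
      have "b *\<^sub>R u + a *\<^sub>R v \<in> domain_cone" using ab u v by (intro sc.add_C sc.cone_C) auto
      then have "height \<bullet> (k *v (b *\<^sub>R u + a *\<^sub>R v)) \<noteq> 0"
        using d by (fastforce simp: domain_cone_def)
      moreover have "height \<bullet> (k *v (b *\<^sub>R u + a *\<^sub>R v)) = 0"
        by (simp add: matrix_vector_right_distrib matrix_vector_mult_diff_distrib matrix_vector_mult_scaleR
            inner_diff_right inner_add_right a_def b_def)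
      ultimately show False by simp
    qed
  qed
  have fin: "(*v) k ` domain_cone = domain_cone"
    if k: "k \<in> carrier (Aut \<Omega>) \<or> - k \<in> carrier (Aut \<Omega>)" and l: "l \<in> carrier (Aut \<Omega>) \<or> - l \<in> carrier (Aut \<Omega>)"
      and kl: "k ** l = mat 1" "l ** k = mat 1" and b: "k *v sc.base \<in> domain_cone" for k l
  proof (intro equalityI subsetI)
    fix w assume "w \<in> (*v) k ` domain_cone"
    then show "w \<in> domain_cone" using uniform[OF k sc.base_C b] by auto
  next
    fix w assume w: "w \<in> domain_cone"
    have "l *v (k *v sc.base) \<in> domain_cone" using kl sc.base_C by (simp add: matrix_vector_mul_assoc)
    then have "l *v w \<in> domain_cone" by (rule uniform[OF l b _ w])
    moreover have "w = k *v (l *v w)" using kl by (simp add: matrix_vector_mul_assoc)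
    ultimately show "w \<in> (*v) k ` domain_cone" by blast
  qed
  consider "g *v sc.base \<in> domain_cone" | "(- g) *v sc.base \<in> domain_cone"
    using dich[OF g sc.base_C] by (auto simp: negmul)
  then show ?thesis
  proof cases
    case 1
    have "(*v) g ` domain_cone = domain_cone" using g hg by (intro fin[OF _ _ h 1]) auto
    then show ?thesis ..
  next
    case 2
    have "(- g) ** (- h) = mat 1" "(- h) ** (- g) = mat 1"
      using h scaleR_matrix_mult[of "-1" g "- h"] scaleR_matrix_mult[of "-1" h "- g"]
        matrix_mult_scaleR[of g "-1" h] matrix_mult_scaleR[of h "-1" g] by simp_all
    then have "(*v) (- g) ` domain_cone = domain_cone" using g hg 2 by (intro fin[of "- g" "- h"]) auto
    then show ?thesis ..
  qed
qed

text \<open>The elements of \<open>\<Gamma>\<close>, with the sign for which they preserve the cone. If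
  \<open>CARD('n option)\<close> is odd, the change of sign turns the determinant into -1.\<close>

definition lifted :: "'n hmat set \<Rightarrow> 'n hmat set" where
  "lifted \<Gamma> = {g. (g \<in> \<Gamma> \<or> - g \<in> \<Gamma>) \<and> (*v) g ` domain_cone = domain_cone}"

lemma act_proj:
  assumes v: "v \<in> domain_cone" and g: "(*v) g ` domain_cone = domain_cone"
  shows "proj_of (sc.act g v) = proj_act g (proj_of v)" and "proj_act (- g) (proj_of v) = proj_act g (proj_of v)"
proof -
  have gv: "height \<bullet> (g *v v) > 0" using v g sc.C_pos by blast
  have v0: "v \<noteq> 0" using v sc.zero_notin_C by auto
  show "proj_of (sc.act g v) = proj_act g (proj_of v)"
    using gv by (simp add: sc.act_def proj_of_scale proj_act_proj_of[OF v0])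
  have "(- g) *v v = (- 1) *\<^sub>R (g *v v)" using scaleR_matrix_vector[of "-1" g v] by simp
  then show "proj_act (- g) (proj_of v) = proj_act g (proj_of v)"
    using proj_of_scale[of "-1" "g *v v"] by (simp add: proj_act_proj_of[OF v0])
qed

lemma lifted_aut:
  assumes \<Gamma>: "subgroup \<Gamma> (Aut \<Omega>)" and g: "g \<in> lifted \<Gamma>"
  shows "sc.autC g"
proof -
  have "det (- h) = (-1) ^ CARD('n option) * det h" for h :: "'n hmat"
    using det_scaleR_matrix[of "-1" h] by simp
  then have "\<bar>det (- h)\<bar> = \<bar>det h\<bar>" for h :: "'n hmat" by (simp add: abs_mult power_abs)
  moreover have "det h = 1" if "h \<in> \<Gamma>" for h
    using subgroup.subset[OF \<Gamma>] that by (auto simp: Aut_def)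
  ultimately have "\<bar>det g\<bar> = 1" using g by (auto simp: lifted_def) (metis abs_one)
  then show ?thesis using g by (simp add: sc.autC_def lifted_def)
qed

lemma subgroup_Aut:
  assumes \<Gamma>: "subgroup \<Gamma> (Aut \<Omega>)"
  shows "mat 1 \<in> \<Gamma>" and "\<And>g h. g \<in> \<Gamma> \<Longrightarrow> h \<in> \<Gamma> \<Longrightarrow> g ** h \<in> \<Gamma>"
    and "\<And>g h. g \<in> \<Gamma> \<Longrightarrow> g ** h = mat 1 \<Longrightarrow> h ** g = mat 1 \<Longrightarrow> h \<in> \<Gamma>"
    and "\<And>g. g \<in> \<Gamma> \<Longrightarrow> g \<in> carrier (Aut \<Omega>)"
proof -
  show "mat 1 \<in> \<Gamma>" using subgroup.one_closed[OF \<Gamma>] by (simp add: Aut_def)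
  show "g ** h \<in> \<Gamma>" if "g \<in> \<Gamma>" "h \<in> \<Gamma>" for g h
    using subgroup.m_closed[OF \<Gamma> that] by (simp add: Aut_def)
  show c: "g \<in> carrier (Aut \<Omega>)" if "g \<in> \<Gamma>" for g using subgroup.subset[OF \<Gamma>] that by blast
  show "h \<in> \<Gamma>" if "g \<in> \<Gamma>" "g ** h = mat 1" "h ** g = mat 1" for g h
    using subgroup.m_inv_closed[OF \<Gamma> that(1)] m_inv_Aut(1)[OF c[OF that(1)] that(2,3)] by simp
qed

lemma minus_mult: "(- g) ** h = - (g ** h)" "g ** (- h) = - (g ** (h :: 'n hmat))"
  using scaleR_matrix_mult[of "-1" g h] matrix_mult_scaleR[of g "-1" h] by simp_all

lemma lifted_group:
  assumes \<Gamma>: "subgroup \<Gamma> (Aut \<Omega>)"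
  shows "g \<in> lifted \<Gamma> \<Longrightarrow> h \<in> lifted \<Gamma> \<Longrightarrow> g ** h \<in> lifted \<Gamma>"
    and "g \<in> lifted \<Gamma> \<Longrightarrow> sc.ginv g \<in> lifted \<Gamma>"
proof -
  note S = subgroup_Aut[OF \<Gamma>]
  assume g: "g \<in> lifted \<Gamma>"
  have gA: "sc.autC g" by (rule lifted_aut[OF \<Gamma> g])
  show "g ** h \<in> lifted \<Gamma>" if h: "h \<in> lifted \<Gamma>"
  proof -
    have "(*v) (g ** h) ` domain_cone = domain_cone"
      using sc.autC_mult[OF gA lifted_aut[OF \<Gamma> h]] by (simp add: sc.autC_def)
    moreover have "g ** h \<in> \<Gamma> \<or> - (g ** h) \<in> \<Gamma>"
    proof -
      consider "g \<in> \<Gamma>" "h \<in> \<Gamma>" | "- g \<in> \<Gamma>" "h \<in> \<Gamma>" | "g \<in> \<Gamma>" "- h \<in> \<Gamma>" | "- g \<in> \<Gamma>" "- h \<in> \<Gamma>"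
        using g h by (auto simp: lifted_def)
      then show ?thesis
        using S(2)[of g h] S(2)[of "- g" h] S(2)[of g "- h"] S(2)[of "- g" "- h"]
        by cases (simp_all add: minus_mult)
    qed
    ultimately show ?thesis by (simp add: lifted_def)
  qed
  have i: "g ** sc.ginv g = mat 1" "sc.ginv g ** g = mat 1" using sc.inv_right sc.inv_left gA by auto
  have "sc.ginv g \<in> \<Gamma> \<or> - sc.ginv g \<in> \<Gamma>"
  proof (cases "g \<in> \<Gamma>")
    case True
    then show ?thesis using S(3)[OF True i] by simp
  next
    case False
    then have "- g \<in> \<Gamma>" using g by (simp add: lifted_def)
    moreover have "(- g) ** (- sc.ginv g) = mat 1" "(- sc.ginv g) ** (- g) = mat 1" using i by (simp_all add: minus_mult)
    ultimately show ?thesis using S(3) by blast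
  qed
  then show "sc.ginv g \<in> lifted \<Gamma>"
    using sc.autC_inv[OF gA] by (simp add: lifted_def sc.autC_def)
qed

lemma lifted_finite:
  assumes \<Gamma>: "subgroup \<Gamma> (Aut \<Omega>)" and disc: "discrete \<Gamma>"
  shows "finite {g \<in> lifted \<Gamma>. norm g \<le> B}"
proof -
  note S = subgroup_Aut[OF \<Gamma>]
  have det: "det g = 1" if "g \<in> \<Gamma>" for g using S(4)[OF that] by (simp add: Aut_def)
  have inv: "\<exists>h\<in>\<Gamma>. g ** h = mat 1 \<and> h ** g = mat 1" if "g \<in> \<Gamma>" for g
  proof -
    have "invertible g" using det[OF that] by (simp add: invertible_det_nz)
    then obtain h where "g ** h = mat 1" "h ** g = mat 1" using invertible_obtain by blast
    then show ?thesis using S(3)[OF that] by blast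
  qed
  have fin: "finite {g \<in> \<Gamma>. norm g \<le> B}"
    using discrete_bounded_finite[OF disc S(1) det inv S(2)] by blast
  have "{g \<in> lifted \<Gamma>. norm g \<le> B} \<subseteq> {g \<in> \<Gamma>. norm g \<le> B} \<union> uminus ` {g \<in> \<Gamma>. norm g \<le> B}"
  proof
    fix g assume "g \<in> {g \<in> lifted \<Gamma>. norm g \<le> B}"
    then have "g \<in> \<Gamma> \<or> - g \<in> \<Gamma>" "norm g \<le> B" by (auto simp: lifted_def)
    moreover have "g = - (- g)" by simp
    ultimately show "g \<in> {g \<in> \<Gamma>. norm g \<le> B} \<union> uminus ` {g \<in> \<Gamma>. norm g \<le> B}"
      by (metis (mono_tags, lifting) UnI1 UnI2 image_eqI mem_Collect_eq norm_minus_cancel)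
  qed
  then show ?thesis using fin finite_subset by blast
qed

lemma inj_chart: "chart T x = chart T y \<Longrightarrow> x = y"
proof -
  assume "chart T x = chart T y"
  then obtain c where c: "T *v hom_coords y = c *\<^sub>R (T *v hom_coords x)"
    using proj_of_eqD[OF hom_nz[OF inv_T] hom_nz[OF inv_T]] unfolding chart_def by metis
  then have "height \<bullet> (T *v hom_coords y) = c * (height \<bullet> (T *v hom_coords x))" by simp
  then have "c = 1" by (simp add: height_T)
  then show "x = y" using c affine_pt_T by (metis scaleR_one)
qed

lemma chart_image_open: assumes "open W" shows "open (chart T ` W)"
proof -
  have "{v. v \<noteq> 0 \<and> proj_of v \<in> chart T ` W} = {v. height \<bullet> v \<noteq> 0} \<inter> {v. height \<bullet> v \<noteq> 0 \<and> affine_pt v \<in> W}"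
  proof (intro equalityI subsetI)
    fix v assume "v \<in> {v. v \<noteq> 0 \<and> proj_of v \<in> chart T ` W}"
    then obtain x where x: "v \<noteq> 0" "x \<in> W" "proj_of v = proj_of (T *v hom_coords x)" by (auto simp: chart_def)
    then obtain c where c: "c \<noteq> 0" "v = c *\<^sub>R (T *v hom_coords x)"
      using proj_of_eqD[OF hom_nz[OF inv_T] x(1)] by metis
    then have hv: "height \<bullet> v \<noteq> 0" by (simp add: height_T)
    then have "chart T (affine_pt v) = chart T x" using proj_of_chart[OF hv] x(3) by (simp add: chart_def)
    then have "affine_pt v = x" by (rule inj_chart)
    then show "v \<in> {v. height \<bullet> v \<noteq> 0} \<inter> {v. height \<bullet> v \<noteq> 0 \<and> affine_pt v \<in> W}" using hv x by simp
  next
    fix v assume "v \<in> {v. height \<bullet> v \<noteq> 0} \<inter> {v. height \<bullet> v \<noteq> 0 \<and> affine_pt v \<in> W}"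
    then show "v \<in> {v. v \<noteq> 0 \<and> proj_of v \<in> chart T ` W}" using proj_of_chart[of v] by auto
  qed
  moreover have "open ({v. height \<bullet> v \<noteq> 0} \<inter> affine_pt -` W)"
  proof -
    have o: "open {v. height \<bullet> v \<noteq> 0}" by (intro open_Collect_neq continuous_intros)
    have "continuous_on {v. height \<bullet> v \<noteq> 0} affine_pt"
      unfolding affine_pt_def
      by (intro continuous_on_vec_lambda continuous_on_divide continuous_on_inner continuous_on_const continuous_on_id
          continuous_on_component matrix_vector_mult_linear_continuous_on) auto
    then show ?thesis using continuous_open_preimage[OF _ o assms] by blast
  qed
  moreover have "{v. height \<bullet> v \<noteq> 0} \<inter> {v. height \<bullet> v \<noteq> 0 \<and> affine_pt v \<in> W} = {v. height \<bullet> v \<noteq> 0} \<inter> affine_pt -` W" by auto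
  ultimately show ?thesis by (simp only: open_proj_iff)
qed

text \<open>Otherwise the orbit map would be injective on the part of \<open>\<Omega>\<close> near
  \<open>p\<close>. This part has infinite volume, whereas the volume of the quotient is finite.\<close>

lemma recurrent_lift:
  assumes T: "T = (SOME T. adapted_chart T \<Omega>)"
    and \<Gamma>: "subgroup \<Gamma> (Aut \<Omega>)" and vol: "quotient_volume \<Omega> \<Gamma> (orbit \<Gamma> ` \<Omega>) < \<infinity>"
    and U: "open U" and p: "p \<in> sc.bdry" "p \<in> U"
  shows "\<exists>g\<in>lifted \<Gamma>. \<exists>v\<in>domain_cone. height \<bullet> v = 1 \<and> v \<in> U \<and> sc.act g v \<in> U \<and> sc.act g v \<noteq> v"
proof (rule ccontr)
  assume n: "\<not> ?thesis"
  note S = subgroup_Aut[OF \<Gamma>]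
  define O1 where "O1 = (\<lambda>x. T *v hom_coords x) -` U"
  have oO: "open O1" unfolding O1_def
    by (intro open_vimage U continuous_on_compose2[OF matrix_vector_mult_linear_continuous_on continuous_hom_coords]) auto
  have pO: "affine_pt p \<in> O1" using T_affine_pt[of p] sc.bdryD(3)[OF p(1)] p(2) by (simp add: O1_def)
  define A where "A = chart T ` (dom \<inter> O1)"
  have "open A" unfolding A_def by (intro chart_image_open open_Int dom_open oO)
  then have Ab: "A \<in> sets borel" by (rule borel_open)
  have AO: "A \<subseteq> \<Omega>" by (auto simp: A_def dom_def)
  have inj: "inj_on (orbit \<Gamma>) A"
  proof (rule inj_onI)
    fix a b assume a: "a \<in> A" and b: "b \<in> A" and ab: "orbit \<Gamma> a = orbit \<Gamma> b"
    obtain x where x: "x \<in> dom" "x \<in> O1" "a = proj_of (T *v hom_coords x)" using a by (auto simp: A_def chart_def)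
    obtain y where y: "y \<in> dom" "y \<in> O1" "b = proj_of (T *v hom_coords y)" using b by (auto simp: A_def chart_def)
    define v where "v = T *v hom_coords y"
    have vC: "v \<in> domain_cone" using y(1) T_hom_cone by (simp add: v_def)
    have v1: "height \<bullet> v = 1" by (simp add: v_def height_T)
    have vU: "v \<in> U" using y(2) by (simp add: O1_def v_def)
    have "proj_act (mat 1) a = a"
      using proj_act_proj_of[OF hom_nz[OF inv_T], of "mat 1" x] x(3) by simp
    then have "a \<in> orbit \<Gamma> a" using S(1) unfolding orbit_def by (metis image_eqI)
    then obtain g where g: "g \<in> \<Gamma>" "a = proj_act g b" using ab by (auto simp: orbit_def)
    have "\<exists>k\<in>lifted \<Gamma>. a = proj_act k b"
    proof -
      consider "(*v) g ` domain_cone = domain_cone" | "(*v) (- g) ` domain_cone = domain_cone"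
        using Aut_sign[OF S(4)[OF g(1)]] by blast
      then show ?thesis
      proof cases
        case 1
        then show ?thesis using g by (intro bexI[of _ g]) (auto simp: lifted_def)
      next
        case 2
        have "proj_act (- (- g)) (proj_of v) = proj_act (- g) (proj_of v)" by (rule act_proj(2)[OF vC 2])
        then show ?thesis using g 2 y(3) by (intro bexI[of _ "- g"]) (auto simp: lifted_def v_def)
      qed
    qed
    then obtain k where k: "k \<in> lifted \<Gamma>" "a = proj_act k b" by blast
    have kC: "(*v) k ` domain_cone = domain_cone" using k(1) by (simp add: lifted_def)
    have "proj_of (sc.act k v) = a" using act_proj(1)[OF vC kC] k(2) y(3) by (simp add: v_def)
    moreover have kA: "sc.autC k" by (rule lifted_aut[OF \<Gamma> k(1)])
    have hk: "height \<bullet> sc.act k v = 1"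
      using sc.C_pos[of "k *v v"] vC sc.autC_C[OF kA, of v] by (simp add: sc.act_def)
    ultimately have "chart T (affine_pt (sc.act k v)) = chart T x" using proj_of_chart[of "sc.act k v"] x(3) by (simp add: chart_def)
    then have "affine_pt (sc.act k v) = x" by (rule inj_chart)
    then have kx: "sc.act k v = T *v hom_coords x" using T_affine_pt[of "sc.act k v"] hk by simp
    then have "sc.act k v \<in> U" using x(2) by (simp add: O1_def)
    then have "sc.act k v = v" using n k(1) vC v1 vU by blast
    then show "a = b" using kx x(3) y(3) by (simp add: v_def)
  qed
  have "orbit \<Gamma> ` A \<subseteq> orbit \<Gamma> ` \<Omega>" using AO by blast
  then have "busemann_volume \<Omega> A \<le> quotient_volume \<Omega> \<Gamma> (orbit \<Gamma> ` \<Omega>)"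
    unfolding quotient_volume_def using Ab AO inj by (intro SUP_upper) auto
  moreover have "busemann_volume \<Omega> A = \<infinity>"
  proof -
    have "chart T -` (A \<inter> \<Omega>) = dom \<inter> O1" using inj_chart by (auto simp: A_def dom_def)
    then have "busemann_volume \<Omega> A = (\<integral>\<^sup>+ x. busemann_density dom x * indicator (dom \<inter> O1) x \<partial>lborel)"
      unfolding busemann_volume_def Let_def T[symmetric] dom_def[symmetric] by simp
    then show ?thesis
      using infinite_volume_near_boundary[OF dom_open dom_convex dom_bounded frontier_dom[OF p(1)] oO pO] by simp
  qed
  ultimately show False using vol by simp
qed

end

theorem mainTheorem9:
  fixes \<Omega> :: "('n::finite) proj set"
  assumes "open \<Omega>"
    and "properly_convex \<Omega>"
    and "strictly_convex \<Omega>"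
    and "C1_boundary \<Omega>"
    and "noncompact_finite_volume_quotient \<Omega>"
    and "\<And>\<epsilon>. 0 < \<epsilon> \<Longrightarrow> \<epsilon> < 1 \<Longrightarrow> C1_plus_boundary \<epsilon> \<Omega>"
  shows "ellipsoid \<Omega>"
proof -
  obtain \<Gamma> where \<Gamma>: "subgroup \<Gamma> (Aut \<Omega>)" "discrete \<Gamma>" "\<not> compact_space (quotient_space \<Omega> \<Gamma>)"
    "quotient_volume \<Omega> \<Gamma> (orbit \<Gamma> ` \<Omega>) < \<infinity>"
    using assms(5) unfolding noncompact_finite_volume_quotient_def by blast
  have ne: "\<Omega> \<noteq> {}"
  proof
    assume "\<Omega> = {}"
    then have "topspace (quotient_space \<Omega> \<Gamma>) = {}"
      using quotient_imp_surjective_map[OF quotient_map_quotient_space[of \<Omega> \<Gamma>]] by simp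
    then show False using \<Gamma>(3) by (simp add: compact_space_def)
  qed
  define T where "T = (SOME T. adapted_chart T \<Omega>)"
  have "\<exists>T. adapted_chart T \<Omega>" using assms(2) by (simp add: properly_convex_def)
  then have "adapted_chart T \<Omega>" unfolding T_def by (rule someI_ex)
  then interpret adapted_domain \<Omega> T using assms(1) ne by unfold_locales
  interpret sm: smooth_cone domain_cone height
  proof
    show "s *\<^sub>R x + t *\<^sub>R y \<in> domain_cone" if "x \<in> sc.bdry" "y \<in> sc.bdry" "x \<noteq> y" "s > 0" "t > 0" for x y s t
      by (rule strict_lift[OF assms(3) that])
    show "\<exists>K>0. \<exists>r>0. \<forall>w. w \<in> closure domain_cone \<longrightarrow> w \<notin> domain_cone \<longrightarrow> norm (w - p) < r \<longrightarrow>
        a \<bullet> w \<le> K * norm (w - p) powr (1 + \<epsilon>)"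
      if "p \<in> sc.bdry" "sc.supports a p" "0 < \<epsilon>" "\<epsilon> < 1" for p a \<epsilon>
      by (rule regular_lift[OF assms(6)[OF that(3,4)] that])
  qed
  have card: "CARD('n option) \<ge> 2" by simp
  have sym: sm.triple_symmetric
  proof (cases "\<exists>x\<in>sc.bdry. \<exists>y\<in>sc.bdry. \<exists>z\<in>sc.bdry. x \<noteq> y \<and> y \<noteq> z \<and> z \<noteq> x")
    case True
    interpret gr: recurrent_group domain_cone height "lifted \<Gamma>"
    proof
      show "finite {g \<in> lifted \<Gamma>. norm g \<le> B}" for B by (rule lifted_finite[OF \<Gamma>(1,2)])
      show "\<exists>g\<in>lifted \<Gamma>. \<exists>v\<in>domain_cone. height \<bullet> v = 1 \<and> v \<in> U \<and> sc.act g v \<in> U \<and> sc.act g v \<noteq> v"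
        if "open U" "p \<in> sc.bdry" "p \<in> U" for U p
        by (rule recurrent_lift[OF T_def \<Gamma>(1,4) that])
    qed (use True lifted_aut[OF \<Gamma>(1)] lifted_group[OF \<Gamma>(1)] in auto)
    show ?thesis unfolding sm.triple_symmetric_def using gr.triple_identity by blast
  next
    case False
    \<comment> \<open>The remaining case is that of an interval, whose boundary consists of two points.\<close>
    then show ?thesis unfolding sm.triple_symmetric_def by blast
  qed
  obtain M :: "'n hmat" where M: "invertible M"
    "domain_cone = (*v) M ` {v. v $ None > 0 \<and> (\<Sum>i\<in>UNIV - {None}. (v $ i)\<^sup>2) < (v $ None)\<^sup>2}"
    using sm.lorentz_cone[OF sym card, of None] by blast
  have sum_Some: "(\<Sum>i\<in>UNIV - {None}. (v $ i)\<^sup>2) = (\<Sum>j\<in>UNIV. (v $ Some j)\<^sup>2)" for v :: "'n hvec"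
  proof -
    have "(UNIV :: 'n option set) - {None} = range Some" by (auto simp: notin_range_Some)
    then show ?thesis by (simp add: sum.reindex)
  qed
  have norm2: "(norm x)\<^sup>2 = (\<Sum>j\<in>UNIV. (x $ j)\<^sup>2)" for x :: "real^'n"
    unfolding power2_norm_eq_inner inner_vec_def by (simp add: power2_eq_square)
  have "\<Omega> = chart M ` ball 0 1"
  proof (intro equalityI subsetI)
    fix p assume p: "p \<in> \<Omega>"
    then obtain x where x: "p = chart T x" using closure_chart closure_subset by blast
    then have "T *v hom_coords x \<in> domain_cone" using p T_hom_cone by (simp add: dom_def)
    then obtain u where u: "T *v hom_coords x = M *v u" "u $ None > 0" "(\<Sum>j\<in>UNIV. (u $ Some j)\<^sup>2) < (u $ None)\<^sup>2"
      using M(2) sum_Some by auto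
    define y where "y = (\<chi> j. u $ Some j / u $ None)"
    have "u $ i = ((u $ None) *\<^sub>R hom_coords y) $ i" for i using u(2) by (cases i) (simp_all add: y_def)
    then have uy: "u = (u $ None) *\<^sub>R hom_coords y" unfolding vec_eq_iff by blast
    have "(norm y)\<^sup>2 = (\<Sum>j\<in>UNIV. (u $ Some j)\<^sup>2) / (u $ None)\<^sup>2"
      by (simp add: norm2 y_def power_divide sum_divide_distrib)
    also have "\<dots> < 1" using u(2,3) by simp
    finally have "norm y < 1" by (simp add: power_less_one_iff abs_square_less_1)
    moreover have "p = chart M y"
    proof -
      have "p = proj_of ((u $ None) *\<^sub>R (M *v hom_coords y))"
        using x u(1) uy unfolding chart_def by (metis matrix_vector_mult_scaleR)
      then show ?thesis using u(2) by (simp add: proj_of_scale chart_def)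
    qed
    ultimately show "p \<in> chart M ` ball 0 1" by auto
  next
    fix p assume "p \<in> chart M ` ball 0 1"
    then obtain y where y: "norm y < 1" "p = chart M y" by auto
    have "(norm y)\<^sup>2 < 1" using y(1) by (simp add: abs_square_less_1)
    then have "M *v hom_coords y \<in> domain_cone" unfolding M(2) by (intro imageI) (simp add: sum_Some norm2)
    then show "p \<in> \<Omega>" using y(2) by (simp add: domain_cone_def chart_def)
  qed
  then have "\<Omega> = chart M ` (\<lambda>x. (mat 1 :: real^'n^'n) *v x + 0) ` ball 0 1" by simp
  moreover have "invertible (mat 1 :: real^'n^'n)" by (simp add: invertible_det_nz)
  ultimately show ?thesis unfolding ellipsoid_def using M(1) by blast
qed

end
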